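(* Let $G$ be a compact Hausdorff group, $A$ a complex Banach space, $\gamma:\widehat G\to(0,\infty)$ a measurable function, and let $s\ge0$. Then $\mathfrak{B}^s_\gamma(G,A)$ embeds continuously into $L^\infty(G,A)$ and $$\forall f\in\mathfrak{B}^s_\gamma(G,A),\qquad \|f\|_{L^\infty}\le\|f\|_{\mathfrak{B}^s_\gamma}.$$
   Context: $G$ is a compact Hausdorff group with normalized Haar measure $dx$. $\widehat{G}$ is the set of unitary equivalence classes of continuous irreducible unitary representations of $G$; for each class a representative, again denoted $\sigma$, is fixed, acting on a Hilbert space $H_\sigma$ of finite dimension $d_\sigma$, together with an orthonormal basis $\{\xi_1^\sigma,\dots,\xi_{d_\sigma}^\sigma\}$ of $H_\sigma$. For a complex Banach space $A$, $L^p(G,A)$ ($1\le p<\infty$) is the Bochner space with norm $\|f\|_{L^p}=(\int_G\|f(x)\|_A^p\,dx)^{1/p}$, and $L^\infty(G,A)$ is the space of (classes of) measurable $A$-valued functions that are bounded almost everywhere, with norm $\|f\|_{L^\infty}=\inf\{C>0:\|f(x)\|_A\le C\text{ almost everywhere}\}$. For $f\in L^1(G,A)$ (in particular $f\in L^2(G,A)$) and $\sigma\in\widehat{G}$, the Fourier coefficient $\widehat f(\sigma)$ is the sesquilinear map $H_\sigma\times H_\sigma\to A$ given by $$\widehat f(\sigma)(\xi,\eta)=\int_G\langle\sigma(x)^*\xi,\eta\rangle_{H_\sigma}f(x)\,dx.$$ For $s\ge0$, the spectral Barron space $\mathfrak{B}^s_\gamma(G,A)$ is the set of all $f\in L^2(G,A)$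 for which $$\|f\|_{\mathfrak{B}^s_\gamma}:=\sum_{\sigma\in\widehat G}d_\sigma(1+\gamma(\sigma)^2)^{s/2}\sum_{i=1}^{d_\sigma}\sum_{j=1}^{d_\sigma}\|\widehat f(\sigma)(\xi_j^\sigma,\xi_i^\sigma)\|_A<\infty.$$ *)

theory Defs
  imports "HOL-Analysis.Analysis" "Jordan_Normal_Form.Schur_Decomposition"
    "Jordan_Normal_Form.VS_Connect"
begin

section \<open>Complex Banach spaces\<close>

class complex_banach = banach +
  fixes scaleC :: "complex \<Rightarrow> 'a \<Rightarrow> 'a" (infixr \<open>*\<^sub>C\<close> 75)
  assumes scaleC_add_right: "c *\<^sub>C (x + y) = c *\<^sub>C x + c *\<^sub>C y"
    and scaleC_add_left: "(c + d) *\<^sub>C x = c *\<^sub>C x + d *\<^sub>C x"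
    and scaleC_scaleC: "c *\<^sub>C (d *\<^sub>C x) = (c * d) *\<^sub>C x"
    and scaleR_scaleC: "r *\<^sub>R x = complex_of_real r *\<^sub>C x"
    and norm_scaleC: "norm (c *\<^sub>C x) = cmod c * norm x"

instantiation complex :: complex_banach
begin
definition "c *\<^sub>C (x::complex) = c * x"
instance
  by standard
    (simp_all add: scaleC_complex_def algebra_simps scaleR_conv_of_real norm_mult)
end


section \<open>Bochner integration without separability\<close>

text \<open>
  The Bochner integral of \<^theory>\<open>HOL-Analysis.Bochner_Integration\<close> is restricted to
  second countable target spaces.  The definitions below use the same simple functions,
  and strong measurability (almost everywhere limits of simple functions)
  takes the place of Borel measurability, as is needed for a nonseparable target.
\<close>

definition strongly_measurable :: "'a measure \<Rightarrow> ('a \<Rightarrow> 'b::real_normed_vector) \<Rightarrow> bool" where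
  "strongly_measurable M f \<longleftrightarrow>
     (\<exists>s. (\<forall>i. simple_function M (s i)) \<and> (AE x in M. (\<lambda>i::nat. s i x) \<longlonglongrightarrow> f x))"

definition has_strong_integral ::
    "'a measure \<Rightarrow> ('a \<Rightarrow> 'b::real_normed_vector) \<Rightarrow> 'b \<Rightarrow> bool" where
  "has_strong_integral M f I \<longleftrightarrow> strongly_measurable M f \<and>
     (\<exists>s. (\<forall>i::nat. Bochner_Integration.simple_bochner_integrable M (s i)) \<and>
          (\<lambda>i. \<integral>\<^sup>+x. ennreal (norm (f x - s i x)) \<partial>M) \<longlonglongrightarrow> 0 \<and>
          (\<lambda>i. Bochner_Integration.simple_bochner_integral M (s i)) \<longlonglongrightarrow> I)"

definition strong_integral :: "'a measure \<Rightarrow> ('a \<Rightarrow> 'b::real_normed_vector) \<Rightarrow> 'b" where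
  "strong_integral M f =
     (if \<exists>I. has_strong_integral M f I then THE I. has_strong_integral M f I else 0)"

text \<open>
  As usual in HOL, elements of Lebesgue spaces are functions rather than classes;
  the norms below do not see changes on null sets.
\<close>

definition bochner_L2 :: "'a measure \<Rightarrow> ('a \<Rightarrow> 'b::real_normed_vector) set" where
  "bochner_L2 M = {f. strongly_measurable M f \<and> (\<integral>\<^sup>+x. ennreal ((norm (f x))\<^sup>2) \<partial>M) < \<infinity>}"

definition bochner_Linf :: "'a measure \<Rightarrow> ('a \<Rightarrow> 'b::real_normed_vector) set" where
  "bochner_Linf M = {f. strongly_measurable M f \<and> (\<exists>C>0. AE x in M. norm (f x) \<le> C)}"

definition Linf_norm :: "'a measure \<Rightarrow> ('a \<Rightarrow> 'b::real_normed_vector) \<Rightarrow> real" where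
  "Linf_norm M f = Inf {C. 0 < C \<and> (AE x in M. norm (f x) \<le> C)}"

text \<open>
  \<open>X\<close> with seminorm \<open>nX\<close> embeds continuously into \<open>Y\<close> with seminorm \<open>nY\<close>: the identity maps
  the subspace \<open>X\<close> into \<open>Y\<close>, is continuous, and the last clause makes it
  injective after identifying functions at distance zero.
\<close>

definition continuously_embeds ::
    "('a \<Rightarrow> 'b::complex_banach) set \<Rightarrow> (('a \<Rightarrow> 'b) \<Rightarrow> real) \<Rightarrow>
     ('a \<Rightarrow> 'b) set \<Rightarrow> (('a \<Rightarrow> 'b) \<Rightarrow> real) \<Rightarrow> bool" where
  "continuously_embeds X nX Y nY \<longleftrightarrow>
     (\<lambda>x. 0) \<in> X \<and>
     (\<forall>f\<in>X. \<forall>g\<in>X. (\<lambda>x. f x + g x) \<in> X) \<and>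
     (\<forall>c. \<forall>f\<in>X. (\<lambda>x. c *\<^sub>C f x) \<in> X) \<and>
     X \<subseteq> Y \<and>
     (\<forall>f\<in>X. \<forall>\<epsilon>>0. \<exists>\<delta>>0. \<forall>g\<in>X. nX (\<lambda>x. g x - f x) < \<delta> \<longrightarrow> nY (\<lambda>x. g x - f x) < \<epsilon>) \<and>
     (\<forall>f\<in>X. nY f = 0 \<longrightarrow> nX f = 0)"


section \<open>Haar measure\<close>

text \<open>
  Groups are written additively because the library class of topological groups,
  \<^class>\<open>topological_group_add\<close>, is; it does not assume commutativity.
\<close>

definition normalized_haar_measure ::
    "'g::{topological_group_add, t2_space} measure \<Rightarrow> bool" where
  "normalized_haar_measure \<mu> \<longleftrightarrow>
     sets \<mu> = sets borel \<and>
     emeasure \<mu> UNIV = 1 \<and>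
     (\<forall>a. distr \<mu> borel (\<lambda>x. a + x) = \<mu>) \<and>
     (\<forall>B\<in>sets borel. emeasure \<mu> B = (INF U\<in>{U. open U \<and> B \<subseteq> U}. emeasure \<mu> U)) \<and>
     (\<forall>U. open U \<longrightarrow> emeasure \<mu> U = (SUP K\<in>{K. compact K \<and> K \<subseteq> U}. emeasure \<mu> K))"


section \<open>The unitary dual\<close>

text \<open>
  A \<open>d\<close>-dimensional Hilbert space is taken to be \<open>carrier_vec d\<close> over the complex numbers
  with the inner product \<open>\<lambda>u v. u \<bullet>c v\<close>, linear in \<open>u\<close>.
\<close>

definition unitary_mat :: "nat \<Rightarrow> complex Matrix.mat \<Rightarrow> bool" where
  "unitary_mat d U \<longleftrightarrow>
     U \<in> carrier_mat d d \<and> mat_adjoint U * U = 1\<^sub>m d \<and> U * mat_adjoint U = 1\<^sub>m d"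

type_synonym 'g rep = "'g \<Rightarrow> complex Matrix.mat"

definition rep_dim :: "'g::zero rep \<Rightarrow> nat" where
  "rep_dim \<sigma> = dim_row (\<sigma> 0)"

definition unitary_rep :: "'g::topological_group_add rep \<Rightarrow> bool" where
  "unitary_rep \<sigma> \<longleftrightarrow>
     (\<forall>x. unitary_mat (rep_dim \<sigma>) (\<sigma> x)) \<and>
     (\<forall>x y. \<sigma> (x + y) = \<sigma> x * \<sigma> y) \<and>
     (\<forall>i<rep_dim \<sigma>. \<forall>j<rep_dim \<sigma>. continuous_on UNIV (\<lambda>x. \<sigma> x $$ (i, j)))"

definition irreducible_rep :: "'g::topological_group_add rep \<Rightarrow> bool" where
  "irreducible_rep \<sigma> \<longleftrightarrow>
     unitary_rep \<sigma> \<and> 0 < rep_dim \<sigma> \<and>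
     (\<forall>W. VectorSpace.subspace class_ring W (module_vec TYPE(complex) (rep_dim \<sigma>)) \<longrightarrow>
          (\<forall>x. \<forall>w\<in>W. \<sigma> x *\<^sub>v w \<in> W) \<longrightarrow>
          W = {0\<^sub>v (rep_dim \<sigma>)} \<or> W = carrier_vec (rep_dim \<sigma>))"

definition unitarily_equivalent :: "'g::zero rep \<Rightarrow> 'g rep \<Rightarrow> bool" where
  "unitarily_equivalent \<sigma> \<tau> \<longleftrightarrow>
     rep_dim \<sigma> = rep_dim \<tau> \<and>
     (\<exists>U. unitary_mat (rep_dim \<sigma>) U \<and> (\<forall>x. U * \<sigma> x = \<tau> x * U))"

definition unitary_dual :: "'g::topological_group_add rep set set" where
  "unitary_dual = {\<sigma>. irreducible_rep \<sigma>} //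
     {(\<sigma>, \<tau>). irreducible_rep \<sigma> \<and> irreducible_rep \<tau> \<and> unitarily_equivalent \<sigma> \<tau>}"

definition orthonormal_basis :: "nat \<Rightarrow> (nat \<Rightarrow> complex Matrix.vec) \<Rightarrow> bool" where
  "orthonormal_basis d \<xi> \<longleftrightarrow>
     (\<forall>i<d. \<xi> i \<in> carrier_vec d) \<and>
     (\<forall>i<d. \<forall>j<d. \<xi> i \<bullet>c \<xi> j = (if i = j then 1 else 0)) \<and>
     LinearCombinations.module.span class_ring (module_vec TYPE(complex) d) (\<xi> ` {..<d})
       = carrier_vec d"

definition dual_choice ::
    "('g::topological_group_add rep set \<Rightarrow> 'g rep) \<Rightarrow>
     ('g rep set \<Rightarrow> nat \<Rightarrow> complex Matrix.vec) \<Rightarrow> bool" where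
  "dual_choice rep \<xi> \<longleftrightarrow>
     (\<forall>c\<in>unitary_dual. rep c \<in> c \<and> orthonormal_basis (rep_dim (rep c)) (\<xi> c))"


section \<open>Fourier coefficients and spectral Barron spaces\<close>

definition fourier_coeff ::
    "'g measure \<Rightarrow> ('g \<Rightarrow> 'b::complex_banach) \<Rightarrow> 'g rep \<Rightarrow>
     complex Matrix.vec \<Rightarrow> complex Matrix.vec \<Rightarrow> 'b" where
  "fourier_coeff \<mu> f \<sigma> u v =
     strong_integral \<mu> (\<lambda>x. ((mat_adjoint (\<sigma> x) *\<^sub>v u) \<bullet>c v) *\<^sub>C f x)"

definition barron_term ::
    "'g::topological_group_add measure \<Rightarrow> ('g rep set \<Rightarrow> 'g rep) \<Rightarrow>
     ('g rep set \<Rightarrow> nat \<Rightarrow> complex Matrix.vec) \<Rightarrow> ('g rep set \<Rightarrow> real) \<Rightarrow> real \<Rightarrow>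
     ('g \<Rightarrow> 'b::complex_banach) \<Rightarrow> 'g rep set \<Rightarrow> real" where
  "barron_term \<mu> rep \<xi> \<gamma> s f c =
     real (rep_dim (rep c)) * (1 + (\<gamma> c)\<^sup>2) powr (s / 2) *
     (\<Sum>i<rep_dim (rep c). \<Sum>j<rep_dim (rep c).
        norm (fourier_coeff \<mu> f (rep c) (\<xi> c j) (\<xi> c i)))"

text \<open>All terms are nonnegative, so summability is finiteness of the norm.\<close>

definition barron_space ::
    "'g::topological_group_add measure \<Rightarrow> ('g rep set \<Rightarrow> 'g rep) \<Rightarrow>
     ('g rep set \<Rightarrow> nat \<Rightarrow> complex Matrix.vec) \<Rightarrow> ('g rep set \<Rightarrow> real) \<Rightarrow> real \<Rightarrow>
     ('g \<Rightarrow> 'b::complex_banach) set" where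
  "barron_space \<mu> rep \<xi> \<gamma> s =
     {f \<in> bochner_L2 \<mu>. barron_term \<mu> rep \<xi> \<gamma> s f summable_on unitary_dual}"

definition barron_norm ::
    "'g::topological_group_add measure \<Rightarrow> ('g rep set \<Rightarrow> 'g rep) \<Rightarrow>
     ('g rep set \<Rightarrow> nat \<Rightarrow> complex Matrix.vec) \<Rightarrow> ('g rep set \<Rightarrow> real) \<Rightarrow> real \<Rightarrow>
     ('g \<Rightarrow> 'b::complex_banach) \<Rightarrow> real" where
  "barron_norm \<mu> rep \<xi> \<gamma> s f = (\<Sum>\<^sub>\<infinity>c\<in>unitary_dual. barron_term \<mu> rep \<xi> \<gamma> s f c)"

end

theory Submission
  imports Defs "Jordan_Normal_Form.Spectral_Radius"
begin

text \<open>
  For a trigonometric polynomial \<open>t = (\<Sum>p. a p * m p)\<close> in the matrix coefficients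
  \<open>m (c, i, j) x = \<langle>\<sigma>\<^sub>c(x)\<^sup>* \<xi>\<^sub>j, \<xi>\<^sub>i\<rangle>\<close>, Schur orthogonality gives
  \<open>a p = d\<^sub>c * (\<integral>x. t x * cnj (m p x))\<close>, hence \<open>\<bar>a p\<bar> \<le> d\<^sub>c \<parallel>t\<parallel>\<^sub>1\<close>.  Therefore
  \<open>\<parallel>\<integral>x. t x * f x\<parallel> \<le> (\<Sum>p. \<bar>a p\<bar> * \<parallel>\<integral>x. m p x * f x\<parallel>) \<le> \<parallel>t\<parallel>\<^sub>1 * \<parallel>f\<parallel>\<close> with the Barron norm of \<open>f\<close> on
  the right.  By the Peter-Weyl theorem and regularity of the measure this passes from \<open>t\<close> to
  continuous functions and then to indicator functions of Borel sets; so all averages of \<open>f\<close> are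
  bounded by its Barron norm, and \<open>f\<close> is bounded by it almost everywhere.  Neither the Hahn-Banach
  theorem nor the summation of the Fourier series is needed.

  The Peter-Weyl theorem is obtained inside the pre-Hilbert space of continuous functions, without
  spectral theory: power iteration of a convolution operator yields a nonzero fixed function, the
  fixed space is translation invariant and finite-dimensional, and a minimal invariant subspace of it
  is spanned by matrix coefficients of an irreducible representation.
\<close>

section \<open>Strong integrals\<close>

text \<open>The constant 1 comes from an exact balance: matrix coefficients of unitary
  representations are bounded by 1, Schur's relations give them squared norm 1/d, and the Barron
  norm carries just this factor d. Testing \<open>f\<close> against functions of L1 norm one
  therefore loses nothing. Three obstacles shape the rest. \<open>A\<close> may be nonseparable, so
  an integrand is known only as an almost everywhere limit of simple functions, and its norm is
  measurable only for the completed measure. \<open>G\<close> need not be second countable, so the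
  tube lemma replaces metric uniform continuity, and iterated integrals are exchanged for continuous
  integrands only, through Stone-Weierstrass. The continuous functions are not complete for the L2
  norm, so projections and limits may fail to exist among them; the remedy, used both for the fixed
  function and for density, is that convolution with a continuous kernel turns L2 convergence into
  uniform convergence. Of the measure only left invariance is given; invariance under inversion is
  derived from it.\<close>

interpretation scaleC: bounded_bilinear "scaleC :: complex \<Rightarrow> 'a::complex_banach \<Rightarrow> 'a"
proof
  fix a b :: complex and x y :: 'a and r :: real
  show "(a + b) *\<^sub>C x = a *\<^sub>C x + b *\<^sub>C x" by (rule scaleC_add_left)
  show "a *\<^sub>C (x + y) = a *\<^sub>C x + a *\<^sub>C y" by (rule scaleC_add_right)
  show "(r *\<^sub>R a) *\<^sub>C x = r *\<^sub>R (a *\<^sub>C x)"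
    by (simp add: scaleR_scaleC[where 'a = 'a] scaleC_scaleC scaleR_conv_of_real)
  show "a *\<^sub>C (r *\<^sub>R x) = r *\<^sub>R (a *\<^sub>C x)"
    by (simp add: scaleR_scaleC scaleC_scaleC mult.commute)
  show "\<exists>K. \<forall>a (x::'a). norm (a *\<^sub>C x) \<le> norm a * norm x * K"
    by (rule exI[of _ 1]) (simp add: norm_scaleC)
qed

lemma scaleC_one: "1 *\<^sub>C (x::'a::complex_banach) = x"
  using scaleR_scaleC[of 1 x] by simp

lemma linear_scaleC: "linear (\<lambda>x::'a::complex_banach. c *\<^sub>C x)"
  by (rule bounded_linear.linear[OF scaleC.bounded_linear_right])

lemma (in complete_measure) borel_measurable_AE_eq:
  fixes f g :: "'a \<Rightarrow> 'b::topological_space"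
  assumes f: "f \<in> borel_measurable M" and ae: "AE x in M. f x = g x"
  shows "g \<in> borel_measurable M"
proof (rule measurableI)
  fix S :: "'b set" assume "S \<in> sets borel"
  then have m: "f -` S \<inter> space M \<in> sets M" using f by (rule measurable_sets[rotated])
  have ae': "AE x in M. x \<in> f -` S \<inter> space M \<longleftrightarrow> x \<in> g -` S \<inter> space M"
    using ae by eventually_elim auto
  show "g -` S \<inter> space M \<in> sets M"
    by (rule in_sets_AE[OF ae' m]) simp
qed simp

lemma strongly_measurableE:
  assumes "strongly_measurable M f"
  obtains s where "\<And>i::nat. simple_function M (s i)" "AE x in M. (\<lambda>i. s i x) \<longlonglongrightarrow> f x"
  using assms unfolding strongly_measurable_def by blast

text \<open>The approximating simple functions converge only off a null set, where the limit may
  differ from a Borel function. This is why integrals of norms are taken over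
  \<open>completion M\<close> from here on.\<close>

lemma strongly_measurable_norm:
  fixes f :: "'a \<Rightarrow> 'b::real_normed_vector"
  assumes "strongly_measurable M f"
  shows "(\<lambda>x. norm (f x)) \<in> borel_measurable (completion M)"
proof -
  obtain s where s: "\<And>i::nat. simple_function M (s i)" "AE x in M. (\<lambda>i. s i x) \<longlonglongrightarrow> f x"
    using strongly_measurableE[OF assms] by blast
  have "(\<lambda>x. norm (s i x)) \<in> borel_measurable M" for i
    by (rule borel_measurable_simple_function, rule simple_function_compose1[OF s(1)])
  then have "(\<lambda>x. lim (\<lambda>i. norm (s i x))) \<in> borel_measurable M"
    by (rule borel_measurable_lim_metric)
  then have m: "(\<lambda>x. lim (\<lambda>i. norm (s i x))) \<in> borel_measurable (completion M)"
    by (rule measurable_completion)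
  have "AE x in M. lim (\<lambda>i. norm (s i x)) = norm (f x)"
    using s(2) by eventually_elim (intro limI tendsto_norm)
  then have "AE x in completion M. lim (\<lambda>i. norm (s i x)) = norm (f x)"
    by (rule AE_completion)
  from completion.borel_measurable_AE_eq[OF m this] show ?thesis .
qed

lemma strongly_measurable_simple: "simple_function M f \<Longrightarrow> strongly_measurable M f"
  unfolding strongly_measurable_def by (intro exI[of _ "\<lambda>_. f"]) auto

text \<open>Applying \<open>h\<close> to two simple functions gives a simple function, and joint
  sequential continuity passes to the limit. Sums, differences and scalar multiples are all
  instances.\<close>

lemma strongly_measurable_compose2:
  assumes f: "strongly_measurable M f" and g: "strongly_measurable M g"
    and h: "\<And>X Y x y. X \<longlonglongrightarrow> x \<Longrightarrow> Y \<longlonglongrightarrow> y \<Longrightarrow> (\<lambda>i. h (X i) (Y i)) \<longlonglongrightarrow> h x y"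
  shows "strongly_measurable M (\<lambda>x. h (f x) (g x))"
proof -
  obtain s where s: "\<And>i::nat. simple_function M (s i)" "AE x in M. (\<lambda>i. s i x) \<longlonglongrightarrow> f x"
    using strongly_measurableE[OF f] by blast
  obtain t where t: "\<And>i::nat. simple_function M (t i)" "AE x in M. (\<lambda>i. t i x) \<longlonglongrightarrow> g x"
    using strongly_measurableE[OF g] by blast
  have "simple_function M (\<lambda>x. h (s i x) (t i x))" for i
    by (rule simple_function_compose2[OF s(1) t(1)])
  moreover have "AE x in M. (\<lambda>i. h (s i x) (t i x)) \<longlonglongrightarrow> h (f x) (g x)"
    using s(2) t(2) by eventually_elim (rule h)
  ultimately show ?thesis unfolding strongly_measurable_def
    by (intro exI[of _ "\<lambda>i x. h (s i x) (t i x)"]) auto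
qed

lemma strongly_measurable_add:
  "strongly_measurable M f \<Longrightarrow> strongly_measurable M g \<Longrightarrow> strongly_measurable M (\<lambda>x. f x + g x)"
  by (rule strongly_measurable_compose2[where h = "(+)"]) (auto intro: tendsto_add)

lemma strongly_measurable_diff:
  "strongly_measurable M f \<Longrightarrow> strongly_measurable M g \<Longrightarrow> strongly_measurable M (\<lambda>x. f x - g x)"
  by (rule strongly_measurable_compose2[where h = "(-)"]) (auto intro: tendsto_diff)

lemma strongly_measurable_borel:
  fixes \<phi> :: "'a \<Rightarrow> complex"
  assumes "\<phi> \<in> borel_measurable M"
  shows "strongly_measurable M \<phi>"
proof -
  obtain s where s: "\<And>i::nat. simple_function M (s i)" "\<And>x. x \<in> space M \<Longrightarrow> (\<lambda>i. s i x) \<longlonglongrightarrow> \<phi> x"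
    using borel_measurable_implies_sequence_metric[OF assms, of 0] by blast
  then show ?thesis unfolding strongly_measurable_def by (intro exI[of _ s]) auto
qed

lemma strongly_measurable_scaleC:
  fixes f :: "'a \<Rightarrow> 'b::complex_banach"
  assumes "\<phi> \<in> borel_measurable M" "strongly_measurable M f"
  shows "strongly_measurable M (\<lambda>x. \<phi> x *\<^sub>C f x)"
  by (rule strongly_measurable_compose2[OF strongly_measurable_borel[OF assms(1)] assms(2)])
     (rule scaleC.tendsto)

abbreviation sint :: "'a measure \<Rightarrow> ('a \<Rightarrow> 'b::real_vector) \<Rightarrow> 'b" where
  "sint \<equiv> Bochner_Integration.simple_bochner_integral"

text \<open>Integrability is asked of the real function \<open>norm (f x)\<close>, so that the
  integration theory for second countable targets applies to it.\<close>

definition L1 :: "'a measure \<Rightarrow> ('a \<Rightarrow> 'b::real_normed_vector) \<Rightarrow> bool" where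
  "L1 M f \<longleftrightarrow> strongly_measurable M f \<and> integrable (completion M) (\<lambda>x. norm (f x))"

definition L1_norm :: "'a measure \<Rightarrow> ('a \<Rightarrow> 'b::real_normed_vector) \<Rightarrow> real" where
  "L1_norm M f = (\<integral>x. norm (f x) \<partial>completion M)"

lemma L1_norm_nonneg [simp]: "0 \<le> L1_norm M f"
  unfolding L1_norm_def by simp

lemma nn_integral_L1: "L1 M f \<Longrightarrow> (\<integral>\<^sup>+x. ennreal (norm (f x)) \<partial>M) = ennreal (L1_norm M f)"
  unfolding L1_norm_def nn_integral_completion[symmetric, of M] L1_def
  by (intro nn_integral_eq_integral) auto

lemma L1_mono:
  assumes "strongly_measurable M g" "integrable (completion M) b" "AE x in M. norm (g x) \<le> b x"
  shows "L1 M g" "L1_norm M g \<le> (\<integral>x. b x \<partial>completion M)"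
proof -
  have ae: "AE x in completion M. norm (g x) \<le> b x"
    using assms(3) by (rule AE_completion)
  show "L1 M g" unfolding L1_def
    using ae by (intro conjI assms(1) Bochner_Integration.integrable_bound[OF assms(2)]
        strongly_measurable_norm) auto
  then show "L1_norm M g \<le> (\<integral>x. b x \<partial>completion M)"
    unfolding L1_norm_def L1_def using assms(2) ae by (intro integral_mono_AE) auto
qed

lemma L1_add:
  assumes "L1 M f" "L1 M g"
  shows "L1 M (\<lambda>x. f x + g x)" "L1_norm M (\<lambda>x. f x + g x) \<le> L1_norm M f + L1_norm M g"
proof -
  have i: "integrable (completion M) (\<lambda>x. norm (f x) + norm (g x))"
    using assms unfolding L1_def by auto
  have m: "strongly_measurable M (\<lambda>x. f x + g x)"
    using assms unfolding L1_def by (auto intro: strongly_measurable_add)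
  have ae: "AE x in M. norm (f x + g x) \<le> norm (f x) + norm (g x)"
    by (simp add: norm_triangle_ineq)
  show "L1 M (\<lambda>x. f x + g x)" "L1_norm M (\<lambda>x. f x + g x) \<le> L1_norm M f + L1_norm M g"
    using L1_mono[OF m i ae] assms unfolding L1_norm_def L1_def by auto
qed

lemma L1_scaleC:
  fixes f :: "'a \<Rightarrow> 'b::complex_banach"
  assumes "L1 M f" "\<phi> \<in> borel_measurable M" "\<And>x. cmod (\<phi> x) \<le> K"
  shows "L1 M (\<lambda>x. \<phi> x *\<^sub>C f x)" "L1_norm M (\<lambda>x. \<phi> x *\<^sub>C f x) \<le> K * L1_norm M f"
proof -
  have i: "integrable (completion M) (\<lambda>x. K * norm (f x))"
    using assms unfolding L1_def by auto
  have m: "strongly_measurable M (\<lambda>x. \<phi> x *\<^sub>C f x)"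
    using assms unfolding L1_def by (auto intro: strongly_measurable_scaleC)
  have ae: "AE x in M. norm (\<phi> x *\<^sub>C f x) \<le> K * norm (f x)"
    using assms(3) by (simp add: norm_scaleC mult_right_mono)
  show "L1 M (\<lambda>x. \<phi> x *\<^sub>C f x)" "L1_norm M (\<lambda>x. \<phi> x *\<^sub>C f x) \<le> K * L1_norm M f"
    using L1_mono[OF m i ae] unfolding L1_norm_def by auto
qed

lemma L1_diff:
  assumes "L1 M f" "L1 M g"
  shows "L1 M (\<lambda>x. f x - g x)" "L1_norm M (\<lambda>x. f x - g x) \<le> L1_norm M f + L1_norm M g"
proof -
  have i: "integrable (completion M) (\<lambda>x. norm (f x) + norm (g x))"
    using assms unfolding L1_def by auto
  have m: "strongly_measurable M (\<lambda>x. f x - g x)"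
    using assms unfolding L1_def by (auto intro: strongly_measurable_diff)
  have ae: "AE x in M. norm (f x - g x) \<le> norm (f x) + norm (g x)"
    by (simp add: norm_triangle_ineq4)
  show "L1 M (\<lambda>x. f x - g x)" "L1_norm M (\<lambda>x. f x - g x) \<le> L1_norm M f + L1_norm M g"
    using L1_mono[OF m i ae] assms unfolding L1_norm_def L1_def by auto
qed

context finite_measure
begin

lemma finite_measure_completion: "finite_measure (completion M)"
  by standard (simp add: emeasure_eq_measure)

lemma simple_bochner_integrable_iff:
  "Bochner_Integration.simple_bochner_integrable M s \<longleftrightarrow> simple_function M s"
  by (auto simp: Bochner_Integration.simple_bochner_integrable.simps emeasure_eq_measure)

lemma L1_bounded:
  assumes "strongly_measurable M g" "AE x in M. norm (g x) \<le> K"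
  shows "L1 M g"
proof (rule L1_mono(1)[OF assms(1) _ assms(2)])
  interpret c: finite_measure "completion M" by (rule finite_measure_completion)
  show "integrable (completion M) (\<lambda>x. K)" by simp
qed

lemma simple_function_bounded:
  fixes s :: "'a \<Rightarrow> 'b::real_normed_vector"
  assumes "simple_function M s"
  obtains K where "0 \<le> K" "\<And>x. x \<in> space M \<Longrightarrow> norm (s x) \<le> K"
proof -
  have "finite (norm ` s ` space M)" using assms by (auto simp: simple_function_def)
  then have "x \<in> space M \<Longrightarrow> norm (s x) \<le> Max (insert 0 (norm ` s ` space M))" for x
    by (intro Max_ge) auto
  moreover have "0 \<le> Max (insert 0 (norm ` s ` space M))"
    using \<open>finite (norm ` s ` space M)\<close> by (intro Max_ge) auto
  ultimately show ?thesis using that by blast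
qed

lemma L1_simple:
  fixes s :: "'a \<Rightarrow> 'b::real_normed_vector"
  assumes "simple_function M s"
  shows "L1 M s"
proof -
  obtain K where "\<And>x. x \<in> space M \<Longrightarrow> norm (s x) \<le> K"
    using simple_function_bounded[OF assms] by blast
  then have "AE x in M. norm (s x) \<le> K" by simp
  then show ?thesis by (rule L1_bounded[OF strongly_measurable_simple[OF assms]])
qed

text \<open>Almost everywhere convergence gives no control of integrals. Truncating the simple
  functions against the size of \<open>f\<close> supplies a dominating function, and dominated
  convergence then gives L1 convergence.\<close>

lemma L1_approx_seq:
  fixes f :: "'a \<Rightarrow> 'b::real_normed_vector"
  assumes f: "L1 M f"
  obtains t where "\<And>i::nat. simple_function M (t i)" "(\<lambda>i. L1_norm M (\<lambda>x. f x - t i x)) \<longlonglongrightarrow> 0"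
proof -
  have sm: "strongly_measurable M f" and int: "integrable (completion M) (\<lambda>x. norm (f x))"
    using f unfolding L1_def by auto
  obtain s where s: "\<And>i::nat. simple_function M (s i)" "AE x in M. (\<lambda>i. s i x) \<longlonglongrightarrow> f x"
    using strongly_measurableE[OF sm] by blast
  obtain g where g: "g \<in> borel_measurable M" "AE x in M. norm (f x) = g x"
    using completion_ex_borel_measurable_real[OF strongly_measurable_norm[OF sm]] by blast
  \<comment> \<open>Truncation at twice the norm of \<open>f\<close>: where \<open>f x\<close> is
    nonzero the condition holds for all large \<open>i\<close>, and where \<open>f x = 0\<close> it
    forces the value 0. The version \<open>g\<close> of the norm makes \<open>A i\<close> measurable
    for \<open>M\<close> itself; the factor 3 below is 1 + 2.\<close>
  define A where "A i = {x \<in> space M. norm (s i x) \<le> 2 * g x}" for i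
  have A [measurable]: "A i \<in> sets M" for i
  proof -
    have "(\<lambda>x. norm (s i x)) \<in> borel_measurable M"
      by (rule borel_measurable_simple_function, rule simple_function_compose1[OF s(1)])
    then show ?thesis unfolding A_def using g(1) by measurable
  qed
  define t where "t i x = indicator (A i) x *\<^sub>R s i x" for i x
  have t: "simple_function M (t i)" for i
    unfolding t_def
    by (rule simple_function_compose2[where h = scaleR, OF simple_function_indicator[OF A] s(1)])
  have Lt: "L1 M (\<lambda>x. f x - t i x)" for i by (rule L1_diff[OF f L1_simple[OF t]])
  have "(\<lambda>i. \<integral>x. norm (f x - t i x) \<partial>completion M) \<longlonglongrightarrow> (\<integral>x. 0 \<partial>completion M)"
  proof (rule integral_dominated_convergence)
    show "integrable (completion M) (\<lambda>x. 3 * norm (f x))" using int by simp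
    show "(\<lambda>x. norm (f x - t i x)) \<in> borel_measurable (completion M)" for i
      using Lt[of i] unfolding L1_def by auto
    have "AE x in M. norm (norm (f x - t i x)) \<le> 3 * norm (f x)" for i
      using g(2)
    proof eventually_elim
      case (elim x)
      have "norm (t i x) \<le> 2 * norm (f x)"
        unfolding t_def A_def using elim norm_ge_zero[of "f x"] by (simp add: indicator_def)
      then show ?case using norm_triangle_ineq4[of "f x" "t i x"] by simp
    qed
    then show "AE x in completion M. norm (norm (f x - t i x)) \<le> 3 * norm (f x)" for i
      by (rule AE_completion)
    have "AE x in M. (\<lambda>i. norm (f x - t i x)) \<longlonglongrightarrow> 0"
      using g(2) s(2) AE_space
    proof eventually_elim
      case (elim x)
      have "(\<lambda>i. t i x) \<longlonglongrightarrow> f x"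
      proof (cases "f x = 0")
        case True
        then have "t i x = 0" for i unfolding t_def A_def using elim by (auto simp: indicator_def)
        then show ?thesis using True by simp
      next
        case False
        have "(\<lambda>i. norm (s i x)) \<longlonglongrightarrow> norm (f x)" using elim by (intro tendsto_norm)
        moreover have "norm (f x) < 2 * norm (f x)" using False by simp
        ultimately have "eventually (\<lambda>i. norm (s i x) < 2 * norm (f x)) sequentially"
          by (rule order_tendstoD(2))
        then have "eventually (\<lambda>i. s i x = t i x) sequentially"
          by eventually_elim (use elim in \<open>auto simp: t_def A_def\<close>)
        with elim(2) show ?thesis by (rule Lim_transform_eventually)
      qed
      then have "(\<lambda>i. norm (f x - t i x)) \<longlonglongrightarrow> norm (f x - f x)" by (intro tendsto_intros)
      then show ?case by simp
    qed
    then show "AE x in completion M. (\<lambda>i. norm (f x - t i x)) \<longlonglongrightarrow> 0"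
      by (rule AE_completion)
  qed simp
  then have "(\<lambda>i. L1_norm M (\<lambda>x. f x - t i x)) \<longlonglongrightarrow> 0" unfolding L1_norm_def by simp
  then show ?thesis using that t by blast
qed

text \<open>Both simple functions are compared through \<open>f\<close>. This one estimate makes
  approximating integrals Cauchy and their limit independent of the sequence.\<close>

lemma simple_integral_diff_le:
  fixes f :: "'a \<Rightarrow> 'b::real_normed_vector"
  assumes f: "L1 M f" and s: "simple_function M s" and t: "simple_function M t"
  shows "norm (sint M s - sint M t)
    \<le> L1_norm M (\<lambda>x. f x - s x) + L1_norm M (\<lambda>x. f x - t x)"
proof -
  have st: "simple_function M (\<lambda>x. s x - t x)" by (rule simple_function_compose2[OF s t])
  have "norm (sint M s - sint M t)
      = norm (sint M (\<lambda>x. s x - t x))"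
    using s t by (subst simple_bochner_integral_diff) (auto simp: simple_bochner_integrable_iff)
  also have "\<dots> \<le> sint M (\<lambda>x. norm (s x - t x))"
    using st by (intro simple_bochner_integral_norm_bound) (simp add: simple_bochner_integrable_iff)
  also have "ennreal \<dots> = (\<integral>\<^sup>+x. ennreal (norm (s x - t x)) \<partial>M)"
    by (intro simple_bochner_integral_eq_nn_integral)
       (auto simp: simple_bochner_integrable_iff intro!: simple_function_compose1[OF st, of norm, simplified])
  then have "sint M (\<lambda>x. norm (s x - t x)) = L1_norm M (\<lambda>x. s x - t x)"
    by (simp add: nn_integral_L1 L1_simple st)
  also have "L1_norm M (\<lambda>x. s x - t x) = L1_norm M (\<lambda>x. (f x - t x) - (f x - s x))" by simp
  also have "\<dots> \<le> L1_norm M (\<lambda>x. f x - t x) + L1_norm M (\<lambda>x. f x - s x)"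
    by (intro L1_diff f L1_simple s t)
  finally show ?thesis by simp
qed

lemma has_strong_integral_iff:
  fixes f :: "'a \<Rightarrow> 'b::real_normed_vector"
  assumes f: "L1 M f"
  shows "has_strong_integral M f I \<longleftrightarrow>
    (\<exists>s. (\<forall>i::nat. simple_function M (s i)) \<and> (\<lambda>i. L1_norm M (\<lambda>x. f x - s i x)) \<longlonglongrightarrow> 0 \<and>
      (\<lambda>i. sint M (s i)) \<longlonglongrightarrow> I)"
proof -
  have lim: "(\<lambda>i. \<integral>\<^sup>+x. ennreal (norm (f x - s i x)) \<partial>M) \<longlonglongrightarrow> 0 \<longleftrightarrow> (\<lambda>i. L1_norm M (\<lambda>x. f x - s i x)) \<longlonglongrightarrow> 0"
    if "\<forall>i. simple_function M (s i)" for s :: "nat \<Rightarrow> 'a \<Rightarrow> 'b"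
  proof -
    have "(\<integral>\<^sup>+x. ennreal (norm (f x - s i x)) \<partial>M) = ennreal (L1_norm M (\<lambda>x. f x - s i x))" for i
      using that by (intro nn_integral_L1 L1_diff f L1_simple) auto
    then show ?thesis
      using tendsto_ennreal_iff[of "\<lambda>i. L1_norm M (\<lambda>x. f x - s i x)" sequentially 0] by simp
  qed
  have sm: "strongly_measurable M f" using f unfolding L1_def by simp
  show ?thesis
    unfolding has_strong_integral_def simple_bochner_integrable_iff
    by (simp add: sm lim cong: conj_cong)
qed

text \<open>The limit of \<open>simple_integral_diff_le\<close> in one argument. Uniqueness, the
  norm bound and linearity of the integral are all read off from it.\<close>

lemma has_strong_integral_simple_le:
  fixes f :: "'a \<Rightarrow> 'b::real_normed_vector"
  assumes f: "L1 M f" and I: "has_strong_integral M f I" and t: "simple_function M t"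
  shows "norm (I - sint M t) \<le> L1_norm M (\<lambda>x. f x - t x)"
proof -
  obtain s where s: "\<And>i::nat. simple_function M (s i)" "(\<lambda>i. L1_norm M (\<lambda>x. f x - s i x)) \<longlonglongrightarrow> 0"
    "(\<lambda>i. sint M (s i)) \<longlonglongrightarrow> I"
    using I unfolding has_strong_integral_iff[OF f] by blast
  have "(\<lambda>i. norm (sint M (s i) - sint M t))
      \<longlonglongrightarrow> norm (I - sint M t)"
    by (intro tendsto_intros s)
  moreover have "(\<lambda>i. L1_norm M (\<lambda>x. f x - s i x) + L1_norm M (\<lambda>x. f x - t x)) \<longlonglongrightarrow> 0 + L1_norm M (\<lambda>x. f x - t x)"
    by (intro tendsto_intros s)
  ultimately have "norm (I - sint M t) \<le> 0 + L1_norm M (\<lambda>x. f x - t x)"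
    by (rule LIMSEQ_le) (use simple_integral_diff_le[OF f s(1) t] in auto)
  then show ?thesis by simp
qed

text \<open>Completeness of the target provides a value and the estimate against simple functions
  leaves no second one, so the \<open>THE\<close> in the definition is meaningful for every L1
  function.\<close>

lemma strong_integral:
  fixes f :: "'a \<Rightarrow> 'b::banach"
  assumes f: "L1 M f"
  shows "has_strong_integral M f (strong_integral M f)"
proof -
  obtain t where t: "\<And>i::nat. simple_function M (t i)" "(\<lambda>i. L1_norm M (\<lambda>x. f x - t i x)) \<longlonglongrightarrow> 0"
    using L1_approx_seq[OF f] by blast
  let ?S = "\<lambda>i. sint M (t i)"
  have "Cauchy ?S"
  proof (rule CauchyI)
    fix e :: real assume "0 < e"
    then obtain N where N: "\<And>i. N \<le> i \<Longrightarrow> L1_norm M (\<lambda>x. f x - t i x) < e / 2"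
      using LIMSEQ_D[OF t(2), of "e/2"] by auto
    then have "norm (?S i - ?S j) < e" if "N \<le> i" "N \<le> j" for i j
      using simple_integral_diff_le[OF f t(1) t(1), of i j] N[OF that(1)] N[OF that(2)] by linarith
    then show "\<exists>N. \<forall>i\<ge>N. \<forall>j\<ge>N. norm (?S i - ?S j) < e" by blast
  qed
  then obtain I where I: "?S \<longlonglongrightarrow> I" using Cauchy_convergent convergent_def by blast
  then have h: "has_strong_integral M f I"
    unfolding has_strong_integral_iff[OF f] using t by blast
  have "J = I" if J: "has_strong_integral M f J" for J
  proof -
    have "norm (J - I) \<le> L1_norm M (\<lambda>x. f x - t i x) + L1_norm M (\<lambda>x. f x - t i x)" for i
      using has_strong_integral_simple_le[OF f J t(1), of i] has_strong_integral_simple_le[OF f h t(1), of i]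
        norm_triangle_ineq4[of "J - ?S i" "I - ?S i"] by simp
    moreover have "(\<lambda>i. L1_norm M (\<lambda>x. f x - t i x) + L1_norm M (\<lambda>x. f x - t i x)) \<longlonglongrightarrow> 0 + 0"
      by (intro tendsto_add t)
    ultimately have "norm (J - I) \<le> 0 + 0"
      by (intro LIMSEQ_le_const[of "\<lambda>i. L1_norm M (\<lambda>x. f x - t i x) + L1_norm M (\<lambda>x. f x - t i x)"]) blast+
    then show ?thesis by simp
  qed
  then show ?thesis
    unfolding strong_integral_def using h by (auto intro: theI)
qed

lemma strong_integral_simple_le:
  fixes f :: "'a \<Rightarrow> 'b::banach"
  assumes "L1 M f" "simple_function M t"
  shows "norm (strong_integral M f - sint M t) \<le> L1_norm M (\<lambda>x. f x - t x)"
  using assms by (intro has_strong_integral_simple_le strong_integral)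

lemma L1_approx:
  fixes f :: "'a \<Rightarrow> 'b::real_normed_vector"
  assumes "L1 M f" "0 < e"
  obtains t where "simple_function M t" "L1_norm M (\<lambda>x. f x - t x) < e"
proof -
  obtain t where t: "\<And>i::nat. simple_function M (t i)" "(\<lambda>i. L1_norm M (\<lambda>x. f x - t i x)) \<longlonglongrightarrow> 0"
    using L1_approx_seq[OF assms(1)] by blast
  from order_tendstoD(2)[OF t(2) assms(2)] obtain i where "L1_norm M (\<lambda>x. f x - t i x) < e"
    by (auto simp: eventually_sequentially)
  then show ?thesis using that t(1) by blast
qed

lemma strong_integral_norm_le:
  fixes f :: "'a \<Rightarrow> 'b::banach"
  assumes "L1 M f"
  shows "norm (strong_integral M f) \<le> L1_norm M f"
proof -
  have "sint M (\<lambda>x. 0::'b) = 0"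
    unfolding Bochner_Integration.simple_bochner_integral_def by (auto intro!: sum.neutral)
  then show ?thesis using strong_integral_simple_le[OF assms, of "\<lambda>x. 0"] by simp
qed

lemma strong_integral_add:
  fixes f g :: "'a \<Rightarrow> 'b::banach"
  assumes f: "L1 M f" and g: "L1 M g"
  shows "strong_integral M (\<lambda>x. f x + g x) = strong_integral M f + strong_integral M g"
proof -
  let ?D = "strong_integral M (\<lambda>x. f x + g x) - (strong_integral M f + strong_integral M g)"
  have "norm ?D \<le> 0"
  proof (rule field_le_epsilon)
    fix e :: real assume "0 < e"
    \<comment> \<open>Each of the two approximation errors occurs twice, once in the joint estimate
      and once on its own.\<close>
    then have e: "0 < e / 4" by simp
    obtain s where s: "simple_function M s" "L1_norm M (\<lambda>x. f x - s x) < e / 4" using L1_approx[OF f e] by blast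
    obtain t where t: "simple_function M t" "L1_norm M (\<lambda>x. g x - t x) < e / 4" using L1_approx[OF g e] by blast
    have st: "simple_function M (\<lambda>x. s x + t x)" by (rule simple_function_compose2[OF s(1) t(1)])
    have S: "sint M (\<lambda>x. s x + t x) = sint M s + sint M t"
      using s t by (intro simple_bochner_integral_add) (simp_all add: simple_bochner_integrable_iff)
    have "L1_norm M (\<lambda>x. f x + g x - (s x + t x)) = L1_norm M (\<lambda>x. (f x - s x) + (g x - t x))"
      by (simp add: algebra_simps)
    also have "\<dots> \<le> L1_norm M (\<lambda>x. f x - s x) + L1_norm M (\<lambda>x. g x - t x)"
      by (intro L1_add L1_diff f g L1_simple s t)
    finally have n: "norm (strong_integral M (\<lambda>x. f x + g x) - (sint M s + sint M t)) \<le> e / 2"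
      using strong_integral_simple_le[OF L1_add(1)[OF f g] st] s t unfolding S by linarith
    have "?D = (strong_integral M (\<lambda>x. f x + g x) - (sint M s + sint M t))
        - ((strong_integral M f - sint M s) + (strong_integral M g - sint M t))" by simp
    also have "norm \<dots> \<le> norm (strong_integral M (\<lambda>x. f x + g x) - (sint M s + sint M t))
        + (norm (strong_integral M f - sint M s) + norm (strong_integral M g - sint M t))"
      by (intro order_trans[OF norm_triangle_ineq4] add_left_mono norm_triangle_ineq)
    also have "\<dots> \<le> 0 + e"
      using n strong_integral_simple_le[OF f s(1)] strong_integral_simple_le[OF g t(1)] s t by linarith
    finally show "norm ?D \<le> 0 + e" .
  qed
  then show ?thesis by simp
qed

lemma strong_integral_scaleC:
  fixes f :: "'a \<Rightarrow> 'b::complex_banach"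
  assumes f: "L1 M f"
  shows "strong_integral M (\<lambda>x. c *\<^sub>C f x) = c *\<^sub>C strong_integral M f"
proof -
  let ?D = "strong_integral M (\<lambda>x. c *\<^sub>C f x) - c *\<^sub>C strong_integral M f"
  have cf: "L1 M (\<lambda>x. c *\<^sub>C f x)" by (rule L1_scaleC[OF f, of _ "cmod c"]) auto
  have "norm ?D \<le> 0"
  proof (rule field_le_epsilon)
    fix e :: real assume "0 < e"
    \<comment> \<open>The factor 2 accounts for two error terms of size \<open>cmod c\<close> times
      the approximation error; the summand 1 covers \<open>c = 0\<close>.\<close>
    then have e: "0 < e / (2 * (cmod c + 1))" by (simp add: add_nonneg_pos)
    obtain s where s: "simple_function M s" "L1_norm M (\<lambda>x. f x - s x) < e / (2 * (cmod c + 1))"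
      using L1_approx[OF f e] by blast
    have cs: "simple_function M (\<lambda>x. c *\<^sub>C s x)" by (rule simple_function_compose1[OF s(1)])
    have S: "sint M (\<lambda>x. c *\<^sub>C s x) = c *\<^sub>C sint M s"
      using s by (intro simple_bochner_integral_linear linear_scaleC) (simp add: simple_bochner_integrable_iff)
    have "L1_norm M (\<lambda>x. c *\<^sub>C f x - c *\<^sub>C s x) \<le> cmod c * L1_norm M (\<lambda>x. f x - s x)"
      unfolding scaleC.diff_right[symmetric]
      by (rule L1_scaleC[OF L1_diff(1)[OF f L1_simple[OF s(1)]]]) auto
    then have 1: "norm (strong_integral M (\<lambda>x. c *\<^sub>C f x) - c *\<^sub>C sint M s) \<le> cmod c * L1_norm M (\<lambda>x. f x - s x)"
      using strong_integral_simple_le[OF cf cs] unfolding S by linarith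
    have 2: "norm (c *\<^sub>C strong_integral M f - c *\<^sub>C sint M s) \<le> cmod c * L1_norm M (\<lambda>x. f x - s x)"
      unfolding scaleC.diff_right[symmetric] norm_scaleC
      using strong_integral_simple_le[OF f s(1)] by (intro mult_left_mono) auto
    have "norm ?D \<le> 2 * cmod c * L1_norm M (\<lambda>x. f x - s x)"
      using 1 2 norm_triangle_ineq4[of "strong_integral M (\<lambda>x. c *\<^sub>C f x) - c *\<^sub>C sint M s"
          "c *\<^sub>C strong_integral M f - c *\<^sub>C sint M s"] by simp
    also have "\<dots> \<le> 2 * (cmod c + 1) * L1_norm M (\<lambda>x. f x - s x)"
      by (intro mult_right_mono) auto
    also have "\<dots> \<le> 2 * (cmod c + 1) * (e / (2 * (cmod c + 1)))"
      using s by (intro mult_left_mono) auto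
    also have "\<dots> = e" by (simp add: add_nonneg_eq_0_iff)
    finally show "norm ?D \<le> 0 + e" by simp
  qed
  then show ?thesis by simp
qed

lemma strong_integral_diff:
  fixes f g :: "'a \<Rightarrow> 'b::complex_banach"
  assumes f: "L1 M f" and g: "L1 M g"
  shows "strong_integral M (\<lambda>x. f x - g x) = strong_integral M f - strong_integral M g"
proof -
  have m: "(-1) *\<^sub>C x = - x" for x :: 'b
    using scaleR_scaleC[of "-1" x] by simp
  have "L1 M (\<lambda>x. (-1) *\<^sub>C g x)" by (rule L1_scaleC[OF g, of _ 1]) auto
  from strong_integral_add[OF f this] strong_integral_scaleC[OF g, of "-1"] show ?thesis
    by (simp add: m)
qed

lemma strong_integral_sum:
  fixes f :: "'i \<Rightarrow> 'a \<Rightarrow> 'b::complex_banach"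
  assumes "\<And>i. i \<in> I \<Longrightarrow> L1 M (f i)"
  shows "strong_integral M (\<lambda>x. \<Sum>i\<in>I. c i *\<^sub>C f i x) = (\<Sum>i\<in>I. c i *\<^sub>C strong_integral M (f i)) \<and>
    L1 M (\<lambda>x. \<Sum>i\<in>I. c i *\<^sub>C f i x)"
proof -
  have z: "L1 M (\<lambda>x. 0::'b)" by (rule L1_simple) simp
  have "norm (strong_integral M (\<lambda>x. 0::'b)) \<le> 0"
    using strong_integral_norm_le[OF z] by (simp add: L1_norm_def)
  then have z': "strong_integral M (\<lambda>x. 0::'b) = 0" by simp
  show ?thesis using assms
  proof (induction I rule: infinite_finite_induct)
    case (insert i I)
    have i: "L1 M (\<lambda>x. c i *\<^sub>C f i x)" using insert.prems by (intro L1_scaleC[of _ _ _ "cmod (c i)"]) auto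
    have I: "L1 M (\<lambda>x. \<Sum>i\<in>I. c i *\<^sub>C f i x)" using insert by auto
    show ?case
      using insert strong_integral_add[OF i I] L1_add(1)[OF i I] strong_integral_scaleC[of "f i" "c i"]
      by simp
  qed (simp_all add: z z')
qed

lemma strong_integral_cong_AE_0:
  fixes f :: "'a \<Rightarrow> 'b::banach"
  assumes "L1 M f" "AE x in M. f x = 0"
  shows "strong_integral M f = 0"
proof -
  have "AE x in completion M. norm (f x) = 0"
    using AE_completion[OF assms(2)] by simp
  then have "L1_norm M f = 0" unfolding L1_norm_def
    by (subst integral_cong_AE[of _ _ "\<lambda>_. 0"]) (use assms(1) in \<open>auto simp: L1_def\<close>)
  then show ?thesis using strong_integral_norm_le[OF assms(1)] by simp
qed

text \<open>
  If the values of \<open>f\<close> on a set of positive measure are close to a vector \<open>v\<close> with \<open>norm v > C\<close>,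
  then so is the average of \<open>f\<close> over it; countably many \<open>v\<close> suffice because \<open>f\<close> is almost
  everywhere a limit of simple functions.
\<close>

lemma AE_norm_le_if_averages_le:
  fixes f :: "'a \<Rightarrow> 'b::complex_banach"
  assumes f: "L1 M f"
    and avg: "\<And>B. B \<in> sets M \<Longrightarrow> norm (strong_integral M (\<lambda>x. indicator B x *\<^sub>C f x)) \<le> C * measure M B"
  shows "AE x in M. norm (f x) \<le> C"
proof -
  interpret c: finite_measure "completion M" by (rule finite_measure_completion)
  have sm: "strongly_measurable M f" using f unfolding L1_def by simp
  have near: "AE x in M. \<not> (norm (f x - v) < \<delta> \<and> C + 2 * \<delta> < norm (f x))" if "0 < \<delta>" for v \<delta>
  proof -
    \<comment> \<open>\<open>g\<close> and \<open>h\<close> are versions of the two norms measurable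
      for \<open>M\<close> itself, so that \<open>B\<close> below is a set to which
      \<open>avg\<close> applies.\<close>
    obtain g where g: "g \<in> borel_measurable M" "AE x in M. norm (f x) = g x"
      using completion_ex_borel_measurable_real[OF strongly_measurable_norm[OF sm]] by blast
    have "strongly_measurable M (\<lambda>x. f x - v)"
      by (intro strongly_measurable_diff sm strongly_measurable_simple) simp
    then obtain h where h: "h \<in> borel_measurable M" "AE x in M. norm (f x - v) = h x"
      using completion_ex_borel_measurable_real[OF strongly_measurable_norm] by blast
    define B where "B = {x \<in> space M. h x < \<delta> \<and> C + 2 * \<delta> < g x}"
    have B: "B \<in> sets M" unfolding B_def using g(1) h(1) by measurable
    have "measure M B = 0"
    proof (rule ccontr)
      assume "measure M B \<noteq> 0"
      then have pos: "0 < measure M B" by (simp add: zero_less_measure_iff)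
      \<comment> \<open>At almost every point of \<open>B\<close> the value of \<open>f\<close> has
        norm above C + 2\<delta> and lies within \<delta> of \<open>v\<close>; a shorter
        \<open>v\<close> would make \<open>B\<close> null.\<close>
      have "C + \<delta> < norm v"
      proof (rule ccontr)
        assume v: "\<not> C + \<delta> < norm v"
        have "AE x in M. x \<notin> B"
          using g(2) h(2)
        proof eventually_elim
          case (elim x)
          then show ?case
            using v norm_triangle_sub[of "f x" v] unfolding B_def by auto
        qed
        then have "B \<in> null_sets M" using B by (simp add: AE_iff_null_sets)
        then show False using pos by (simp add: null_sets_def measure_def)
      qed
      define t where "t x = indicator B x *\<^sub>R v" for x
      have t: "simple_function M t"
        unfolding t_def by (rule simple_function_compose1[OF simple_function_indicator[OF B]])
      have sb: "Bochner_Integration.simple_bochner_integrable M (indicator B :: 'a \<Rightarrow> real)"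
        using B by (simp add: simple_bochner_integrable_iff)
      have "sint M (indicator B :: 'a \<Rightarrow> real) = measure M B"
        using simple_bochner_integrable_eq_integral[OF sb] B sets.sets_into_space[OF B]
        by (simp add: Int_absorb2)
      then have It: "sint M t = measure M B *\<^sub>R v"
        using simple_bochner_integral_linear[OF linear_scaleR_left sb, of v] unfolding t_def by simp
      have LB: "L1 M (\<lambda>x. indicator B x *\<^sub>C f x)"
        using B by (intro L1_scaleC[OF f, of _ 1]) (auto simp: indicator_def)
      have "L1_norm M (\<lambda>x. indicator B x *\<^sub>C f x - t x) \<le> (\<integral>x. \<delta> * indicator B x \<partial>completion M)"
      proof (rule L1_mono(2))
        show "strongly_measurable M (\<lambda>x. indicator B x *\<^sub>C f x - t x)"
          using L1_diff(1)[OF LB L1_simple[OF t]] unfolding L1_def by simp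
        show "integrable (completion M) (\<lambda>x. \<delta> * indicator B x)"
          using B by (intro integrable_mult_right integrable_real_indicator) (auto simp: c.emeasure_eq_measure)
        show "AE x in M. norm (indicator B x *\<^sub>C f x - t x) \<le> \<delta> * indicator B x"
          using h(2) by eventually_elim
            (auto simp: t_def B_def indicator_def scaleC_one scaleC.zero_left)
      qed
      also have "\<dots> = \<delta> * measure M B"
        using B by (simp add: Int_absorb2[OF sets.sets_into_space[OF B]])
      finally have "norm (strong_integral M (\<lambda>x. indicator B x *\<^sub>C f x) - measure M B *\<^sub>R v) \<le> \<delta> * measure M B"
        using strong_integral_simple_le[OF LB t] unfolding It by simp
      then have "norm (measure M B *\<^sub>R v) \<le> C * measure M B + \<delta> * measure M B"
        using avg[OF B] norm_triangle_sub[of "measure M B *\<^sub>R v" "strong_integral M (\<lambda>x. indicator B x *\<^sub>C f x)"]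
        unfolding norm_minus_commute[of "measure M B *\<^sub>R v"] by linarith
      then have "measure M B * norm v \<le> measure M B * (C + \<delta>)" by (simp add: algebra_simps)
      then show False using pos \<open>C + \<delta> < norm v\<close> by simp
    qed
    then have "B \<in> null_sets M" using B by (simp add: null_sets_def emeasure_eq_measure)
    then have "AE x in M. x \<notin> B" by (rule AE_not_in)
    with g(2) h(2) AE_space show ?thesis by eventually_elim (auto simp: B_def)
  qed
  obtain s where s: "\<And>i::nat. simple_function M (s i)" "AE x in M. (\<lambda>i. s i x) \<longlonglongrightarrow> f x"
    using strongly_measurableE[OF sm] by blast
  define V where "V = (\<Union>i. s i ` space M)"
  have "countable V"
    unfolding V_def by (intro countable_UN countableI_type countable_finite simple_functionD(1) s(1))
  then have "AE x in M. \<forall>n::nat. \<forall>v\<in>V. \<not> (norm (f x - v) < 1 / Suc n \<and> C + 2 * (1 / Suc n) < norm (f x))"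
    unfolding AE_all_countable by (intro allI AE_ball_countable[THEN iffD2] ballI near) simp_all
  with s(2) AE_space show ?thesis
  proof eventually_elim
    case (elim x)
    have "norm (f x) \<le> C + 2 * (1 / Suc n)" for n
    proof -
      have "eventually (\<lambda>i. dist (s i x) (f x) < 1 / Suc n) sequentially"
        using elim(1) by (rule tendstoD) simp
      then obtain i where "norm (f x - s i x) < 1 / Suc n"
        by (auto simp: eventually_sequentially dist_norm norm_minus_commute)
      moreover have "s i x \<in> V" unfolding V_def using elim(2) by auto
      ultimately show ?thesis using elim(3) not_less by blast
    qed
    moreover have "(\<lambda>n. C + 2 * (1 / Suc n)) \<longlonglongrightarrow> C + 2 * 0"
      by (intro tendsto_intros LIMSEQ_inverse_real_of_nat[unfolded inverse_eq_divide])
    ultimately have "norm (f x) \<le> C + 2 * 0" by (intro LIMSEQ_le_const) auto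
    then show ?case by simp
  qed
qed

end

section \<open>Square-integrable vector-valued functions\<close>

lemma bochner_L2_iff:
  "f \<in> bochner_L2 M \<longleftrightarrow> strongly_measurable M f \<and> integrable (completion M) (\<lambda>x. (norm (f x))\<^sup>2)"
  unfolding bochner_L2_def nn_integral_completion[symmetric, of M]
  using strongly_measurable_norm[of M f] by (auto simp: integrable_iff_bounded)

lemma bochner_L2_add:
  assumes "f \<in> bochner_L2 M" "g \<in> bochner_L2 M"
  shows "(\<lambda>x. f x + g x) \<in> bochner_L2 M"
proof -
  have m: "strongly_measurable M (\<lambda>x. f x + g x)"
    using assms unfolding bochner_L2_iff by (intro strongly_measurable_add) auto
  have "integrable (completion M) (\<lambda>x. 2 * (norm (f x))\<^sup>2 + 2 * (norm (g x))\<^sup>2)"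
    using assms unfolding bochner_L2_iff by auto
  then have "integrable (completion M) (\<lambda>x. (norm (f x + g x))\<^sup>2)"
  proof (rule Bochner_Integration.integrable_bound)
    show "(\<lambda>x. (norm (f x + g x))\<^sup>2) \<in> borel_measurable (completion M)"
      using strongly_measurable_norm[OF m] by simp
    have "(norm (f x + g x))\<^sup>2 \<le> 2 * (norm (f x))\<^sup>2 + 2 * (norm (g x))\<^sup>2" for x
    proof -
      have "(norm (f x + g x))\<^sup>2 \<le> (norm (f x) + norm (g x))\<^sup>2"
        by (intro power_mono norm_triangle_ineq) simp
      also have "\<dots> \<le> 2 * (norm (f x))\<^sup>2 + 2 * (norm (g x))\<^sup>2"
        using zero_le_power2[of "norm (f x) - norm (g x)"] by (simp add: power2_sum power2_diff)
      finally show ?thesis .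
    qed
    then show "AE x in completion M. norm ((norm (f x + g x))\<^sup>2)
        \<le> norm (2 * (norm (f x))\<^sup>2 + 2 * (norm (g x))\<^sup>2)"
      by simp
  qed
  then show ?thesis using m unfolding bochner_L2_iff by simp
qed

lemma bochner_L2_scaleC:
  fixes f :: "'a \<Rightarrow> 'b::complex_banach"
  assumes "f \<in> bochner_L2 M"
  shows "(\<lambda>x. c *\<^sub>C f x) \<in> bochner_L2 M"
proof -
  have "strongly_measurable M (\<lambda>x. c *\<^sub>C f x)"
    using assms unfolding bochner_L2_iff by (intro strongly_measurable_scaleC) auto
  then show ?thesis
    using assms unfolding bochner_L2_iff by (simp add: norm_scaleC power_mult_distrib)
qed

lemma (in finite_measure) bochner_L2_imp_L1:
  assumes "f \<in> bochner_L2 M"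
  shows "L1 M f"
proof (rule L1_mono(1))
  interpret c: finite_measure "completion M" by (rule finite_measure_completion)
  show "strongly_measurable M f" "integrable (completion M) (\<lambda>x. 1 + (norm (f x))\<^sup>2)"
    using assms unfolding bochner_L2_iff by auto
  have "2 * norm (f x) \<le> 1 + (norm (f x))\<^sup>2" for x
    using zero_le_power2[of "norm (f x) - 1"] by (simp add: power2_diff)
  then have "norm (f x) \<le> 1 + (norm (f x))\<^sup>2" for x
    using norm_ge_zero[of "f x"] by (smt (verit))
  then show "AE x in M. norm (f x) \<le> 1 + (norm (f x))\<^sup>2" by simp
qed

section \<open>Unitary representations and Schur's lemma\<close>

lemma dim_mat_adjoint [simp]: "dim_row (mat_adjoint A) = dim_col A" "dim_col (mat_adjoint A) = dim_row A"
  unfolding mat_adjoint_def by auto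

lemma index_mat_adjoint [simp]:
  fixes A :: "complex Matrix.mat"
  assumes "i < dim_col A" "j < dim_row A"
  shows "mat_adjoint A $$ (i, j) = cnj (A $$ (j, i))"
  unfolding mat_adjoint_def using assms by (simp add: mat_of_rows_index)

lemma mat_adjoint_carrier [simp]: "A \<in> carrier_mat n m \<Longrightarrow> mat_adjoint A \<in> carrier_mat m n"
  by auto

lemma mat_adjoint_adjoint [simp]: "mat_adjoint (mat_adjoint (A :: complex Matrix.mat)) = A"
  by (rule eq_matI) auto

lemma mat_adjoint_mult:
  fixes A B :: "complex Matrix.mat"
  assumes "A \<in> carrier_mat n m" "B \<in> carrier_mat m p"
  shows "mat_adjoint (A * B) = mat_adjoint B * mat_adjoint A"
  using assms by (intro eq_matI) (auto simp: scalar_prod_def mult.commute)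

lemma mult_mat_index:
  assumes "A \<in> carrier_mat n m" "B \<in> carrier_mat m p" "i < n" "j < p"
  shows "(A * B) $$ (i, j) = (\<Sum>k<m. A $$ (i, k) * B $$ (k, j))"
  using assms by (auto simp: scalar_prod_def atLeast0LessThan)

lemma adjoint_mult_index:
  fixes A B :: "complex Matrix.mat"
  assumes "A \<in> carrier_mat n m" "B \<in> carrier_mat n p" "i < m" "j < p"
  shows "(mat_adjoint A * B) $$ (i, j) = (\<Sum>k<n. cnj (A $$ (k, i)) * B $$ (k, j))"
  using assms by (auto simp: scalar_prod_def atLeast0LessThan)

lemma mult_adjoint_index:
  fixes A B :: "complex Matrix.mat"
  assumes "A \<in> carrier_mat n m" "B \<in> carrier_mat p m" "i < n" "j < p"
  shows "(A * mat_adjoint B) $$ (i, j) = (\<Sum>k<m. A $$ (i, k) * cnj (B $$ (j, k)))"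
  using assms by (auto simp: scalar_prod_def atLeast0LessThan)

lemma subspace_module_vec:
  assumes "W \<subseteq> carrier_vec n" "0\<^sub>v n \<in> W" "\<And>v w. v \<in> W \<Longrightarrow> w \<in> W \<Longrightarrow> v + w \<in> W"
    "\<And>c v. v \<in> W \<Longrightarrow> c \<cdot>\<^sub>v v \<in> W"
  shows "VectorSpace.subspace class_ring W (module_vec TYPE(complex) n)"
  unfolding VectorSpace.subspace_def submodule_def
  using assms vec_vs vec_module by (auto simp: module_vec_simps)

lemma subspace_module_vecD:
  assumes "VectorSpace.subspace class_ring W (module_vec TYPE(complex) n)"
  shows "W \<subseteq> carrier_vec n" "0\<^sub>v n \<in> W" "v \<in> W \<Longrightarrow> w \<in> W \<Longrightarrow> v + w \<in> W"
    "v \<in> W \<Longrightarrow> c \<cdot>\<^sub>v v \<in> W"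
  using assms unfolding VectorSpace.subspace_def submodule_def by (auto simp: module_vec_simps)

lemma irreducible_repD: "irreducible_rep \<sigma> \<Longrightarrow> unitary_rep \<sigma>"
  unfolding irreducible_rep_def by simp

lemma unitary_rep_carrier:
  "unitary_rep \<sigma> \<Longrightarrow> \<sigma> x \<in> carrier_mat (rep_dim \<sigma>) (rep_dim \<sigma>)"
  unfolding unitary_rep_def unitary_mat_def by auto

text \<open>The definition of a representation says nothing about 0, but \<open>\<sigma> 0\<close>
  is idempotent and invertible, hence the identity. Then \<open>\<sigma> (- x)\<close> inverts the
  unitary matrix \<open>\<sigma> x\<close>.\<close>

lemma unitary_rep_uminus:
  assumes "unitary_rep \<sigma>"
  shows "\<sigma> (- x) = mat_adjoint (\<sigma> x)" and "\<sigma> 0 = 1\<^sub>m (rep_dim \<sigma>)"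
proof -
  let ?d = "rep_dim \<sigma>"
  have C [simp]: "\<sigma> y \<in> carrier_mat ?d ?d" for y by (rule unitary_rep_carrier[OF assms])
  have U: "mat_adjoint (\<sigma> y) * \<sigma> y = 1\<^sub>m ?d" "\<sigma> y * mat_adjoint (\<sigma> y) = 1\<^sub>m ?d" for y
    using assms unfolding unitary_rep_def unitary_mat_def by auto
  have hom: "\<sigma> (y + z) = \<sigma> y * \<sigma> z" for y z
    using assms unfolding unitary_rep_def by auto
  have "\<sigma> 0 = (mat_adjoint (\<sigma> 0) * \<sigma> 0) * \<sigma> 0"
    unfolding U by (rule left_mult_one_mat[symmetric]) (rule C)
  also have "\<dots> = mat_adjoint (\<sigma> 0) * (\<sigma> 0 * \<sigma> 0)"
    by (rule assoc_mult_mat[of _ ?d ?d _ ?d _ ?d]) auto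
  also have "\<dots> = 1\<^sub>m ?d" using hom[of 0 0] U by simp
  finally show one: "\<sigma> 0 = 1\<^sub>m ?d" .
  have "\<sigma> (- x) = \<sigma> (- x) * (\<sigma> x * mat_adjoint (\<sigma> x))"
    unfolding U by (rule right_mult_one_mat[symmetric]) (rule C)
  also have "\<dots> = (\<sigma> (- x) * \<sigma> x) * mat_adjoint (\<sigma> x)"
    by (rule assoc_mult_mat[of _ ?d ?d _ ?d _ ?d, symmetric]) auto
  also have "\<dots> = 1\<^sub>m ?d * mat_adjoint (\<sigma> x)" using hom[of "- x" x] one by simp
  also have "\<dots> = mat_adjoint (\<sigma> x)"
    by (rule left_mult_one_mat[OF mat_adjoint_carrier[OF C]])
  finally show "\<sigma> (- x) = mat_adjoint (\<sigma> x)" .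
qed

text \<open>Entrywise forms, since integration later acts on single matrix entries.\<close>

lemma unitary_rep_index:
  assumes "unitary_rep \<sigma>" "i < rep_dim \<sigma>" "j < rep_dim \<sigma>"
  shows "\<sigma> (x + y) $$ (i, j) = (\<Sum>k<rep_dim \<sigma>. \<sigma> x $$ (i, k) * \<sigma> y $$ (k, j))"
    and "\<sigma> (- x) $$ (i, j) = cnj (\<sigma> x $$ (j, i))"
    and "(\<Sum>k<rep_dim \<sigma>. \<sigma> x $$ (k, i) * cnj (\<sigma> x $$ (k, j))) = (if i = j then 1 else 0)"
    and "continuous_on UNIV (\<lambda>x. \<sigma> x $$ (i, j))"
proof -
  let ?d = "rep_dim \<sigma>"
  note C = unitary_rep_carrier[OF assms(1)]
  show "\<sigma> (x + y) $$ (i, j) = (\<Sum>k<?d. \<sigma> x $$ (i, k) * \<sigma> y $$ (k, j))"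
    using mult_mat_index[OF C C assms(2,3)] assms(1) unfolding unitary_rep_def by metis
  show "\<sigma> (- x) $$ (i, j) = cnj (\<sigma> x $$ (j, i))"
    unfolding unitary_rep_uminus[OF assms(1)] using C[of x] assms by (intro index_mat_adjoint) auto
  have "(mat_adjoint (\<sigma> x) * \<sigma> x) $$ (j, i) = (if i = j then 1 else 0)"
    using assms unfolding unitary_rep_def unitary_mat_def by auto
  then show "(\<Sum>k<?d. \<sigma> x $$ (k, i) * cnj (\<sigma> x $$ (k, j))) = (if i = j then 1 else 0)"
    unfolding adjoint_mult_index[OF C C assms(3,2)] by (simp add: mult.commute)
  show "continuous_on UNIV (\<lambda>x. \<sigma> x $$ (i, j))"
    using assms unfolding unitary_rep_def by auto
qed

text \<open>Over the complex numbers \<open>A\<close> has an eigenvalue, and its eigenspace is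
  invariant under everything that commutes with \<open>A\<close>. Being nonzero, it is the whole
  space.\<close>

lemma Schur_scalar:
  assumes \<sigma>: "irreducible_rep \<sigma>" and A: "A \<in> carrier_mat (rep_dim \<sigma>) (rep_dim \<sigma>)"
    and comm: "\<And>x. A * \<sigma> x = \<sigma> x * A"
  shows "\<exists>c. A = c \<cdot>\<^sub>m 1\<^sub>m (rep_dim \<sigma>)"
proof -
  let ?d = "rep_dim \<sigma>"
  have ur: "unitary_rep \<sigma>" and d: "0 < ?d"
    using \<sigma> unfolding irreducible_rep_def by auto
  note C = unitary_rep_carrier[OF ur]
  obtain c where "eigenvalue A c"
    using spectrum_non_empty[OF A d] unfolding spectrum_def by auto
  then obtain v where v: "v \<in> carrier_vec ?d" "v \<noteq> 0\<^sub>v ?d" "A *\<^sub>v v = c \<cdot>\<^sub>v v"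
    unfolding eigenvalue_def eigenvector_def using A by auto
  define W where "W = {v \<in> carrier_vec ?d. A *\<^sub>v v = c \<cdot>\<^sub>v v}"
  have "VectorSpace.subspace class_ring W (module_vec TYPE(complex) ?d)"
  proof (rule subspace_module_vec)
    show "0\<^sub>v ?d \<in> W" using A unfolding W_def by auto
    show "u + w \<in> W" if "u \<in> W" "w \<in> W" for u w
      using that A unfolding W_def
      by (auto simp: mult_add_distrib_mat_vec smult_add_distrib_vec)
    show "a \<cdot>\<^sub>v u \<in> W" if "u \<in> W" for a u
      using that A unfolding W_def by (auto simp: mult_mat_vec smult_smult_assoc mult.commute)
  qed (auto simp: W_def)
  moreover have "\<forall>x. \<forall>w\<in>W. \<sigma> x *\<^sub>v w \<in> W"
  proof (intro allI ballI)
    fix x w assume "w \<in> W"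
    then have w: "w \<in> carrier_vec ?d" "A *\<^sub>v w = c \<cdot>\<^sub>v w" unfolding W_def by auto
    have "A *\<^sub>v (\<sigma> x *\<^sub>v w) = (A * \<sigma> x) *\<^sub>v w"
      by (rule assoc_mult_mat_vec[symmetric, OF A C w(1)])
    also have "\<dots> = \<sigma> x *\<^sub>v (A *\<^sub>v w)"
      unfolding comm by (rule assoc_mult_mat_vec[OF C A w(1)])
    also have "\<dots> = c \<cdot>\<^sub>v (\<sigma> x *\<^sub>v w)"
      unfolding w(2) using C[of x] w(1) by (rule mult_mat_vec)
    finally show "\<sigma> x *\<^sub>v w \<in> W" using C[of x] w(1) unfolding W_def by auto
  qed
  ultimately have "W = {0\<^sub>v ?d} \<or> W = carrier_vec ?d"
    using \<sigma> unfolding irreducible_rep_def by auto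
  moreover have "v \<in> W" using v unfolding W_def by auto
  ultimately have W: "W = carrier_vec ?d" using v(2) by auto
  have "A = c \<cdot>\<^sub>m 1\<^sub>m ?d"
  proof (rule eq_matI)
    fix i j assume "i < dim_row (c \<cdot>\<^sub>m 1\<^sub>m ?d)" "j < dim_col (c \<cdot>\<^sub>m 1\<^sub>m ?d)"
    then have ij: "i < ?d" "j < ?d" by auto
    have "unit_vec ?d j \<in> W" unfolding W by simp
    then have "(A *\<^sub>v unit_vec ?d j) $ i = (c \<cdot>\<^sub>v unit_vec ?d j) $ i" unfolding W_def by auto
    moreover have "(A *\<^sub>v unit_vec ?d j) $ i = A $$ (i, j)"
      using A ij by (simp add: scalar_prod_right_unit)
    ultimately show "A $$ (i, j) = (c \<cdot>\<^sub>m 1\<^sub>m ?d) $$ (i, j)" using ij by simp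
  qed (use A in auto)
  then show ?thesis ..
qed

text \<open>Unlike irreducibility itself, this consequence of it transfers to conjugates at once.\<close>

definition scalar_commutant :: "'g::topological_group_add rep \<Rightarrow> bool" where
  "scalar_commutant \<sigma> \<longleftrightarrow> unitary_rep \<sigma> \<and> 0 < rep_dim \<sigma> \<and>
     (\<forall>A\<in>carrier_mat (rep_dim \<sigma>) (rep_dim \<sigma>). (\<forall>x. A * \<sigma> x = \<sigma> x * A) \<longrightarrow>
        (\<exists>c. A = c \<cdot>\<^sub>m 1\<^sub>m (rep_dim \<sigma>)))"

lemma scalar_commutantD:
  assumes "scalar_commutant \<sigma>"
  shows "unitary_rep \<sigma>" "0 < rep_dim \<sigma>"
    "A \<in> carrier_mat (rep_dim \<sigma>) (rep_dim \<sigma>) \<Longrightarrow> (\<And>x. A * \<sigma> x = \<sigma> x * A) \<Longrightarrow>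
      \<exists>c. A = c \<cdot>\<^sub>m 1\<^sub>m (rep_dim \<sigma>)"
  using assms unfolding scalar_commutant_def by auto

lemma irreducible_scalar_commutant: "irreducible_rep \<sigma> \<Longrightarrow> scalar_commutant \<sigma>"
  unfolding scalar_commutant_def using Schur_scalar irreducible_repD
  by (auto simp: irreducible_rep_def)

text \<open>The products of \<open>A\<close> with its adjoint, in both orders, commute with the two
  representations and so are scalars. Arguing with commutants instead of kernels and images makes
  the lemma available for \<open>scalar_commutant\<close>.\<close>

lemma Schur_intertwiner:
  assumes \<sigma>: "scalar_commutant \<sigma>" and \<tau>: "scalar_commutant \<tau>"
    and A: "A \<in> carrier_mat (rep_dim \<sigma>) (rep_dim \<tau>)"
    and tw: "\<And>x. \<sigma> x * A = A * \<tau> x" and nz: "A \<noteq> 0\<^sub>m (rep_dim \<sigma>) (rep_dim \<tau>)"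
  shows "unitarily_equivalent \<tau> \<sigma>"
proof -
  let ?m = "rep_dim \<sigma>" and ?n = "rep_dim \<tau>"
  note ur = scalar_commutantD(1)[OF \<sigma>] scalar_commutantD(1)[OF \<tau>]
  note C = unitary_rep_carrier[OF ur(1)] unitary_rep_carrier[OF ur(2)]
  let ?B = "mat_adjoint A"
  have B: "?B \<in> carrier_mat ?n ?m" using A by simp
  have tw': "?B * \<sigma> x = \<tau> x * ?B" for x
  proof -
    \<comment> \<open>The adjoint intertwines in the opposite direction: take adjoints of the
      relation at \<open>- x\<close>, where adjoints of group elements are their inverses.\<close>
    have "mat_adjoint (\<sigma> (- x) * A) = mat_adjoint (A * \<tau> (- x))" unfolding tw ..
    then show ?thesis
      unfolding mat_adjoint_mult[OF C(1) A] mat_adjoint_mult[OF A C(2)]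
      by (simp add: unitary_rep_uminus ur)
  qed
  have "(?B * A) * \<tau> x = \<tau> x * (?B * A)" for x
    using assoc_mult_mat[OF B A C(2)] assoc_mult_mat[OF B C(1) A] assoc_mult_mat[OF C(2) B A]
    by (metis tw tw')
  moreover have "?B * A \<in> carrier_mat ?n ?n" using A B by auto
  ultimately obtain c where c: "?B * A = c \<cdot>\<^sub>m 1\<^sub>m ?n" using scalar_commutantD(3)[OF \<tau>] by metis
  have "(A * ?B) * \<sigma> x = \<sigma> x * (A * ?B)" for x
    using assoc_mult_mat[OF A B C(1)] assoc_mult_mat[OF A C(2) B] assoc_mult_mat[OF C(1) A B]
    by (metis tw tw')
  moreover have "A * ?B \<in> carrier_mat ?m ?m" using A B by auto
  ultimately obtain c' where c': "A * ?B = c' \<cdot>\<^sub>m 1\<^sub>m ?m" using scalar_commutantD(3)[OF \<sigma>] by metis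
  obtain i j where ij: "i < ?m" "j < ?n" "A $$ (i, j) \<noteq> 0"
    using nz A by (metis (no_types, lifting) carrier_matD eq_matI index_zero_mat)
  \<comment> \<open>Associating the product of \<open>A\<close>, its adjoint and \<open>A\<close> in
    two ways compares the two scalars; a nonzero entry of \<open>A\<close> cancels.\<close>
  have "c' \<cdot>\<^sub>m A = c \<cdot>\<^sub>m A"
  proof -
    have "c' \<cdot>\<^sub>m A = (A * ?B) * A" unfolding c' mult_smult_assoc_mat[OF one_carrier_mat A] using A by simp
    also have "\<dots> = A * (?B * A)" by (rule assoc_mult_mat[OF A B A])
    also have "\<dots> = c \<cdot>\<^sub>m A"
      unfolding c mult_smult_distrib[OF A one_carrier_mat] using A by simp
    finally show ?thesis .
  qed
  then have "(c' \<cdot>\<^sub>m A) $$ (i, j) = (c \<cdot>\<^sub>m A) $$ (i, j)" by simp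
  then have cc': "c' = c" using ij A by auto
  have col: "c = (\<Sum>k<?m. of_real ((cmod (A $$ (k, l)))\<^sup>2))" if "l < ?n" for l
  proof -
    have "(?B * A) $$ (l, l) = (\<Sum>k<?m. of_real ((cmod (A $$ (k, l)))\<^sup>2))"
      unfolding adjoint_mult_index[OF A A that that] complex_norm_square by (simp add: mult.commute)
    then show ?thesis using that unfolding c by simp
  qed
  have row: "c = (\<Sum>l<?n. of_real ((cmod (A $$ (k, l)))\<^sup>2))" if "k < ?m" for k
  proof -
    have "(A * ?B) $$ (k, k) = (\<Sum>l<?n. of_real ((cmod (A $$ (k, l)))\<^sup>2))"
      unfolding mult_adjoint_index[OF A A that that] complex_norm_square by simp
    then show ?thesis using that unfolding c' cc' by simp
  qed
  define r where "r = (\<Sum>k<?m. (cmod (A $$ (k, j)))\<^sup>2)"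
  have cr: "c = of_real r" unfolding r_def col[OF ij(2)] by simp
  have "0 < r" unfolding r_def using ij by (intro sum_pos2[of _ i]) auto
  \<comment> \<open>Every row and every column of \<open>A\<close> has squared norm
    \<open>c\<close>. Summing all squared entries by columns and by rows shows that the matrix is
    square.\<close>
  have "of_nat ?n * c = (\<Sum>l<?n. c)" by simp
  also have "\<dots> = (\<Sum>l<?n. \<Sum>k<?m. of_real ((cmod (A $$ (k, l)))\<^sup>2))"
    by (intro sum.cong refl col) simp
  also have "\<dots> = (\<Sum>k<?m. \<Sum>l<?n. of_real ((cmod (A $$ (k, l)))\<^sup>2))" by (rule sum.swap)
  also have "\<dots> = (\<Sum>k<?m. c)"
    by (intro sum.cong refl row[symmetric]) simp
  also have "\<dots> = of_nat ?m * c" by simp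
  finally have dims: "?n = ?m" using cr \<open>0 < r\<close> by simp
  \<comment> \<open>Here \<open>r\<close> is the common squared length of rows and columns, so this
    factor makes \<open>A\<close> unitary.\<close>
  define s where "s = complex_of_real (1 / sqrt r)"
  have s: "cnj s * s * c = 1" "s * cnj s * c = 1"
    unfolding s_def cr using \<open>0 < r\<close> by (simp_all flip: of_real_mult)
  have sB: "mat_adjoint (s \<cdot>\<^sub>m A) = cnj s \<cdot>\<^sub>m ?B" by (rule eq_matI) auto
  have "unitary_mat ?n (s \<cdot>\<^sub>m A)"
    unfolding unitary_mat_def sB
  proof (intro conjI)
    show "s \<cdot>\<^sub>m A \<in> carrier_mat ?n ?n" using A dims by simp
    have "cnj s \<cdot>\<^sub>m ?B * (s \<cdot>\<^sub>m A) = (cnj s * s) \<cdot>\<^sub>m (?B * A)"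
      using A B by (intro eq_matI) (auto simp: scalar_prod_def sum_distrib_left mult_ac)
    then show "cnj s \<cdot>\<^sub>m ?B * (s \<cdot>\<^sub>m A) = 1\<^sub>m ?n"
      unfolding c using s by (intro eq_matI) (auto simp: mult.assoc)
    have "s \<cdot>\<^sub>m A * (cnj s \<cdot>\<^sub>m ?B) = (s * cnj s) \<cdot>\<^sub>m (A * ?B)"
      using A B by (intro eq_matI) (auto simp: scalar_prod_def sum_distrib_left mult_ac)
    then show "s \<cdot>\<^sub>m A * (cnj s \<cdot>\<^sub>m ?B) = 1\<^sub>m ?n"
      unfolding c' cc' using s dims by (intro eq_matI) (auto simp: mult.assoc)
  qed
  moreover have "s \<cdot>\<^sub>m A * \<tau> x = \<sigma> x * (s \<cdot>\<^sub>m A)" for x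
    using tw[of x] mult_smult_assoc_mat[OF A C(2)] mult_smult_distrib[OF C(1) A] by metis
  ultimately show ?thesis
    unfolding unitarily_equivalent_def using dims by blast
qed

lemma unitary_mat_one: "unitary_mat n (1\<^sub>m n)"
proof -
  have "mat_adjoint (1\<^sub>m n) = (1\<^sub>m n :: complex Matrix.mat)" by (rule eq_matI) auto
  then show ?thesis unfolding unitary_mat_def by simp
qed

lemma unitary_mat_adjoint: "unitary_mat n U \<Longrightarrow> unitary_mat n (mat_adjoint U)"
  unfolding unitary_mat_def by simp

lemma unitary_mat_mult:
  assumes "unitary_mat n U" "unitary_mat n V"
  shows "unitary_mat n (U * V)"
proof -
  have C: "U \<in> carrier_mat n n" "V \<in> carrier_mat n n"
      "mat_adjoint U \<in> carrier_mat n n" "mat_adjoint V \<in> carrier_mat n n"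
    and E: "mat_adjoint U * U = 1\<^sub>m n" "U * mat_adjoint U = 1\<^sub>m n"
      "mat_adjoint V * V = 1\<^sub>m n" "V * mat_adjoint V = 1\<^sub>m n"
    using assms unfolding unitary_mat_def by auto
  have "(mat_adjoint V * mat_adjoint U) * (U * V) = mat_adjoint V * (mat_adjoint U * (U * V))"
    using C by (intro assoc_mult_mat[of _ n n _ n _ n]) auto
  also have "mat_adjoint U * (U * V) = (mat_adjoint U * U) * V"
    using C by (intro assoc_mult_mat[of _ n n _ n _ n, symmetric]) auto
  finally have 1: "(mat_adjoint V * mat_adjoint U) * (U * V) = 1\<^sub>m n" using C E by simp
  have "(U * V) * (mat_adjoint V * mat_adjoint U) = U * (V * (mat_adjoint V * mat_adjoint U))"
    using C by (intro assoc_mult_mat[of _ n n _ n _ n]) auto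
  also have "V * (mat_adjoint V * mat_adjoint U) = (V * mat_adjoint V) * mat_adjoint U"
    using C by (intro assoc_mult_mat[of _ n n _ n _ n, symmetric]) auto
  finally have 2: "(U * V) * (mat_adjoint V * mat_adjoint U) = 1\<^sub>m n" using C E by simp
  show ?thesis
    unfolding unitary_mat_def mat_adjoint_mult[OF C(1,2)] using 1 2 C by auto
qed

lemma unitarily_equivalent_refl:
  assumes "unitary_rep \<sigma>" shows "unitarily_equivalent \<sigma> \<sigma>"
  unfolding unitarily_equivalent_def
proof (intro conjI refl exI allI)
  show "unitary_mat (rep_dim \<sigma>) (1\<^sub>m (rep_dim \<sigma>))" by (rule unitary_mat_one)
  show "1\<^sub>m (rep_dim \<sigma>) * \<sigma> x = \<sigma> x * 1\<^sub>m (rep_dim \<sigma>)" for x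
    using unitary_rep_carrier[OF assms, of x] by simp
qed

lemma unitarily_equivalent_sym:
  assumes \<sigma>: "unitary_rep \<sigma>" and \<tau>: "unitary_rep \<tau>" and eq: "unitarily_equivalent \<sigma> \<tau>"
  shows "unitarily_equivalent \<tau> \<sigma>"
proof -
  let ?n = "rep_dim \<sigma>"
  obtain U where d: "?n = rep_dim \<tau>" and U: "unitary_mat ?n U" and tw: "\<And>x. U * \<sigma> x = \<tau> x * U"
    using eq unfolding unitarily_equivalent_def by auto
  have C: "U \<in> carrier_mat ?n ?n" "\<sigma> x \<in> carrier_mat ?n ?n" "\<tau> x \<in> carrier_mat ?n ?n" for x
    using U unitary_rep_carrier[OF \<sigma>] unitary_rep_carrier[OF \<tau>] d unfolding unitary_mat_def by auto
  have "mat_adjoint U * \<tau> x = \<sigma> x * mat_adjoint U" for x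
  proof -
    have "mat_adjoint (U * \<sigma> (- x)) = mat_adjoint (\<tau> (- x) * U)" unfolding tw ..
    then show ?thesis
      unfolding mat_adjoint_mult[OF C(1,2)] mat_adjoint_mult[OF C(3,1)]
      by (simp add: unitary_rep_uminus \<sigma> \<tau>)
  qed
  then show ?thesis
    unfolding unitarily_equivalent_def using d unitary_mat_adjoint[OF U] by auto
qed

lemma unitarily_equivalent_trans:
  assumes "unitary_rep \<rho>" "unitary_rep \<sigma>" "unitary_rep \<tau>"
    and "unitarily_equivalent \<rho> \<sigma>" "unitarily_equivalent \<sigma> \<tau>"
  shows "unitarily_equivalent \<rho> \<tau>"
proof -
  let ?n = "rep_dim \<rho>"
  obtain U where d: "?n = rep_dim \<sigma>" and U: "unitary_mat ?n U" and tU: "\<And>x. U * \<rho> x = \<sigma> x * U"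
    using assms(4) unfolding unitarily_equivalent_def by auto
  obtain V where d': "?n = rep_dim \<tau>" and V: "unitary_mat ?n V" and tV: "\<And>x. V * \<sigma> x = \<tau> x * V"
    using assms(5) d unfolding unitarily_equivalent_def by auto
  have C: "U \<in> carrier_mat ?n ?n" "V \<in> carrier_mat ?n ?n" "\<rho> x \<in> carrier_mat ?n ?n"
    "\<sigma> x \<in> carrier_mat ?n ?n" "\<tau> x \<in> carrier_mat ?n ?n" for x
    using U V unitary_rep_carrier[OF assms(1)] unitary_rep_carrier[OF assms(2)]
      unitary_rep_carrier[OF assms(3)] d d' unfolding unitary_mat_def by auto
  have "(V * U) * \<rho> x = \<tau> x * (V * U)" for x
    using assoc_mult_mat[OF C(2,1,3)] assoc_mult_mat[OF C(2,4,1)] assoc_mult_mat[OF C(5,2,1)]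
    by (metis tU tV)
  then show ?thesis
    unfolding unitarily_equivalent_def using d' unitary_mat_mult[OF V U] by auto
qed

lemma equiv_unitarily_equivalent:
  "equiv {\<sigma> :: 'g::topological_group_add rep. irreducible_rep \<sigma>}
    {(\<sigma>, \<tau>). irreducible_rep \<sigma> \<and> irreducible_rep \<tau> \<and> unitarily_equivalent \<sigma> \<tau>}"
proof -
  have ur: "unitary_rep \<sigma>" if "irreducible_rep \<sigma>" for \<sigma> :: "'g rep"
    using that unfolding irreducible_rep_def by simp
  show ?thesis
    by (intro equivI refl_onI symI transI)
       (auto intro: unitarily_equivalent_refl unitarily_equivalent_sym unitarily_equivalent_trans ur)
qed

text \<open>Change of orthonormal basis, later applied to the chosen bases, so that coefficients in
  these bases become matrix entries. A matrix \<open>B\<close> commuting with \<open>\<rho>\<close>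
  yields \<open>U * (B * mat_adjoint U)\<close>, which commutes with
  \<open>\<sigma>\<close>.\<close>

lemma conjugate_rep:
  fixes \<sigma> :: "'g::topological_group_add rep"
  assumes \<sigma>: "scalar_commutant \<sigma>" and U: "unitary_mat (rep_dim \<sigma>) U"
  defines "\<rho> \<equiv> \<lambda>x. mat_adjoint U * (\<sigma> x * U)"
  shows "scalar_commutant \<rho>" "rep_dim \<rho> = rep_dim \<sigma>" "unitarily_equivalent \<rho> \<sigma>"
proof -
  let ?n = "rep_dim \<sigma>" and ?A = "mat_adjoint U"
  note ur = scalar_commutantD(1)[OF \<sigma>]
  have C: "U \<in> carrier_mat ?n ?n" "?A \<in> carrier_mat ?n ?n" "\<sigma> x \<in> carrier_mat ?n ?n" for x
    using U unitary_rep_carrier[OF ur] unfolding unitary_mat_def by auto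
  have E: "?A * U = 1\<^sub>m ?n" "U * ?A = 1\<^sub>m ?n" using U unfolding unitary_mat_def by auto
  have C\<rho>: "\<rho> x \<in> carrier_mat ?n ?n" for x
    unfolding \<rho>_def using mult_carrier_mat[OF C(2) mult_carrier_mat[OF C(3,1)]] .
  show rd: "rep_dim \<rho> = ?n" unfolding rep_dim_def[of \<rho>] using C\<rho>[of 0] by simp
  have U\<rho>: "U * \<rho> x = \<sigma> x * U" for x
  proof -
    have "U * \<rho> x = (U * ?A) * (\<sigma> x * U)"
      unfolding \<rho>_def by (rule assoc_mult_mat[OF C(1,2) mult_carrier_mat[OF C(3,1)], symmetric])
    then show ?thesis unfolding E left_mult_one_mat[OF mult_carrier_mat[OF C(3,1)]] .
  qed
  have mult: "\<rho> (x + y) = \<rho> x * \<rho> y" for x y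
  proof -
    have hom: "\<sigma> (x + y) = \<sigma> x * \<sigma> y" using ur unfolding unitary_rep_def by simp
    have "\<rho> x * \<rho> y = ?A * ((\<sigma> x * U) * \<rho> y)"
      unfolding \<rho>_def by (rule assoc_mult_mat[OF C(2) mult_carrier_mat[OF C(3,1)] C\<rho>[unfolded \<rho>_def]])
    also have "(\<sigma> x * U) * \<rho> y = \<sigma> x * (\<sigma> y * U)"
      unfolding assoc_mult_mat[OF C(3,1) C\<rho>] U\<rho> ..
    also have "\<dots> = \<sigma> (x + y) * U"
      unfolding hom by (rule assoc_mult_mat[OF C(3,3,1), symmetric])
    finally show ?thesis unfolding \<rho>_def by simp
  qed
  have uni: "unitary_mat ?n (\<rho> x)" for x
    unfolding \<rho>_def using ur
    by (intro unitary_mat_mult unitary_mat_adjoint U) (simp add: unitary_rep_def)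
  have ent: "\<rho> x $$ (i, j) = (\<Sum>k<?n. cnj (U $$ (k, i)) * (\<Sum>l<?n. \<sigma> x $$ (k, l) * U $$ (l, j)))"
    if "i < ?n" "j < ?n" for x i j
    unfolding \<rho>_def adjoint_mult_index[OF C(1) mult_carrier_mat[OF C(3,1)] that]
    using that by (intro sum.cong refl) (simp add: mult_mat_index[OF C(3,1)])
  have "continuous_on UNIV (\<lambda>x. \<rho> x $$ (i, j))" if "i < ?n" "j < ?n" for i j
    unfolding ent[OF that] by (intro continuous_intros unitary_rep_index(4)[OF ur]) auto
  then have ur\<rho>: "unitary_rep \<rho>" unfolding unitary_rep_def rd using uni mult by simp
  show "unitarily_equivalent \<rho> \<sigma>"
    unfolding unitarily_equivalent_def rd using U U\<rho> by auto
  have \<rho>A: "\<rho> x * ?A = ?A * \<sigma> x" for x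
  proof -
    have "mat_adjoint (U * \<rho> (- x)) = mat_adjoint (\<sigma> (- x) * U)" unfolding U\<rho> ..
    then show ?thesis
      unfolding mat_adjoint_mult[OF C(1) C\<rho>] mat_adjoint_mult[OF C(3,1)]
      by (simp add: unitary_rep_uminus ur ur\<rho>)
  qed
  have "\<exists>c. B = c \<cdot>\<^sub>m 1\<^sub>m ?n" if B: "B \<in> carrier_mat ?n ?n" and comm: "\<And>x. B * \<rho> x = \<rho> x * B" for B
  proof -
    note CB = mult_carrier_mat[OF B C(2)]
    have "(U * (B * ?A)) * \<sigma> x = \<sigma> x * (U * (B * ?A))" for x
    proof -
      have "(U * (B * ?A)) * \<sigma> x = U * ((B * \<rho> x) * ?A)"
        using assoc_mult_mat[OF C(1) CB C(3)] assoc_mult_mat[OF B C(2,3)] assoc_mult_mat[OF B C\<rho> C(2)]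
        by (simp add: \<rho>A)
      also have "\<dots> = \<sigma> x * (U * (B * ?A))"
        using assoc_mult_mat[OF C\<rho> B C(2)] assoc_mult_mat[OF C(1) C\<rho> CB] assoc_mult_mat[OF C(3,1) CB]
        by (simp add: comm U\<rho>[symmetric])
      finally show ?thesis .
    qed
    then obtain c where c: "U * (B * ?A) = c \<cdot>\<^sub>m 1\<^sub>m ?n"
      using scalar_commutantD(3)[OF \<sigma> mult_carrier_mat[OF C(1) CB]] by metis
    have "B = (?A * (U * (B * ?A))) * U"
      using assoc_mult_mat[OF C(2,1) CB] assoc_mult_mat[OF B C(2,1)] CB B by (simp add: E)
    also have "\<dots> = c \<cdot>\<^sub>m 1\<^sub>m ?n"
      unfolding c mult_smult_distrib[OF C(2) one_carrier_mat] right_mult_one_mat[OF C(2)]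
        mult_smult_assoc_mat[OF C(2,1)] E ..
    finally show ?thesis ..
  qed
  then show "scalar_commutant \<rho>"
    unfolding scalar_commutant_def rd using ur\<rho> scalar_commutantD(2)[OF \<sigma>] by blast
qed

section \<open>Invariant integration of continuous functions\<close>

text \<open>The tube lemma for the open set on which \<open>F\<close> is close to its slice at
  \<open>x0\<close>; it stands in for uniform continuity on domains without a metric.\<close>

lemma eventually_uniformly_close_slices:
  fixes F :: "'a::topological_space \<Rightarrow> 'b::topological_space \<Rightarrow> 'c::metric_space"
  assumes "compact (UNIV :: 'b set)" and F: "continuous_on UNIV (\<lambda>p. F (fst p) (snd p))"
    and e: "0 < e"
  shows "eventually (\<lambda>x. \<forall>y. dist (F x y) (F x0 y) < e) (nhds x0)"
proof -
  let ?W = "{p. dist (F (fst p) (snd p)) (F x0 (snd p)) < e}"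
  have "continuous_on UNIV (\<lambda>p::'a \<times> 'b. F (fst (x0, snd p)) (snd (x0, snd p)))"
    by (rule continuous_on_compose2[OF F]) (auto intro!: continuous_intros)
  then have "open ?W"
    using F by (intro open_Collect_less continuous_intros) auto
  moreover have "{x0} \<times> UNIV \<subseteq> ?W" using e by auto
  ultimately obtain X0 where "x0 \<in> X0" "open X0" "X0 \<times> UNIV \<subseteq> ?W"
    using Elementary_Topology.tube_lemma[of UNIV ?W x0] assms(1) by blast
  then have "\<forall>x\<in>X0. \<forall>y. dist (F x y) (F x0 y) < e" by (auto simp: subset_iff)
  then show ?thesis
    using \<open>x0 \<in> X0\<close> \<open>open X0\<close> unfolding eventually_nhds by blast
qed

lemma compact_Hausdorff_Urysohn:
  fixes S T :: "'a::t2_space set"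
  assumes "compact (UNIV :: 'a set)" "closed S" "closed T" "S \<inter> T = {}"
  obtains f :: "'a \<Rightarrow> real" where "continuous_on UNIV f" "\<And>x. 0 \<le> f x" "\<And>x. f x \<le> 1"
    "\<And>x. x \<in> S \<Longrightarrow> f x = 0" "\<And>x. x \<in> T \<Longrightarrow> f x = 1"
proof -
  have "Hausdorff_space (euclidean :: 'a topology)"
    unfolding Hausdorff_space_def by (auto simp: disjnt_def) (metis hausdorff)
  then have "normal_space (euclidean :: 'a topology)"
    using assms(1) by (intro compact_Hausdorff_or_regular_imp_normal_space)
      (auto simp: compact_space_def)
  then obtain f where f: "continuous_map euclidean (top_of_set {0..1::real}) f"
      "f ` S \<subseteq> {0}" "f ` T \<subseteq> {1}"
    using assms Urysohn_lemma[of euclidean S T 0 1] by (auto simp: disjnt_def)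
  show ?thesis
  proof (rule that[of f])
    show "continuous_on UNIV f"
      using f(1) by (simp add: continuous_map_in_subtopology)
    show "0 \<le> f x" "f x \<le> 1" for x
      using f(1) by (auto simp: continuous_map_in_subtopology image_subset_iff)
  qed (use f in auto)
qed

text \<open>The algebraic tensor product of the two spaces of continuous real functions, viewed as
  functions on the product space.\<close>

inductive_set tensor_sums :: "('a::topological_space \<times> 'b::topological_space \<Rightarrow> real) set" where
  tensor: "continuous_on UNIV a \<Longrightarrow> continuous_on UNIV b \<Longrightarrow>
    (\<lambda>p. a (fst p) * b (snd p)) \<in> tensor_sums"
| add: "f \<in> tensor_sums \<Longrightarrow> g \<in> tensor_sums \<Longrightarrow> (\<lambda>p. f p + g p) \<in> tensor_sums"

lemma tensor_sums_mult:
  assumes "f \<in> tensor_sums" "g \<in> tensor_sums"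
  shows "(\<lambda>p. f p * g p) \<in> tensor_sums"
  using assms
proof (induction f arbitrary: g)
  case (tensor a b)
  from tensor.prems show ?case
  proof induction
    case (tensor c d)
    have "(\<lambda>p. (a (fst p) * c (fst p)) * (b (snd p) * d (snd p))) \<in> tensor_sums"
      using tensor.hyps \<open>continuous_on UNIV a\<close> \<open>continuous_on UNIV b\<close>
      by (intro tensor_sums.tensor continuous_intros)
    then show ?case by (simp add: mult.assoc mult.left_commute)
  next
    case (add f g)
    then show ?case using tensor_sums.add by (fastforce simp: distrib_left)
  qed
next
  case (add f g)
  then show ?case using tensor_sums.add by (fastforce simp: distrib_right)
qed

lemma tensor_sums_continuous: "f \<in> tensor_sums \<Longrightarrow> continuous_on UNIV f"
proof (induction rule: tensor_sums.induct)
  case (tensor a b)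
  then show ?case
    by (intro continuous_on_mult continuous_on_compose2[of UNIV a _ fst]
        continuous_on_compose2[of UNIV b _ snd]) (auto intro: continuous_intros)
qed (auto intro: continuous_intros)

text \<open>Stone-Weierstrass: two distinct points of the product differ in some coordinate, and a
  Urysohn function of that coordinate alone separates them.\<close>

lemma tensor_sums_dense:
  fixes F :: "'a::t2_space \<times> 'b::t2_space \<Rightarrow> real"
  assumes "compact (UNIV :: 'a set)" "compact (UNIV :: 'b set)" "continuous_on UNIV F" "0 < e"
  shows "\<exists>g\<in>tensor_sums. \<forall>p. \<bar>F p - g p\<bar> < e"
proof -
  interpret function_ring_on "tensor_sums :: ('a \<times> 'b \<Rightarrow> real) set" UNIV
  proof
    show "compact (UNIV :: ('a \<times> 'b) set)"
      using compact_Times[OF assms(1,2)] by simp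
    show "(\<lambda>_. c) \<in> tensor_sums" for c
      using tensor_sums.tensor[of "\<lambda>_. c" "\<lambda>_. 1"] by simp
    show "\<exists>f\<in>tensor_sums. f p \<noteq> f q" if "p \<noteq> q" for p q :: "'a \<times> 'b"
    proof (cases "fst p = fst q")
      case False
      obtain u where u: "continuous_on UNIV u" "u (fst p) = (0::real)" "u (fst q) = 1"
        by (rule compact_Hausdorff_Urysohn[OF assms(1), of "{fst p}" "{fst q}"])
          (use False in auto)
      then show ?thesis
        using tensor_sums.tensor[of u "\<lambda>_. 1"] by (intro bexI) auto
    next
      case True
      with that have "snd p \<noteq> snd q" by (auto simp: prod_eq_iff)
      then obtain u where u: "continuous_on UNIV u" "u (snd p) = (0::real)" "u (snd q) = 1"
        by - (rule compact_Hausdorff_Urysohn[OF assms(2), of "{snd p}" "{snd q}"], auto)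
      then show ?thesis
        using tensor_sums.tensor[of "\<lambda>_. 1" u] by (intro bexI) auto
    qed
  qed (auto intro: tensor_sums.add tensor_sums_mult tensor_sums_continuous)
  show ?thesis
    using Stone_Weierstrass_basic[OF assms(3,4)] by auto
qed

lemma continuous_slices:
  assumes "continuous_on UNIV (\<lambda>p. F (fst p) (snd p))"
  shows "continuous_on UNIV (F x)" "continuous_on UNIV (\<lambda>x. F x y)"
    and "continuous_on UNIV (\<lambda>p. F (snd p) (fst p))"
proof -
  have "continuous_on UNIV (\<lambda>y. F (fst (x, y)) (snd (x, y)))"
    by (rule continuous_on_compose2[OF assms]) (auto intro!: continuous_intros)
  then show "continuous_on UNIV (F x)" by simp
  have "continuous_on UNIV (\<lambda>x. F (fst (x, y)) (snd (x, y)))"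
    by (rule continuous_on_compose2[OF assms]) (auto intro!: continuous_intros)
  then show "continuous_on UNIV (\<lambda>x. F x y)" by simp
  have "continuous_on UNIV (\<lambda>p. F (fst (snd p, fst p)) (snd (snd p, fst p)))"
    by (rule continuous_on_compose2[OF assms]) (auto intro!: continuous_intros)
  then show "continuous_on UNIV (\<lambda>p. F (snd p) (fst p))" by simp
qed

locale compact_haar =
  fixes M :: "'g::{topological_group_add, t2_space} measure"
  assumes compact: "compact (UNIV :: 'g set)" and haar: "normalized_haar_measure M"
begin

abbreviation cont :: "('g \<Rightarrow> 'b::topological_space) \<Rightarrow> bool" where
  "cont f \<equiv> continuous_on UNIV f"

lemma sets_M [measurable_cong]: "sets M = sets borel"
  using haar unfolding normalized_haar_measure_def by auto

lemma space_M [simp]: "space M = UNIV"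
  using sets_eq_imp_space_eq[OF sets_M] by simp

lemma emeasure_M: "emeasure M UNIV = 1"
  using haar unfolding normalized_haar_measure_def by auto

sublocale finite_measure M
  by standard (simp add: emeasure_M)

lemma measure_M [simp]: "measure M UNIV = 1"
  by (simp add: measure_def emeasure_M)

lemma cont_measurable: "cont f \<Longrightarrow> f \<in> borel_measurable M"
  using borel_measurable_continuous_onI measurable_cong_sets[OF sets_M refl] by blast

lemma cont_bounded:
  fixes f :: "'g \<Rightarrow> 'b::real_normed_vector"
  assumes "cont f"
  obtains B where "0 < B" "\<And>x. norm (f x) \<le> B"
proof -
  have "bounded (range f)"
    using compact_continuous_image[OF assms compact] by (rule compact_imp_bounded)
  then show ?thesis using that by (auto simp: bounded_pos)
qed

lemma bounded_integrable:
  fixes f :: "'g \<Rightarrow> 'b::{banach, second_countable_topology}"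
  assumes "f \<in> borel_measurable M" "\<And>x. norm (f x) \<le> B"
  shows "integrable M f"
  using assms by (intro integrable_const_bound[of _ B]) auto

lemma cont_integrable:
  fixes f :: "'g \<Rightarrow> 'b::{banach, second_countable_topology}"
  assumes "cont f"
  shows "integrable M f"
  using cont_bounded[OF assms] cont_measurable[OF assms] bounded_integrable by metis

lemma cont_comp: "cont f \<Longrightarrow> cont g \<Longrightarrow> cont (\<lambda>x. f (g x))"
  by (rule continuous_on_compose2) auto

lemma norm_integral_le:
  fixes f :: "'g \<Rightarrow> 'b::{banach, second_countable_topology}"
  assumes "cont f" "\<And>x. norm (f x) \<le> B"
  shows "norm (integral\<^sup>L M f) \<le> B"
proof -
  have "norm (integral\<^sup>L M f) \<le> (\<integral>x. norm (f x) \<partial>M)"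
    by (rule integral_norm_bound)
  also have "\<dots> \<le> (\<integral>x. B \<partial>M)"
    using assms by (intro integral_mono cont_integrable continuous_intros) auto
  finally show ?thesis by simp
qed

text \<open>Nearby slices are uniformly close because the group is compact, and the total mass is
  1.\<close>

lemma cont_parametric_integral:
  fixes F :: "'a::topological_space \<Rightarrow> 'g \<Rightarrow> 'b::{banach, second_countable_topology}"
  assumes F: "continuous_on UNIV (\<lambda>p. F (fst p) (snd p))"
  shows "continuous_on UNIV (\<lambda>x. \<integral>y. F x y \<partial>M)"
  unfolding continuous_on_def
proof (intro ballI tendstoI)
  fix x0 and e :: real assume e: "0 < e"
  have "eventually (\<lambda>x. \<forall>y. dist (F x y) (F x0 y) < e/2) (nhds x0)"
    using e by (intro eventually_uniformly_close_slices compact F) auto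
  then have "eventually (\<lambda>x. dist (\<integral>y. F x y \<partial>M) (\<integral>y. F x0 y \<partial>M) < e) (nhds x0)"
  proof eventually_elim
    case (elim x)
    have "norm (\<integral>y. F x y - F x0 y \<partial>M) \<le> e/2"
      using elim by (intro norm_integral_le continuous_intros continuous_slices[OF F])
        (auto simp: dist_norm less_imp_le)
    then show ?case
      using e by (simp add: dist_norm cont_integrable continuous_slices[OF F])
  qed
  then show "\<forall>\<^sub>F x in at x0 within UNIV. dist (\<integral>y. F x y \<partial>M) (\<integral>y. F x0 y \<partial>M) < e"
    unfolding eventually_at_filter by eventually_elim simp
qed

text \<open>The Borel sets of the product can exceed the product sigma-algebra, so continuity does
  not at once give the measurability that product measures ask for. For tensors the exchange is
  trivial, and both sides are continuous for uniform convergence.\<close>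

lemma Fubini_real:
  fixes F :: "'g \<Rightarrow> 'g \<Rightarrow> real"
  assumes F: "continuous_on UNIV (\<lambda>p. F (fst p) (snd p))"
  shows "(\<integral>x. \<integral>y. F x y \<partial>M \<partial>M) = (\<integral>y. \<integral>x. F x y \<partial>M \<partial>M)"
proof -
  have tens: "(\<integral>x. \<integral>y. f (x, y) \<partial>M \<partial>M) = (\<integral>y. \<integral>x. f (x, y) \<partial>M \<partial>M)"
    if "f \<in> tensor_sums" for f :: "'g \<times> 'g \<Rightarrow> real"
    using that
  proof induction
    case (tensor a b)
    then show ?case by (simp add: cont_integrable)
  next
    case (add f g)
    have fc: "continuous_on UNIV (\<lambda>p. f (fst p, snd p))" "continuous_on UNIV (\<lambda>p. g (fst p, snd p))"
      using add tensor_sums_continuous by auto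
    note c1 = continuous_slices[of "\<lambda>x y. f (x, y)", OF fc(1)]
      and c2 = continuous_slices[of "\<lambda>x y. g (x, y)", OF fc(2)]
    have p: "cont (\<lambda>x. \<integral>y. f (x, y) \<partial>M)" "cont (\<lambda>y. \<integral>x. f (x, y) \<partial>M)"
        "cont (\<lambda>x. \<integral>y. g (x, y) \<partial>M)" "cont (\<lambda>y. \<integral>x. g (x, y) \<partial>M)"
      by (intro cont_parametric_integral, use fc c1 c2 in simp)+
    show ?case
      using add.IH c1 c2 p by (simp add: cont_integrable)
  qed
  show ?thesis
  proof (rule ccontr)
    let ?D = "\<lambda>F. (\<integral>x. \<integral>y. F x y \<partial>M \<partial>M) - (\<integral>y. \<integral>x. F x y \<partial>M \<partial>M)"
    assume "\<not> ?thesis"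
    \<comment> \<open>An error of one third of the supposed gap is contradictory: both iterated
      integrals of the remainder are at most a third, yet their difference is the whole gap.\<close>
    then have "0 < \<bar>?D F\<bar> / 3" by simp
    then obtain g where g: "g \<in> tensor_sums" and gF: "\<And>p. \<bar>F (fst p) (snd p) - g p\<bar> < \<bar>?D F\<bar> / 3"
      using tensor_sums_dense[OF compact compact F] by blast
    define H where "H x y = F x y - g (x, y)" for x y
    have Hc: "continuous_on UNIV (\<lambda>p. H (fst p) (snd p))"
      unfolding H_def using F tensor_sums_continuous[OF g] by (auto intro!: continuous_intros)
    have gc: "continuous_on UNIV (\<lambda>p. g (fst p, snd p))"
      using tensor_sums_continuous[OF g] by simp
    note cs = continuous_slices[OF F] continuous_slices[of "\<lambda>x y. g (x, y)", OF gc]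
      continuous_slices[OF Hc]
    have p: "cont (\<lambda>x. \<integral>y. g (x, y) \<partial>M)" "cont (\<lambda>y. \<integral>x. g (x, y) \<partial>M)"
        "cont (\<lambda>x. \<integral>y. F x y \<partial>M)" "cont (\<lambda>y. \<integral>x. F x y \<partial>M)"
        "cont (\<lambda>x. \<integral>y. H x y \<partial>M)" "cont (\<lambda>y. \<integral>x. H x y \<partial>M)"
      by (intro cont_parametric_integral, use gc F Hc cs in simp)+
    have "?D H = ?D F - ?D (\<lambda>x y. g (x, y))"
      unfolding H_def using cs p by (simp add: cont_integrable)
    then have "?D H = ?D F" using tens[OF g] by simp
    have Hb: "\<bar>H x y\<bar> \<le> \<bar>?D F\<bar> / 3" for x y
      using gF[of "(x, y)"] by (simp add: H_def less_imp_le)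
    have "\<bar>\<integral>x. \<integral>y. H x y \<partial>M \<partial>M\<bar> \<le> \<bar>?D F\<bar> / 3"
      unfolding real_norm_def[symmetric] using Hb
      by (intro norm_integral_le p cs) auto
    moreover have "\<bar>\<integral>y. \<integral>x. H x y \<partial>M \<partial>M\<bar> \<le> \<bar>?D F\<bar> / 3"
      unfolding real_norm_def[symmetric] using Hb
      by (intro norm_integral_le p cs) auto
    moreover have False if "\<bar>a\<bar> \<le> \<bar>d\<bar> / 3" "\<bar>b\<bar> \<le> \<bar>d\<bar> / 3" "a - b = d" "0 < \<bar>d\<bar> / 3" for a b d :: real
      using that by linarith
    ultimately show False using \<open>?D H = ?D F\<close> \<open>0 < \<bar>?D F\<bar> / 3\<close> by metis
  qed
qed

lemma Fubini:
  fixes F :: "'g \<Rightarrow> 'g \<Rightarrow> complex"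
  assumes F: "continuous_on UNIV (\<lambda>p. F (fst p) (snd p))"
  shows "(\<integral>x. \<integral>y. F x y \<partial>M \<partial>M) = (\<integral>y. \<integral>x. F x y \<partial>M \<partial>M)"
proof -
  have F': "continuous_on UNIV (\<lambda>p. F (snd p) (fst p))" by (rule continuous_slices[OF F])
  note i = cont_integrable[OF continuous_slices(1)[OF F]] cont_integrable[OF continuous_slices(2)[OF F]]
    cont_integrable[OF cont_parametric_integral[OF F]]
    cont_integrable[OF cont_parametric_integral[OF F']]
  have R: "continuous_on UNIV (\<lambda>p. Re (F (fst p) (snd p)))"
    "continuous_on UNIV (\<lambda>p. Im (F (fst p) (snd p)))"
    using F by (auto intro!: continuous_intros)
  show ?thesis
    using Fubini_real[OF R(1)] Fubini_real[OF R(2)] i by (simp add: complex_eq_iff)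
qed

lemma integral_left:
  fixes f :: "'g \<Rightarrow> 'b::{banach, second_countable_topology}"
  assumes "cont f"
  shows "(\<integral>x. f (a + x) \<partial>M) = (\<integral>x. f x \<partial>M)"
proof -
  have "(\<lambda>x. a + x) \<in> measurable M borel"
    by (intro cont_measurable continuous_intros)
  moreover have "f \<in> borel_measurable borel"
    using assms by (rule borel_measurable_continuous_onI)
  moreover have "distr M borel (\<lambda>x. a + x) = M"
    using haar unfolding normalized_haar_measure_def by auto
  ultimately show ?thesis
    by (metis integral_distr)
qed

text \<open>Integrate \<open>f (- y + x)\<close> over both variables. Left invariance in
  \<open>x\<close> gives the integral of \<open>f\<close>; left invariance in \<open>y\<close>,
  shifting by \<open>x\<close>, gives the integral of its reflection.\<close>

lemma integral_inverse:
  fixes f :: "'g \<Rightarrow> complex"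
  assumes f: "cont f"
  shows "(\<integral>x. f (- x) \<partial>M) = (\<integral>x. f x \<partial>M)"
proof -
  have F: "continuous_on UNIV (\<lambda>p. f (- snd p + fst p))"
    by (rule continuous_on_compose2[OF f]) (auto intro!: continuous_intros)
  have "(\<integral>y. f (- y + x) \<partial>M) = (\<integral>y. f (- (x + y) + x) \<partial>M)" for x
    by (rule integral_left[of "\<lambda>y. f (- y + x)", symmetric])
       (rule continuous_slices(1)[of "\<lambda>x y. f (- y + x)", OF F])
  then have "(\<integral>x. \<integral>y. f (- y + x) \<partial>M \<partial>M) = (\<integral>x. f (- x) \<partial>M)"
    by (simp add: minus_add add.assoc)
  moreover have "(\<integral>y. \<integral>x. f (- y + x) \<partial>M \<partial>M) = (\<integral>x. f x \<partial>M)"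
    by (simp add: integral_left[OF f])
  ultimately show ?thesis using Fubini[of "\<lambda>x y. f (- y + x)", OF F] by simp
qed

lemma integral_reflect:
  fixes f :: "'g \<Rightarrow> complex"
  assumes f: "cont f"
  shows "(\<integral>y. f (- y + x) \<partial>M) = (\<integral>y. f y \<partial>M)"
proof -
  have "cont (\<lambda>y. f (- y + x))"
    by (rule cont_comp[OF f]) (auto intro!: continuous_intros)
  then have "(\<integral>y. f (- y + x) \<partial>M) = (\<integral>y. f (- (x + y) + x) \<partial>M)"
    by (rule integral_left[of "\<lambda>y. f (- y + x)", symmetric])
  then show ?thesis by (simp add: minus_add add.assoc integral_inverse[OF f])
qed

text \<open>By compactness finitely many translates of \<open>U\<close> cover the group. They all
  have the same measure, which cannot be 0 since the total mass is 1.\<close>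

lemma open_pos:
  assumes "open U" "U \<noteq> {}"
  shows "0 < measure M U"
proof (rule ccontr)
  assume "\<not> 0 < measure M U"
  then have U0: "emeasure M U = 0"
    using measure_nonneg[of M U] by (simp add: emeasure_eq_measure)
  obtain u where u: "u \<in> U" using assms by auto
  have op: "open ((\<lambda>x. a + x) -` U)" for a
    by (rule open_vimage[OF assms(1)]) (intro continuous_intros)
  have "UNIV \<subseteq> (\<Union>a\<in>UNIV. (\<lambda>x. a + x) -` U)"
  proof
    fix x
    have "(u - x) + x \<in> U" using u by (simp only: diff_add_cancel)
    then show "x \<in> (\<Union>a\<in>UNIV. (\<lambda>x. a + x) -` U)" by blast
  qed
  then obtain A where A: "finite A" "UNIV \<subseteq> (\<Union>a\<in>A. (\<lambda>x. a + x) -` U)"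
    using compactE_image[OF compact, of UNIV "\<lambda>a. (\<lambda>x. a + x) -` U"] op by metis
  have z: "emeasure M ((\<lambda>x. a + x) -` U) = 0" for a
  proof -
    have d: "distr M borel (\<lambda>x. a + x) = M"
      using haar unfolding normalized_haar_measure_def by auto
    have "(\<lambda>x. a + x) \<in> measurable M borel"
      by (intro cont_measurable continuous_intros)
    then have "emeasure (distr M borel (\<lambda>x. a + x)) U = emeasure M ((\<lambda>x. a + x) -` U)"
      using assms by (subst emeasure_distr) auto
    then show ?thesis using d U0 by simp
  qed
  have "emeasure M UNIV \<le> emeasure M (\<Union>a\<in>A. (\<lambda>x. a + x) -` U)"
    using A op by (intro emeasure_mono) (auto simp: sets_M)
  also have "\<dots> \<le> (\<Sum>a\<in>A. emeasure M ((\<lambda>x. a + x) -` U))"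
    using A op by (intro emeasure_subadditive_finite) (auto simp: sets_M)
  finally show False using z emeasure_M by simp
qed

text \<open>The set where \<open>f\<close> is positive is open, so it is empty once it is null. This
  makes \<open>l2\<close> definite on continuous functions.\<close>

lemma integral_nonneg_eq_0:
  fixes f :: "'g \<Rightarrow> real"
  assumes f: "cont f" "\<And>x. 0 \<le> f x" "(\<integral>x. f x \<partial>M) = 0"
  shows "f x = 0"
proof (rule ccontr)
  assume "f x \<noteq> 0"
  let ?U = "{y. 0 < f y}"
  have "open ?U" using f by (intro open_Collect_less) auto
  then have "0 < measure M ?U" using f(2)[of x] \<open>f x \<noteq> 0\<close>
    by (intro open_pos) (auto simp: less_le)
  moreover have "AE y in M. f y = 0"
    using integral_nonneg_eq_0_iff_AE[OF cont_integrable[OF f(1)]] f by simp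
  then have "AE y in M. y \<notin> ?U" by eventually_elim auto
  then have "measure M ?U = 0"
    using \<open>open ?U\<close> by (subst (asm) AE_iff_measurable[OF _ refl]) (auto simp: sets_M measure_def)
  ultimately show False by simp
qed

subsection \<open>The pre-Hilbert space of continuous functions\<close>

definition ip :: "('g \<Rightarrow> complex) \<Rightarrow> ('g \<Rightarrow> complex) \<Rightarrow> complex" where
  "ip f g = (\<integral>x. f x * cnj (g x) \<partial>M)"

definition l2 :: "('g \<Rightarrow> complex) \<Rightarrow> real" where
  "l2 f = sqrt (\<integral>x. (cmod (f x))\<^sup>2 \<partial>M)"

lemma ip_add: "cont f \<Longrightarrow> cont g \<Longrightarrow> cont h \<Longrightarrow> ip (\<lambda>x. f x + g x) h = ip f h + ip g h"
  unfolding ip_def distrib_right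
  by (intro Bochner_Integration.integral_add cont_integrable continuous_intros)

lemma ip_diff: "cont f \<Longrightarrow> cont g \<Longrightarrow> cont h \<Longrightarrow> ip (\<lambda>x. f x - g x) h = ip f h - ip g h"
  unfolding ip_def left_diff_distrib
  by (intro Bochner_Integration.integral_diff cont_integrable continuous_intros)

lemma ip_scale: "ip (\<lambda>x. c * f x) h = c * ip f h"
  unfolding ip_def by (simp add: mult.assoc)

lemma ip_sum:
  assumes "\<And>i. i \<in> I \<Longrightarrow> cont (e i)" "cont h"
  shows "ip (\<lambda>x. \<Sum>i\<in>I. c i * e i x) h = (\<Sum>i\<in>I. c i * ip (e i) h)"
proof -
  have "ip (\<lambda>x. \<Sum>i\<in>I. c i * e i x) h = (\<integral>x. (\<Sum>i\<in>I. c i * (e i x * cnj (h x))) \<partial>M)"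
    unfolding ip_def by (simp add: sum_distrib_right mult.assoc)
  also have "\<dots> = (\<Sum>i\<in>I. \<integral>x. c i * (e i x * cnj (h x)) \<partial>M)"
    using assms by (intro Bochner_Integration.integral_sum cont_integrable continuous_intros)
  also have "\<dots> = (\<Sum>i\<in>I. c i * ip (e i) h)"
    unfolding ip_def by simp
  finally show ?thesis .
qed

lemma ip_cnj: "cnj (ip f g) = ip g f"
  unfolding ip_def by (subst Bochner_Integration.integral_cnj[symmetric]) (simp add: mult.commute)

lemma ip_diff_right: "cont f \<Longrightarrow> cont g \<Longrightarrow> cont h \<Longrightarrow> ip h (\<lambda>x. f x - g x) = ip h f - ip h g"
  using ip_diff[of f g h] by (metis complex_cnj_diff ip_cnj)

lemma ip_scale_right: "ip h (\<lambda>x. c * f x) = cnj c * ip h f"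
  using ip_scale[of c f h] by (metis complex_cnj_mult ip_cnj)

lemma ip_sum_right:
  assumes "\<And>i. i \<in> I \<Longrightarrow> cont (e i)" "cont h"
  shows "ip h (\<lambda>x. \<Sum>i\<in>I. c i * e i x) = (\<Sum>i\<in>I. cnj (c i) * ip h (e i))"
  by (subst ip_cnj[symmetric], subst ip_sum) (simp_all add: assms ip_cnj)

lemma l2_nonneg [simp]: "0 \<le> l2 f"
  unfolding l2_def by simp

lemma l2_sq: "(l2 f)\<^sup>2 = (\<integral>x. (cmod (f x))\<^sup>2 \<partial>M)"
  unfolding l2_def by (intro real_sqrt_pow2 integral_nonneg_AE) auto

lemma ip_self: "ip f f = of_real ((l2 f)\<^sup>2)"
proof -
  have "ip f f = (\<integral>x. complex_of_real ((cmod (f x))\<^sup>2) \<partial>M)"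
    unfolding ip_def by (intro Bochner_Integration.integral_cong refl complex_norm_square[symmetric])
  also have "\<dots> = of_real ((l2 f)\<^sup>2)"
    unfolding l2_sq by (rule integral_complex_of_real)
  finally show ?thesis .
qed

lemma l2_zero: "l2 (\<lambda>x. 0) = 0"
  unfolding l2_def by simp

lemma l2_eq_0:
  assumes "cont f" "l2 f = 0"
  shows "f = (\<lambda>x. 0)"
proof
  fix x
  have "(cmod (f x))\<^sup>2 = 0"
    using assms l2_sq[of f]
    by (intro integral_nonneg_eq_0[of "\<lambda>x. (cmod (f x))\<^sup>2"] continuous_intros) simp_all
  then show "f x = 0" by simp
qed

lemma l2_le: "cont f \<Longrightarrow> (\<And>x. cmod (f x) \<le> B) \<Longrightarrow> l2 f \<le> B"
proof -
  assume f: "cont f" "\<And>x. cmod (f x) \<le> B"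
  have "0 \<le> B" using f(2)[of undefined] norm_ge_zero order_trans by blast
  have "norm (\<integral>x. (cmod (f x))\<^sup>2 \<partial>M) \<le> B\<^sup>2"
    using f by (intro norm_integral_le continuous_intros) (auto intro!: power_mono)
  then have "(l2 f)\<^sup>2 \<le> B\<^sup>2" by (simp add: l2_sq)
  then show "l2 f \<le> B" using \<open>0 \<le> B\<close> by (rule power2_le_imp_le)
qed

lemma l2_scale: "l2 (\<lambda>x. c * f x) = cmod c * l2 f"
  unfolding l2_def by (simp add: norm_mult power_mult_distrib real_sqrt_mult)

lemma l2_diff_sq:
  assumes "cont f" "cont g"
  shows "(l2 (\<lambda>x. f x - g x))\<^sup>2 = (l2 f)\<^sup>2 + (l2 g)\<^sup>2 - 2 * Re (ip f g)"
proof -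
  have "complex_of_real ((l2 (\<lambda>x. f x - g x))\<^sup>2)
      = of_real ((l2 f)\<^sup>2) + of_real ((l2 g)\<^sup>2) - (ip f g + cnj (ip f g))"
    unfolding ip_self[symmetric] ip_cnj using assms
    by (simp add: ip_diff ip_diff_right continuous_intros)
  then have "complex_of_real ((l2 (\<lambda>x. f x - g x))\<^sup>2)
      = of_real ((l2 f)\<^sup>2 + (l2 g)\<^sup>2 - 2 * Re (ip f g))"
    by (simp add: complex_add_cnj)
  then show ?thesis using of_real_eq_iff by blast
qed

text \<open>Pythagoras for the projection onto the line through \<open>g\<close>. It yields
  Cauchy-Schwarz, and later the approximate orthogonality of a minimizing sequence.\<close>

lemma l2_diff_projection_sq:
  assumes f: "cont f" and g: "cont g" and nz: "l2 g \<noteq> 0"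
  shows "(l2 (\<lambda>x. f x - (ip f g / of_real ((l2 g)\<^sup>2)) * g x))\<^sup>2 = (l2 f)\<^sup>2 - (cmod (ip f g))\<^sup>2 / (l2 g)\<^sup>2"
proof -
  define c where "c = ip f g / of_real ((l2 g)\<^sup>2)"
  have "(l2 (\<lambda>x. f x - c * g x))\<^sup>2 = (l2 f)\<^sup>2 + (cmod c * l2 g)\<^sup>2 - 2 * Re (cnj c * ip f g)"
    using f g by (subst l2_diff_sq) (auto simp: l2_scale ip_scale_right intro!: continuous_intros)
  also have "cnj c * ip f g = of_real ((cmod (ip f g))\<^sup>2 / (l2 g)\<^sup>2)"
    unfolding c_def using complex_norm_square[of "ip f g"] by (simp add: mult.commute)
  also have "(cmod c * l2 g)\<^sup>2 = (cmod (ip f g))\<^sup>2 / (l2 g)\<^sup>2"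
    unfolding c_def using nz by (simp add: norm_divide norm_mult power_divide power_mult_distrib
        power2_eq_square)
  finally show ?thesis unfolding c_def by simp
qed

lemma ip_Cauchy_Schwarz:
  assumes f: "cont f" and g: "cont g"
  shows "cmod (ip f g) \<le> l2 f * l2 g"
proof (cases "l2 g = 0")
  case True
  then have "g = (\<lambda>x. 0)" using g l2_eq_0 by blast
  then show ?thesis by (simp add: ip_def True)
next
  case False
  then have "(cmod (ip f g))\<^sup>2 / (l2 g)\<^sup>2 \<le> (l2 f)\<^sup>2"
    using l2_diff_projection_sq[OF f g False]
      zero_le_power2[of "l2 (\<lambda>x. f x - (ip f g / of_real ((l2 g)\<^sup>2)) * g x)"] by linarith
  then have "(cmod (ip f g))\<^sup>2 \<le> (l2 f * l2 g)\<^sup>2"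
    using False by (simp add: divide_le_eq power_mult_distrib)
  then show ?thesis by (rule power2_le_imp_le) simp
qed

section \<open>Convolution; multiplicatively, the second factor is evaluated at the inverse of
  \<open>y\<close> times \<open>x\<close>\<close>

definition conv :: "('g \<Rightarrow> complex) \<Rightarrow> ('g \<Rightarrow> complex) \<Rightarrow> 'g \<Rightarrow> complex" where
  "conv f g x = (\<integral>y. f y * g (- y + x) \<partial>M)"

lemma cont_fst: "cont f \<Longrightarrow> continuous_on UNIV (\<lambda>p. f (fst p))"
  and cont_snd: "cont f \<Longrightarrow> continuous_on UNIV (\<lambda>p. f (snd p))"
  and cont_quot: "cont f \<Longrightarrow> continuous_on UNIV (\<lambda>p. f (- fst p + snd p))"
  and cont_quot': "cont f \<Longrightarrow> continuous_on UNIV (\<lambda>p. f (- snd p + fst p))"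
  by (rule continuous_on_compose2[of UNIV f], auto intro!: continuous_intros)+

lemma cont_left: "cont f \<Longrightarrow> cont (\<lambda>x. f (a + x))"
  and cont_reflect: "cont f \<Longrightarrow> cont (\<lambda>y. f (- y + x))"
  by (rule cont_comp[of f], auto intro!: continuous_intros)+

lemma cont_conv:
  assumes "cont f" "cont g"
  shows "cont (conv f g)"
  unfolding conv_def
  by (intro cont_parametric_integral continuous_intros cont_snd[OF assms(1)] cont_quot'[OF assms(2)])

lemmas cont_intros = continuous_intros cont_conv

lemma conv_eq_ip: "conv f g x = ip f (\<lambda>y. cnj (g (- y + x)))"
  unfolding conv_def ip_def by simp

lemma l2_reflect:
  assumes "cont g"
  shows "l2 (\<lambda>y. cnj (g (- y + x))) = l2 g"
proof -
  have "complex_of_real (\<integral>y. (cmod (g (- y + x)))\<^sup>2 \<partial>M)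
      = (\<integral>y. complex_of_real ((cmod (g (- y + x)))\<^sup>2) \<partial>M)"
    by (simp only: integral_complex_of_real)
  also have "\<dots> = (\<integral>y. complex_of_real ((cmod (g y))\<^sup>2) \<partial>M)"
    by (rule integral_reflect) (intro continuous_intros assms)
  also have "\<dots> = complex_of_real (\<integral>y. (cmod (g y))\<^sup>2 \<partial>M)"
    by (simp only: integral_complex_of_real)
  finally show ?thesis unfolding l2_def of_real_eq_iff by simp
qed

text \<open>Cauchy-Schwarz against the reflected and translated kernel, whose L2 norm does not
  depend on \<open>x\<close>. A uniform bound thus comes out of L2 data.\<close>

lemma conv_bound: "cont f \<Longrightarrow> cont g \<Longrightarrow> cmod (conv f g x) \<le> l2 f * l2 g"
  using ip_Cauchy_Schwarz[of f "\<lambda>y. cnj (g (- y + x))"]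
  by (simp add: conv_eq_ip l2_reflect continuous_intros cont_reflect)

lemma l2_conv: "cont f \<Longrightarrow> cont g \<Longrightarrow> l2 (conv f g) \<le> l2 f * l2 g"
  by (intro l2_le cont_conv conv_bound)

lemma conv_add: "cont f \<Longrightarrow> cont g \<Longrightarrow> cont k \<Longrightarrow> conv (\<lambda>x. f x + g x) k x = conv f k x + conv g k x"
  unfolding conv_eq_ip by (rule ip_add) (simp_all add: continuous_intros cont_reflect)

lemma conv_diff: "cont f \<Longrightarrow> cont g \<Longrightarrow> cont k \<Longrightarrow> conv (\<lambda>x. f x - g x) k x = conv f k x - conv g k x"
  unfolding conv_eq_ip by (rule ip_diff) (simp_all add: continuous_intros cont_reflect)

lemma conv_scale: "conv (\<lambda>x. c * f x) k x = c * conv f k x"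
  unfolding conv_eq_ip by (rule ip_scale)

lemma conv_scale_right: "conv f (\<lambda>x. c * k x) x = c * conv f k x"
  unfolding conv_def by (simp add: mult.left_commute)

lemma conv_assoc:
  assumes "cont f" "cont g" "cont h"
  shows "conv (conv f g) h = conv f (conv g h)"
proof
  fix x
  have "conv (conv f g) h x = (\<integral>z. \<integral>y. f y * g (- y + z) * h (- z + x) \<partial>M \<partial>M)"
    unfolding conv_def by simp
  also have "\<dots> = (\<integral>y. \<integral>z. f y * g (- y + z) * h (- z + x) \<partial>M \<partial>M)"
    by (intro Fubini continuous_intros cont_snd[OF assms(1)] cont_quot'[OF assms(2)]
        continuous_on_compose2[OF assms(3)]) auto
  also have "\<dots> = (\<integral>y. f y * (\<integral>z. g z * h (- z + (- y + x)) \<partial>M) \<partial>M)"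
  proof (rule Bochner_Integration.integral_cong[OF refl])
    fix y
    have "(\<integral>z. g z * h (- z + (- y + x)) \<partial>M)
        = (\<integral>z. g (- y + z) * h (- (- y + z) + (- y + x)) \<partial>M)"
      by (rule integral_left[of "\<lambda>z. g z * h (- z + (- y + x))" "- y", symmetric])
         (intro continuous_intros assms(2) cont_reflect[OF assms(3)])
    also have "\<dots> = (\<integral>z. g (- y + z) * h (- z + x) \<partial>M)"
      by (simp add: minus_add add.assoc)
    finally show "(\<integral>z. f y * g (- y + z) * h (- z + x) \<partial>M)
        = f y * (\<integral>z. g z * h (- z + (- y + x)) \<partial>M)"
      by (simp add: mult.assoc)
  qed
  finally show "conv (conv f g) h x = conv f (conv g h) x" unfolding conv_def .
qed

text \<open>The condition on \<open>k\<close> says that the integral kernel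
  \<open>k (- y + x)\<close> is hermitian in the pair of variables.\<close>

lemma conv_selfadjoint:
  assumes "cont f" "cont g" "cont k" and k: "\<And>x. k (- x) = cnj (k x)"
  shows "ip (conv f k) g = ip f (conv g k)"
proof -
  have "ip (conv f k) g = (\<integral>x. \<integral>y. f y * k (- y + x) * cnj (g x) \<partial>M \<partial>M)"
    unfolding ip_def conv_def by simp
  also have "\<dots> = (\<integral>y. \<integral>x. f y * k (- y + x) * cnj (g x) \<partial>M \<partial>M)"
    by (intro Fubini continuous_intros cont_fst[OF assms(2)] cont_snd[OF assms(1)]
        cont_quot'[OF assms(3)])
  also have "\<dots> = (\<integral>y. f y * cnj (conv g k y) \<partial>M)"
  proof (rule Bochner_Integration.integral_cong[OF refl])
    fix y
    have "cnj (k (- x + y)) = k (- y + x)" for x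
      using k[of "- x + y"] by (simp add: minus_add)
    then have "cnj (conv g k y) = (\<integral>x. k (- y + x) * cnj (g x) \<partial>M)"
      unfolding conv_def
      by (subst Bochner_Integration.integral_cnj[symmetric]) (simp add: mult.commute)
    then show "(\<integral>x. f y * k (- y + x) * cnj (g x) \<partial>M) = f y * cnj (conv g k y)"
      by (simp add: mult.assoc)
  qed
  finally show ?thesis unfolding ip_def .
qed

text \<open>Convolution from the right commutes with left translation, so fixed spaces of such
  operators are left invariant.\<close>

lemma conv_left_translate:
  assumes "cont f" "cont k"
  shows "conv (\<lambda>x. f (a + x)) k x = conv f k (a + x)"
proof -
  have "(\<integral>y. f (a + y) * k (- y + x) \<partial>M) = (\<integral>y. f (a + (- a + y)) * k (- (- a + y) + x) \<partial>M)"
    by (rule integral_left[of "\<lambda>y. f (a + y) * k (- y + x)" "- a", symmetric])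
       (intro continuous_intros cont_left[OF assms(1)] cont_reflect[OF assms(2)])
  then show ?thesis
    unfolding conv_def by (simp add: minus_add add.assoc)
qed

lemma ip_left_translate:
  "cont f \<Longrightarrow> cont g \<Longrightarrow> ip (\<lambda>x. f (a + x)) (\<lambda>x. g (a + x)) = ip f g"
  unfolding ip_def by (rule integral_left[of "\<lambda>x. f x * cnj (g x)"]) (intro continuous_intros)

text \<open>Substitute for completeness: the functions \<open>f n\<close> may have no continuous L2
  limit, but their convolutions are uniformly Cauchy by \<open>conv_bound\<close>.\<close>

lemma conv_uniform_limit:
  assumes k: "cont k" and f: "\<And>n. cont (f n)"
    and C: "\<And>e. 0 < e \<Longrightarrow> \<exists>N. \<forall>m\<ge>N. \<forall>n\<ge>N. (l2 (\<lambda>x. f m x - f n x))\<^sup>2 < e"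
  obtains q where "cont q" "uniform_limit UNIV (\<lambda>n. conv (f n) k) q sequentially"
proof -
  have "uniformly_Cauchy_on UNIV (\<lambda>n. conv (f n) k)"
  proof (rule uniformly_Cauchy_onI)
    fix e :: real assume "0 < e"
    define \<delta> where "\<delta> = e / (l2 k + 1)"
    have k_pos: "0 < l2 k + 1" by (simp add: add_nonneg_pos)
    then have "0 < \<delta>" unfolding \<delta>_def using \<open>0 < e\<close> by simp
    then obtain N where N: "\<And>m n. N \<le> m \<Longrightarrow> N \<le> n \<Longrightarrow> (l2 (\<lambda>x. f m x - f n x))\<^sup>2 < \<delta>\<^sup>2"
      using C[of "\<delta>\<^sup>2"] by auto
    show "\<exists>N. \<forall>x\<in>UNIV. \<forall>m\<ge>N. \<forall>n\<ge>N. dist (conv (f m) k x) (conv (f n) k x) < e"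
    proof (intro exI allI ballI impI)
      fix x m n assume "N \<le> m" "N \<le> n"
      have "l2 (\<lambda>x. f m x - f n x) < \<delta>"
        by (rule power2_less_imp_less[OF N[OF \<open>N \<le> m\<close> \<open>N \<le> n\<close>] less_imp_le[OF \<open>0 < \<delta>\<close>]])
      have "dist (conv (f m) k x) (conv (f n) k x) = cmod (conv (\<lambda>x. f m x - f n x) k x)"
        unfolding dist_norm conv_diff[OF f f k] ..
      also have "\<dots> \<le> l2 (\<lambda>x. f m x - f n x) * l2 k"
        by (rule conv_bound[OF continuous_on_diff[OF f f] k])
      also have "\<dots> \<le> \<delta> * l2 k"
        using \<open>l2 (\<lambda>x. f m x - f n x) < \<delta>\<close> by (intro mult_right_mono) auto
      also have "\<dots> < \<delta> * (l2 k + 1)" using \<open>0 < \<delta>\<close> by simp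
      also have "\<dots> = e" unfolding \<delta>_def using k_pos by simp
      finally show "dist (conv (f m) k x) (conv (f n) k x) < e" .
    qed
  qed
  then have "uniformly_convergent_on UNIV (\<lambda>n. conv (f n) k)"
    by (rule Cauchy_uniformly_convergent)
  then obtain q where q: "uniform_limit UNIV (\<lambda>n. conv (f n) k) q sequentially"
    unfolding uniformly_convergent_on_def by blast
  have "cont q"
    by (rule uniform_limit_theorem[OF _ q]) (auto simp: cont_conv f k)
  then show ?thesis using that q by blast
qed

text \<open>
  Power iteration: \<open>k * \<dots> * k\<close> with an odd number of factors converges uniformly, because its
  inner products are a decreasing sequence, and the limit is fixed by \<open>\<lambda>f. f * k * k\<close>.  It is not
  zero because the \<open>n\<close>-th power of the operator has norm 1, and this norm bounds the \<open>L\<^sup>2\<close> norm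
  of its kernel from below.
\<close>

lemma fixed_point_of_normalized_kernel:
  assumes k: "cont k" and herm: "\<And>x. k (- x) = cnj (k x)"
    and contr: "\<And>f. cont f \<Longrightarrow> l2 (conv f k) \<le> l2 f"
    and sharp: "\<And>\<epsilon>. 0 < \<epsilon> \<Longrightarrow> \<exists>f. cont f \<and> l2 f \<le> 1 \<and> 1 - \<epsilon> < l2 (conv f k)"
  shows "\<exists>q. cont q \<and> q \<noteq> (\<lambda>x. 0) \<and> conv (conv q k) k = q"
proof -
  define T where "T f = conv f k" for f
  \<comment> \<open>\<open>P n\<close> is the convolution of \<open>n + 1\<close> copies of
    \<open>k\<close>; hence it is the kernel of the power \<open>Suc n\<close> of \<open>T\<close>,
    and the indices below are off by one.\<close>
  define P where "P n = (T ^^ n) k" for n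
  have cT: "cont ((T ^^ n) f)" if "cont f" for n f
    using that k by (induction n) (auto simp: T_def cont_conv)
  have cP: "cont (P n)" for n unfolding P_def by (rule cT[OF k])
  have sa: "ip (T f) g = ip f (T g)" if "cont f" "cont g" for f g
    unfolding T_def using that k herm by (rule conv_selfadjoint)
  have TP: "(T ^^ Suc n) f = conv f (P n)" if f: "cont f" for n f
  proof (induction n)
    case (Suc n)
    have "(T ^^ Suc (Suc n)) f = T ((T ^^ Suc n) f)" by simp
    also have "\<dots> = conv (conv f (P n)) k" unfolding Suc T_def ..
    finally show ?case by (simp add: conv_assoc f k cP) (simp add: P_def T_def)
  qed (simp add: P_def T_def)
  have P_ge: "1 \<le> l2 (P n)" for n
  proof (rule ccontr)
    assume "\<not> 1 \<le> l2 (P n)"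
    \<comment> \<open>If the kernel norm were below 1, so would be its root \<open>c\<close>, and
      some \<open>f\<close> would satisfy \<open>c < l2 (T f)\<close>. Its iterates grow at least
      geometrically and overtake the bound that the kernel imposes.\<close>
    define c where "c = root (Suc n) (l2 (P n))"
    have c: "c ^ Suc n = l2 (P n)" "0 \<le> c"
      unfolding c_def by (rule real_root_pow_pos2) simp_all
    then have "c < 1" using \<open>\<not> 1 \<le> l2 (P n)\<close> one_le_power[of c "Suc n"] by force
    then obtain f where f: "cont f" "l2 f \<le> 1" "c < l2 (T f)"
      using sharp[of "1 - c"] unfolding T_def by auto
    define a where "a m = l2 ((T ^^ m) f)" for m
    have a0: "0 \<le> a m" for m unfolding a_def by simp
    \<comment> \<open>Self-adjointness moves one factor \<open>T\<close> across the inner product;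
      Cauchy-Schwarz then makes the norms of the iterates log-convex.\<close>
    have lc: "(a (Suc m))\<^sup>2 \<le> a m * a (Suc (Suc m))" for m
    proof -
      have "complex_of_real ((a (Suc m))\<^sup>2) = ip ((T ^^ m) f) ((T ^^ Suc (Suc m)) f)"
        unfolding a_def ip_self[symmetric] using sa[of "(T ^^ m) f" "T ((T ^^ m) f)"]
          cT[OF f(1), of "Suc m"] cT[OF f(1), of m] by simp
      then have "(a (Suc m))\<^sup>2 = cmod (ip ((T ^^ m) f) ((T ^^ Suc (Suc m)) f))"
        by (metis norm_of_real abs_power2 of_real_power power2_abs)
      also have "\<dots> \<le> a m * a (Suc (Suc m))"
        unfolding a_def by (intro ip_Cauchy_Schwarz cT f)
      finally show ?thesis .
    qed
    \<comment> \<open>By log-convexity the successive ratios do not decrease, and the first is at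
      least \<open>a 1\<close> because \<open>a 0\<close> is at most 1.\<close>
    have grow: "a 1 * a m \<le> a (Suc m)" for m
    proof (induction m)
      case 0
      then show ?case using f(2) a0[of 1] by (simp add: a_def mult_left_le)
    next
      case (Suc m)
      have "a 1 * (a (Suc m))\<^sup>2 \<le> a 1 * (a m * a (Suc (Suc m)))"
        using lc a0 by (intro mult_left_mono) auto
      also have "\<dots> \<le> a (Suc m) * a (Suc (Suc m))"
        using Suc a0 by (simp only: mult.assoc[symmetric]) (intro mult_right_mono)
      finally have "a (Suc m) * (a 1 * a (Suc m)) \<le> a (Suc m) * a (Suc (Suc m))"
        by (simp add: power2_eq_square mult.left_commute)
      then show ?case
        using a0[of "Suc m"] a0[of "Suc (Suc m)"]
        by (cases "a (Suc m) = 0") (auto simp: less_le)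
    qed
    have pow: "a 1 ^ Suc m \<le> a (Suc m)" for m
    proof (induction m)
      case (Suc m)
      have "a 1 ^ Suc (Suc m) \<le> a 1 * a (Suc m)"
        using Suc a0[of 1] by (simp add: mult_left_mono)
      also have "\<dots> \<le> a (Suc (Suc m))" by (rule grow)
      finally show ?case .
    qed simp
    have "l2 (P n) < a 1 ^ Suc n"
      unfolding c(1)[symmetric] using f(3) c(2)
      by (intro power_strict_mono) (auto simp: a_def)
    also have "\<dots> \<le> a (Suc n)" by (rule pow)
    also have "\<dots> \<le> l2 f * l2 (P n)"
      unfolding a_def TP[OF f(1)] by (intro l2_conv f cP)
    also have "\<dots> \<le> l2 (P n)" using f(2) by (simp add: mult_left_le_one_le)
    finally show False by simp
  qed
  define b where "b n = (l2 (P n))\<^sup>2" for n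
  have shift: "ip (P (i + m)) (P j) = ip (P i) (P (j + m))" for i j m
  proof (induction m arbitrary: j)
    case (Suc m)
    have "ip (P (i + Suc m)) (P j) = ip (P (i + m)) (P (Suc j))"
      using sa[OF cP cP] by (simp add: P_def)
    then show ?case using Suc by simp
  qed simp
  \<comment> \<open>Even indices only: factors can then be shifted until both arguments are equal,
    and the inner product becomes a squared norm.\<close>
  have ipP: "ip (P (2 * n)) (P (2 * m)) = of_real (b (n + m))" for n m
  proof (cases "m \<le> n")
    case True
    then show ?thesis
      using shift[of "n + m" "n - m" "2 * m"] by (simp add: b_def ip_self mult_2 add.commute[of m n] del: of_real_power)
  next
    case False
    then show ?thesis
      using shift[of "2 * n" "m - n" "n + m"] by (simp add: b_def ip_self mult_2 add.commute[of m n] del: of_real_power)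
  qed
  have "b (Suc n) \<le> b n" for n
    unfolding b_def P_def using contr[OF cT[OF k]] by (auto intro!: power_mono simp: T_def)
  then have "decseq b" by (simp add: decseq_Suc_iff)
  moreover have "0 \<le> b n" for n by (simp add: b_def)
  ultimately obtain L where L: "b \<longlonglongrightarrow> L"
    using decseq_convergent[of b 0] by blast
  \<comment> \<open>All three terms on the right tend to \<open>L\<close> before weighting, and the
    weights 1 + 1 - 2 cancel, so the sequence is L2 Cauchy.\<close>
  have dist_sq: "(l2 (\<lambda>x. P (2 * n) x - P (2 * m) x))\<^sup>2 = b (2 * n) + b (2 * m) - 2 * b (n + m)" for n m
    using l2_diff_sq[OF cP cP, of "2 * n" "2 * m"] ipP[of n m] by (simp add: b_def)
  \<comment> \<open>One further application of \<open>T\<close> upgrades the L2 Cauchy property to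
    uniform convergence.\<close>
  define Q where "Q n = T (P (2 * n))" for n
  have cQ: "cont (Q n)" for n unfolding Q_def T_def by (intro cont_intros cP k)
  have k_pos: "0 < l2 k" using P_ge[of 0] by (simp add: P_def)
  have "\<exists>N. \<forall>m\<ge>N. \<forall>n\<ge>N. (l2 (\<lambda>x. P (2 * m) x - P (2 * n) x))\<^sup>2 < e" if "0 < e" for e :: real
  proof -
    obtain N where N: "\<And>n. N \<le> n \<Longrightarrow> \<bar>b n - L\<bar> < e / 4"
      using LIMSEQ_D[OF L, of "e / 4"] \<open>0 < e\<close> by auto
    have "(l2 (\<lambda>x. P (2 * m) x - P (2 * n) x))\<^sup>2 < e" if "N \<le> m" "N \<le> n" for m n
    proof -
      have "\<bar>b (2 * m) - L\<bar> < e / 4" "\<bar>b (2 * n) - L\<bar> < e / 4" "\<bar>b (m + n) - L\<bar> < e / 4"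
        by (rule N, use that in simp)+
      then show ?thesis unfolding dist_sq by linarith
    qed
    then show ?thesis by blast
  qed
  then obtain q where cq: "cont q" and "uniform_limit UNIV (\<lambda>n. conv (P (2 * n)) k) q sequentially"
    using conv_uniform_limit[OF k, of "\<lambda>n. P (2 * n)"] cP by blast
  then have q: "uniform_limit UNIV Q q sequentially" unfolding Q_def T_def by simp
  have "q \<noteq> (\<lambda>x. 0)"
  proof
    assume "q = (\<lambda>x. 0)"
    then obtain n where "\<forall>x. cmod (Q n x) < 1/2"
      using uniform_limitD[OF q, of "1/2"] by (auto simp: eventually_sequentially)
    then have "l2 (Q n) \<le> 1/2" by (intro l2_le cQ) (auto simp: less_imp_le)
    moreover have "Q n = P (Suc (2 * n))" by (simp add: Q_def P_def)
    ultimately show False using P_ge[of "Suc (2 * n)"] by simp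
  qed
  moreover have "conv (conv q k) k = q"
  proof
    fix x
    have QS: "conv (conv (Q n) k) k = Q (Suc n)" for n
      by (simp add: Q_def T_def P_def)
    have "(\<lambda>n. conv (conv (Q n) k) k x) \<longlonglongrightarrow> conv (conv q k) k x"
    proof (rule tendstoI)
      fix e :: real assume "0 < e"
      have "eventually (\<lambda>n. \<forall>x\<in>UNIV. dist (Q n x) (q x) < e / (2 * l2 k)) sequentially"
        using \<open>0 < e\<close> k_pos by (intro uniform_limitD[OF q]) auto
      then show "eventually (\<lambda>n. dist (conv (conv (Q n) k) k x) (conv (conv q k) k x) < e) sequentially"
      proof eventually_elim
        case (elim n)
        let ?D = "\<lambda>x. Q n x - q x"
        have "conv (conv (Q n) k) k x - conv (conv q k) k x = conv (conv ?D k) k x"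
          by (simp add: conv_diff[symmetric] cQ cq k cont_intros)
        then have "dist (conv (conv (Q n) k) k x) (conv (conv q k) k x) \<le> l2 (conv ?D k) * l2 k"
          by (simp add: dist_norm conv_bound cont_intros cQ cq k)
        also have "\<dots> \<le> l2 ?D * l2 k"
          by (intro mult_right_mono contr cont_intros cQ cq) simp
        also have "\<dots> \<le> e / (2 * l2 k) * l2 k"
          using elim by (intro mult_right_mono l2_le cont_intros cQ cq)
             (auto simp: dist_norm less_imp_le)
        also have "\<dots> < e" using \<open>0 < e\<close> k_pos by simp
        finally show ?case .
      qed
    qed
    moreover have "(\<lambda>n. Q (Suc n) x) \<longlonglongrightarrow> q x"
      using tendsto_uniform_limitI[OF q, of x] by (simp add: LIMSEQ_Suc[of "\<lambda>n. Q n x"])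
    ultimately show "conv (conv q k) k x = q x"
      unfolding QS by (rule LIMSEQ_unique)
  qed
  ultimately show ?thesis using cq by blast
qed

text \<open>The scalar is the reciprocal of the operator norm of convolution by \<open>k\<close>. A
  supremum that may not be attained is enough, because the normalized result only asks for almost
  extremal functions.\<close>

lemma fixed_point_of_scaled_kernel:
  assumes k: "cont k" and herm: "\<And>x. k (- x) = cnj (k x)" and nz: "k \<noteq> (\<lambda>x. 0)"
  shows "\<exists>c q. cont q \<and> q \<noteq> (\<lambda>x. 0) \<and> conv (conv q (\<lambda>x. c * k x)) (\<lambda>x. c * k x) = q"
proof -
  define S where "S = {l2 (conv f k) |f. cont f \<and> l2 f \<le> 1}"
  have k_pos: "0 < l2 k" using nz l2_eq_0[OF k] by (auto simp: less_le)
  have bdd: "bdd_above S"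
  proof (rule bdd_aboveI)
    fix r assume "r \<in> S"
    then obtain f where "cont f" "l2 f \<le> 1" "r = l2 (conv f k)" unfolding S_def by auto
    then show "r \<le> l2 k"
      using l2_conv[of f k] k mult_left_le_one_le[of "l2 k" "l2 f"] by simp
  qed
  define \<Lambda> where "\<Lambda> = Sup S"
  have norm_le: "l2 (conv f k) \<le> \<Lambda> * l2 f" if f: "cont f" for f
  proof (cases "l2 f = 0")
    case True
    then show ?thesis using l2_conv[OF f k] by simp
  next
    case False
    define g where "g x = of_real (1 / l2 f) * f x" for x
    have cg: "cont g" unfolding g_def by (intro cont_intros f)
    have "l2 g = 1" using False unfolding g_def l2_scale by (simp add: norm_divide)
    then have "l2 (conv g k) \<in> S" unfolding S_def using cg by auto
    then have "l2 (conv g k) \<le> \<Lambda>" unfolding \<Lambda>_def using bdd by (rule cSup_upper)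
    moreover have "conv g k = (\<lambda>x. of_real (1 / l2 f) * conv f k x)"
      unfolding g_def by (rule ext, rule conv_scale)
    ultimately have "l2 (\<lambda>x. of_real (1 / l2 f) * conv f k x) \<le> \<Lambda>" by simp
    then have "l2 (conv f k) / l2 f \<le> \<Lambda>" unfolding l2_scale by (simp add: norm_divide)
    then show ?thesis using False by (simp add: divide_le_eq less_le)
  qed
  \<comment> \<open>For a hermitian kernel the convolution square at the identity is the squared L2
    norm, so the operator, and with it \<open>\<Lambda>\<close>, is nonzero.\<close>
  have "conv k k 0 = ip k k"
    unfolding conv_def ip_def by (simp add: herm)
  then have "conv k k 0 \<noteq> 0" using k_pos by (simp add: ip_self)
  then have "l2 (conv k k) \<noteq> 0" using l2_eq_0[OF cont_conv[OF k k]] by auto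
  then have "0 < \<Lambda> * l2 k" using norm_le[OF k] l2_nonneg[of "conv k k"] by linarith
  then have \<Lambda>: "0 < \<Lambda>" using k_pos by (simp add: zero_less_mult_iff)
  define c where "c = complex_of_real (1 / \<Lambda>)"
  define k' where "k' x = c * k x" for x
  have k': "cont k'" unfolding k'_def by (intro cont_intros k)
  have l2k': "l2 (conv f k') = l2 (conv f k) / \<Lambda>" for f
  proof -
    have "conv f k' = (\<lambda>x. c * conv f k x)"
      unfolding k'_def by (rule ext, rule conv_scale_right)
    then have "l2 (conv f k') = cmod c * l2 (conv f k)" by (simp only: l2_scale)
    then show ?thesis using \<Lambda> by (simp add: c_def norm_divide)
  qed
  have "\<exists>q. cont q \<and> q \<noteq> (\<lambda>x. 0) \<and> conv (conv q k') k' = q"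
  proof (rule fixed_point_of_normalized_kernel[OF k'])
    show "k' (- x) = cnj (k' x)" for x
      unfolding k'_def c_def by (simp add: herm)
    show "l2 (conv f k') \<le> l2 f" if "cont f" for f
      unfolding l2k' using norm_le[OF that] \<Lambda> by (simp add: divide_le_eq mult.commute)
    fix \<epsilon> :: real assume "0 < \<epsilon>"
    have "S \<noteq> {}" unfolding S_def using l2_zero by (auto intro!: exI[of _ "\<lambda>x. 0"])
    moreover have "\<Lambda> * (1 - \<epsilon>) < \<Lambda>" using \<Lambda> \<open>0 < \<epsilon>\<close> by (simp add: algebra_simps)
    ultimately obtain r where "r \<in> S" "\<Lambda> * (1 - \<epsilon>) < r"
      unfolding \<Lambda>_def by (metis less_cSupD)
    then show "\<exists>f. cont f \<and> l2 f \<le> 1 \<and> 1 - \<epsilon> < l2 (conv f k')"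
      unfolding S_def l2k' using \<Lambda> by (auto simp: less_divide_eq mult.commute)
  qed
  then show ?thesis unfolding k'_def by blast
qed

subsection \<open>Finite-dimensional invariant subspaces\<close>

definition lin :: "('g \<Rightarrow> complex) set \<Rightarrow> bool" where
  "lin W \<longleftrightarrow> (\<forall>f\<in>W. cont f) \<and> (\<lambda>x. 0) \<in> W \<and> (\<forall>f\<in>W. \<forall>g\<in>W. (\<lambda>x. f x + g x) \<in> W) \<and>
     (\<forall>c. \<forall>f\<in>W. (\<lambda>x. c * f x) \<in> W)"

definition ons :: "('g \<Rightarrow> complex) set \<Rightarrow> bool" where
  "ons B \<longleftrightarrow> finite B \<and> (\<forall>f\<in>B. cont f) \<and> (\<forall>f\<in>B. \<forall>g\<in>B. ip f g = (if f = g then 1 else 0))"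

lemma linD:
  assumes "lin W"
  shows "f \<in> W \<Longrightarrow> cont f" and "(\<lambda>x. 0) \<in> W"
    and "f \<in> W \<Longrightarrow> g \<in> W \<Longrightarrow> (\<lambda>x. f x + g x) \<in> W" and "f \<in> W \<Longrightarrow> (\<lambda>x. c * f x) \<in> W"
  using assms unfolding lin_def by auto

lemma lin_sum: "lin W \<Longrightarrow> (\<And>i. i \<in> I \<Longrightarrow> e i \<in> W) \<Longrightarrow> (\<lambda>x. \<Sum>i\<in>I. c i * e i x) \<in> W"
proof (induction I rule: infinite_finite_induct)
  case (insert i I)
  then show ?case unfolding lin_def by simp
qed (simp_all add: lin_def)

lemma lin_diff:
  assumes "lin W" "f \<in> W" "g \<in> W"
  shows "(\<lambda>x. f x - g x) \<in> W"
proof -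
  have "(\<lambda>x. f x + (-1) * g x) \<in> W"
    by (rule linD(3)[OF assms(1,2) linD(4)[OF assms(1,3)]])
  then show ?thesis by simp
qed

definition proj :: "('g \<Rightarrow> complex) set \<Rightarrow> ('g \<Rightarrow> complex) \<Rightarrow> 'g \<Rightarrow> complex" where
  "proj B f x = (\<Sum>b\<in>B. ip f b * b x)"

lemma cont_proj: "ons B \<Longrightarrow> cont (proj B f)"
  unfolding proj_def ons_def by (intro continuous_intros) auto

lemma ip_proj:
  assumes "ons B" "b \<in> B"
  shows "ip (proj B f) b = ip f b"
proof -
  have "ip (proj B f) b = (\<Sum>a\<in>B. ip f a * ip a b)"
    unfolding proj_def using assms unfolding ons_def by (intro ip_sum) auto
  also have "\<dots> = (\<Sum>a\<in>B. if a = b then ip f a else 0)"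
    using assms unfolding ons_def by (intro sum.cong) auto
  finally show ?thesis using assms by (simp add: ons_def)
qed

lemma Bessel:
  assumes B: "ons B" and f: "cont f"
  shows "(\<Sum>b\<in>B. (cmod (ip f b))\<^sup>2) \<le> (l2 f)\<^sup>2"
proof -
  let ?s = "\<Sum>b\<in>B. (cmod (ip f b))\<^sup>2"
  have 1: "ip g (proj B f) = of_real ?s" if "cont g" "\<And>b. b \<in> B \<Longrightarrow> ip g b = ip f b" for g
  proof -
    have "ip g (proj B f) = (\<Sum>b\<in>B. cnj (ip f b) * ip g b)"
      unfolding proj_def using B that unfolding ons_def by (intro ip_sum_right) auto
    also have "\<dots> = (\<Sum>b\<in>B. of_real ((cmod (ip f b))\<^sup>2))"
      using that by (intro sum.cong) (simp_all only: complex_norm_square mult.commute)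
    finally show ?thesis by simp
  qed
  have "complex_of_real ((l2 (proj B f))\<^sup>2) = of_real ?s"
    unfolding ip_self[symmetric] by (intro 1 cont_proj B ip_proj)
  then have "(l2 (proj B f))\<^sup>2 = ?s" using of_real_eq_iff by blast
  moreover have "Re (ip f (proj B f)) = ?s"
    using 1[OF f] by simp
  ultimately have "0 \<le> (l2 f)\<^sup>2 - ?s"
    using l2_diff_sq[OF f cont_proj[OF B], of f] zero_le_power2[of "l2 (\<lambda>x. f x - proj B f x)"]
    by linarith
  then show ?thesis by simp
qed

text \<open>One Gram-Schmidt step: the remainder of \<open>f\<close> after projection is orthogonal
  to \<open>B\<close>, nonzero, and still in \<open>W\<close>.\<close>

lemma ons_extend:
  assumes W: "lin W" and B: "ons B" "B \<subseteq> W" and f: "f \<in> W" "f \<noteq> proj B f"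
  shows "\<exists>B'. ons B' \<and> B' \<subseteq> W \<and> card B' = Suc (card B)"
proof -
  define r where "r x = f x - proj B f x" for x
  have cf: "cont f" using W f unfolding lin_def by auto
  have cr: "cont r" unfolding r_def by (intro continuous_intros cf cont_proj B)
  have rW: "r \<in> W"
    unfolding r_def proj_def using B by (intro lin_diff W f lin_sum) auto
  have rb: "ip r b = 0" if "b \<in> B" for b
    unfolding r_def using that B ip_proj[OF B(1) that]
    by (subst ip_diff) (auto simp: cf cont_proj ons_def)
  have r0: "l2 r \<noteq> 0"
  proof
    assume "l2 r = 0"
    then have "r = (\<lambda>x. 0)" by (rule l2_eq_0[OF cr])
    then have "f = proj B f" unfolding r_def by (auto simp: fun_eq_iff)
    then show False using f by simp
  qed
  define u where "u x = of_real (1 / l2 r) * r x" for x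
  have cu: "cont u" unfolding u_def by (intro continuous_intros cr)
  have "l2 u = 1" using r0 unfolding u_def l2_scale by (simp add: norm_divide)
  then have uu: "ip u u = 1" by (simp add: ip_self)
  have ub: "ip u b = 0" if "b \<in> B" for b
    unfolding u_def ip_scale using rb[OF that] by simp
  then have bu: "ip b u = 0" if "b \<in> B" for b
    using that ip_cnj[of u b] by simp
  have "u \<notin> B" using ub uu by auto
  then have "ons (insert u B)" "card (insert u B) = Suc (card B)"
    using B(1) uu ub bu cu unfolding ons_def by auto
  moreover have "u \<in> W" unfolding u_def by (rule linD(4)[OF W rW])
  ultimately show ?thesis using B(2) by (intro exI[of _ "insert u B"]) auto
qed

text \<open>Dimension is measured by the sizes of orthonormal sets, which Bessel's inequality can
  bound directly.\<close>

definition rank_bounded :: "('g \<Rightarrow> complex) set \<Rightarrow> nat \<Rightarrow> bool" where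
  "rank_bounded W n \<longleftrightarrow> (\<forall>B. ons B \<and> B \<subseteq> W \<longrightarrow> card B \<le> n)"

definition rank :: "('g \<Rightarrow> complex) set \<Rightarrow> nat" where
  "rank W = (LEAST n. rank_bounded W n)"

lemma rank_bounded_rank: "rank_bounded W n \<Longrightarrow> rank_bounded W (rank W)"
  unfolding rank_def by (rule LeastI)

text \<open>An orthonormal set of maximal size must reproduce every element of \<open>W\<close>,
  since otherwise a Gram-Schmidt step would enlarge it.\<close>

lemma ons_basis:
  assumes W: "lin W" and n: "rank_bounded W n"
  obtains B where "ons B" "B \<subseteq> W" "card B = rank W" "\<And>f. f \<in> W \<Longrightarrow> f = proj B f"
proof -
  have "ons {}" by (simp add: ons_def)
  have "\<exists>B. ons B \<and> B \<subseteq> W \<and> card B = rank W"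
  proof (rule ccontr)
    assume *: "\<not> ?thesis"
    have "rank W \<noteq> 0" using * \<open>ons {}\<close> by fastforce
    then have "rank_bounded W (rank W - 1)"
      using * rank_bounded_rank[OF n] unfolding rank_bounded_def
      by (metis One_nat_def Suc_pred le_SucE not_gr_zero)
    then have "rank W \<le> rank W - 1" unfolding rank_def by (rule Least_le)
    then show False using \<open>rank W \<noteq> 0\<close> by simp
  qed
  then obtain B where B: "ons B" "B \<subseteq> W" "card B = rank W" by blast
  moreover have "f = proj B f" if "f \<in> W" for f
    using ons_extend[OF W B(1,2) that] rank_bounded_rank[OF n] B(3)
    unfolding rank_bounded_def by (metis not_less_eq_eq order_refl)
  ultimately show ?thesis using that by blast
qed

text \<open>A function of \<open>W\<close> outside \<open>W'\<close> would extend a basis of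
  \<open>W'\<close> to an orthonormal set larger than the rank of \<open>W\<close> allows.\<close>

lemma rank_eq_imp_eq:
  assumes "lin W" "rank_bounded W n" "lin W'" "W' \<subseteq> W" "rank W \<le> rank W'"
  shows "W' = W"
proof (rule ccontr)
  assume "W' \<noteq> W"
  then obtain f where f: "f \<in> W" "f \<notin> W'" using assms by auto
  have "rank_bounded W' n" using assms unfolding rank_bounded_def by auto
  then obtain B where B: "ons B" "B \<subseteq> W'" "card B = rank W'"
    using ons_basis[OF assms(3)] by metis
  have "f \<noteq> proj B f"
  proof
    assume "f = proj B f"
    moreover have "proj B f \<in> W'"
      using lin_sum[OF assms(3), of B "\<lambda>b. b" "ip f"] B unfolding proj_def by auto
    ultimately show False using f by simp
  qed
  then obtain B' where "ons B'" "B' \<subseteq> W" "card B' = Suc (card B)"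
    using ons_extend[OF assms(1) B(1) _ f(1)] B(2) assms(4) by blast
  then show False
    using rank_bounded_rank[OF assms(2)] B(3) assms(5) unfolding rank_bounded_def by fastforce
qed

definition left_inv :: "('g \<Rightarrow> complex) set \<Rightarrow> bool" where
  "left_inv W \<longleftrightarrow> (\<forall>f\<in>W. \<forall>a. (\<lambda>x. f (a + x)) \<in> W)"

definition minimal_left_inv :: "('g \<Rightarrow> complex) set \<Rightarrow> bool" where
  "minimal_left_inv W \<longleftrightarrow> lin W \<and> left_inv W \<and> \<not> W \<subseteq> {\<lambda>x. 0} \<and>
     (\<forall>W'. lin W' \<and> left_inv W' \<and> \<not> W' \<subseteq> {\<lambda>x. 0} \<and> W' \<subseteq> W \<longrightarrow> W' = W)"

text \<open>Choose a nonzero invariant subspace of least rank; one inside it has no smaller rank and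
  therefore coincides with it.\<close>

lemma minimal_left_inv_exists:
  assumes "lin V" "left_inv V" "rank_bounded V n" "\<not> V \<subseteq> {\<lambda>x. 0}"
  obtains W where "minimal_left_inv W" "W \<subseteq> V"
proof -
  define P where "P W \<longleftrightarrow> lin W \<and> left_inv W \<and> W \<subseteq> V \<and> \<not> W \<subseteq> {\<lambda>x. 0}" for W
  have "P V" using assms unfolding P_def by simp
  then obtain W where W: "P W" "\<And>W'. P W' \<Longrightarrow> rank W \<le> rank W'"
    using ex_has_least_nat[of P V rank] by blast
  have "W' = W" if W': "lin W'" "left_inv W'" "\<not> W' \<subseteq> {\<lambda>x. 0}" "W' \<subseteq> W" for W'
  proof -
    have "P W'" using W' W(1) unfolding P_def by auto
    moreover have "rank_bounded W n" using assms(3) W(1) unfolding rank_bounded_def P_def by auto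
    ultimately show "W' = W"
      using W W' unfolding P_def by (intro rank_eq_imp_eq[of W n]) auto
  qed
  then show ?thesis
    using that[of W] W(1) unfolding P_def minimal_left_inv_def by blast
qed

lemma fixed_space_lin:
  assumes "cont k"
  shows "lin {f. cont f \<and> conv f k = f}"
  unfolding lin_def
proof (intro conjI ballI allI; (elim CollectE conjE)?)
  have "conv (\<lambda>x. 0) k = (\<lambda>x. 0)" unfolding conv_def by simp
  then show "(\<lambda>x. 0) \<in> {f. cont f \<and> conv f k = f}" by simp
next
  fix f g assume "cont f" "conv f k = f" "cont g" "conv g k = g"
  then show "(\<lambda>x. f x + g x) \<in> {f. cont f \<and> conv f k = f}"
    using conv_add[of f g k] assms by (auto intro!: continuous_intros)
next
  fix c f assume "cont f" "conv f k = f"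
  then show "(\<lambda>x. c * f x) \<in> {f. cont f \<and> conv f k = f}"
    using conv_scale[of c f k] by (auto intro!: continuous_intros)
qed

lemma fixed_space_left_inv:
  assumes "cont k"
  shows "left_inv {f. cont f \<and> conv f k = f}"
  unfolding left_inv_def
proof (intro ballI allI, elim CollectE conjE, intro CollectI conjI)
  fix f a assume f: "cont f" "conv f k = f"
  show "cont (\<lambda>x. f (a + x))" by (rule cont_left[OF f(1)])
  show "conv (\<lambda>x. f (a + x)) k = (\<lambda>x. f (a + x))"
    using conv_left_translate[OF f(1) assms, of a] f(2) by (intro ext) simp
qed

text \<open>Bessel's inequality at each point, integrated, bounds the trace of the projection.\<close>

lemma fixed_space_rank_bounded:
  assumes k: "cont k"
  shows "\<exists>n. rank_bounded {f. cont f \<and> conv f k = f} n"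
proof -
  have "card B \<le> nat \<lceil>(l2 k)\<^sup>2\<rceil>" if B: "ons B" "B \<subseteq> {f. cont f \<and> conv f k = f}" for B
  proof -
    have cB: "cont b" "conv b k = b" if "b \<in> B" for b using B that by auto
    have le: "(\<Sum>b\<in>B. (cmod (b x))\<^sup>2) \<le> (l2 k)\<^sup>2" for x
    proof -
      \<comment> \<open>A fixed function is reproduced by this kernel: its value at \<open>x\<close>
        is, up to conjugation, an inner product with \<open>?\<kappa>\<close>, so the values of
        \<open>B\<close> at \<open>x\<close> are Bessel coefficients.\<close>
      let ?\<kappa> = "\<lambda>y. cnj (k (- y + x))"
      have c\<kappa>: "cont ?\<kappa>" by (intro continuous_intros cont_reflect k)
      have "cmod (b x) = cmod (ip ?\<kappa> b)" if "b \<in> B" for b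
      proof -
        have "b x = cnj (ip ?\<kappa> b)"
          using cB(2)[OF that] conv_eq_ip[of b k x] by (simp add: ip_cnj)
        then show ?thesis by simp
      qed
      then have "(\<Sum>b\<in>B. (cmod (b x))\<^sup>2) = (\<Sum>b\<in>B. (cmod (ip ?\<kappa> b))\<^sup>2)"
        by (intro sum.cong) auto
      also have "\<dots> \<le> (l2 k)\<^sup>2"
        using Bessel[OF B(1) c\<kappa>] by (simp add: l2_reflect[OF k])
      finally show ?thesis .
    qed
    have "l2 b = 1" if "b \<in> B" for b
    proof -
      have "complex_of_real ((l2 b)\<^sup>2) = of_real 1"
        using B(1) that unfolding ip_self[symmetric] ons_def by simp
      then show ?thesis unfolding of_real_eq_iff by (simp add: power2_eq_1_iff) (use l2_nonneg[of b] in linarith)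
    qed
    then have "real (card B) = (\<Sum>b\<in>B. (l2 b)\<^sup>2)" by simp
    also have "\<dots> = (\<Sum>b\<in>B. \<integral>x. (cmod (b x))\<^sup>2 \<partial>M)" unfolding l2_sq ..
    also have "\<dots> = (\<integral>x. (\<Sum>b\<in>B. (cmod (b x))\<^sup>2) \<partial>M)"
      by (intro Bochner_Integration.integral_sum[symmetric] cont_integrable continuous_intros cB)
    also have "\<dots> \<le> norm \<dots>" by simp
    also have "\<dots> \<le> (l2 k)\<^sup>2"
      using le by (intro norm_integral_le continuous_intros cB) (auto simp: abs_of_nonneg sum_nonneg)
    finally show ?thesis by linarith
  qed
  then show ?thesis unfolding rank_bounded_def by blast
qed

subsection \<open>Matrix coefficients\<close>

text \<open>\<open>A\<close> is the average over the group of the product of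
  \<open>\<sigma> x\<close>, a matrix unit and the adjoint of \<open>\<tau> x\<close>. Left
  invariance of the average is the intertwining relation.\<close>

lemma matrix_coeff_intertwiner:
  assumes \<sigma>: "unitary_rep \<sigma>" and \<tau>: "unitary_rep \<tau>" and k: "k < rep_dim \<sigma>" and l: "l < rep_dim \<tau>"
  defines "A \<equiv> Matrix.mat (rep_dim \<sigma>) (rep_dim \<tau>) (\<lambda>(i, j). \<integral>x. \<sigma> x $$ (i, k) * cnj (\<tau> x $$ (j, l)) \<partial>M)"
  shows "\<sigma> a * A = A * \<tau> a"
proof (rule eq_matI)
  let ?m = "rep_dim \<sigma>" and ?n = "rep_dim \<tau>"
  have A: "A \<in> carrier_mat ?m ?n" unfolding A_def by simp
  note C = unitary_rep_carrier[OF \<sigma>] unitary_rep_carrier[OF \<tau>]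
  note cs = unitary_rep_index(4)[OF \<sigma>] unitary_rep_index(4)[OF \<tau>]
  have Aij: "A $$ (i, j) = (\<integral>x. \<sigma> x $$ (i, k) * cnj (\<tau> x $$ (j, l)) \<partial>M)" if "i < ?m" "j < ?n" for i j
    unfolding A_def using that by simp
  show "dim_row (\<sigma> a * A) = dim_row (A * \<tau> a)" "dim_col (\<sigma> a * A) = dim_col (A * \<tau> a)"
    using A C(1)[of a] C(2)[of a] by auto
  fix i j assume "i < dim_row (A * \<tau> a)" "j < dim_col (A * \<tau> a)"
  then have ij: "i < ?m" "j < ?n" using A C(2)[of a] by auto
  have "(\<sigma> a * A) $$ (i, j) = (\<Sum>p<?m. \<sigma> a $$ (i, p) * (\<integral>x. \<sigma> x $$ (p, k) * cnj (\<tau> x $$ (j, l)) \<partial>M))"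
    unfolding mult_mat_index[OF C(1) A ij] using ij by (intro sum.cong) (auto simp: Aij)
  also have "\<dots> = (\<Sum>p<?m. \<integral>x. \<sigma> a $$ (i, p) * (\<sigma> x $$ (p, k) * cnj (\<tau> x $$ (j, l))) \<partial>M)"
    by simp
  also have "\<dots> = (\<integral>x. (\<Sum>p<?m. \<sigma> a $$ (i, p) * (\<sigma> x $$ (p, k) * cnj (\<tau> x $$ (j, l)))) \<partial>M)"
    using ij k l
    by (intro Bochner_Integration.integral_sum[symmetric] cont_integrable continuous_intros cs) auto
  \<comment> \<open>The argument of \<open>\<tau>\<close> is padded so that the whole integrand is a
    left translate of one function.\<close>
  also have "\<dots> = (\<integral>x. \<sigma> (a + x) $$ (i, k) * cnj (\<tau> (- a + (a + x)) $$ (j, l)) \<partial>M)"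
    unfolding unitary_rep_index(1)[OF \<sigma> ij(1) k] by (simp add: sum_distrib_right mult.assoc add.assoc[symmetric])
  also have "\<dots> = (\<integral>x. \<sigma> x $$ (i, k) * cnj (\<tau> (- a + x) $$ (j, l)) \<partial>M)"
    using ij k l
    by (intro integral_left[of "\<lambda>x. \<sigma> x $$ (i, k) * cnj (\<tau> (- a + x) $$ (j, l))"] continuous_intros cs
        cont_left[of "\<lambda>x. \<tau> x $$ (j, l)"])
  also have "\<dots> = (\<integral>x. (\<Sum>p<?n. \<tau> a $$ (p, j) * (\<sigma> x $$ (i, k) * cnj (\<tau> x $$ (p, l)))) \<partial>M)"
    unfolding unitary_rep_index(1)[OF \<tau> ij(2) l] using ij
    by (intro Bochner_Integration.integral_cong refl)
       (simp add: unitary_rep_index(2)[OF \<tau>] sum_distrib_left mult_ac)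
  also have "\<dots> = (\<Sum>p<?n. \<integral>x. \<tau> a $$ (p, j) * (\<sigma> x $$ (i, k) * cnj (\<tau> x $$ (p, l))) \<partial>M)"
    using ij k l by (intro Bochner_Integration.integral_sum cont_integrable continuous_intros cs) auto
  also have "\<dots> = (A * \<tau> a) $$ (i, j)"
    unfolding mult_mat_index[OF A C(2) ij] using ij by (intro sum.cong) (auto simp: Aij)
  finally show "(\<sigma> a * A) $$ (i, j) = (A * \<tau> a) $$ (i, j)" .
qed

lemma Schur_orthogonality_inequivalent:
  assumes "scalar_commutant \<sigma>" "scalar_commutant \<tau>" "\<not> unitarily_equivalent \<tau> \<sigma>"
    and "i < rep_dim \<sigma>" "k < rep_dim \<sigma>" "j < rep_dim \<tau>" "l < rep_dim \<tau>"
  shows "(\<integral>x. \<sigma> x $$ (i, k) * cnj (\<tau> x $$ (j, l)) \<partial>M) = 0"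
proof -
  define A where "A = Matrix.mat (rep_dim \<sigma>) (rep_dim \<tau>) (\<lambda>(i, j). \<integral>x. \<sigma> x $$ (i, k) * cnj (\<tau> x $$ (j, l)) \<partial>M)"
  have "A = 0\<^sub>m (rep_dim \<sigma>) (rep_dim \<tau>)"
  proof (rule ccontr)
    assume "A \<noteq> 0\<^sub>m (rep_dim \<sigma>) (rep_dim \<tau>)"
    moreover have "\<sigma> x * A = A * \<tau> x" for x
      unfolding A_def using assms
      by (intro matrix_coeff_intertwiner) (auto dest: scalar_commutantD)
    moreover have "A \<in> carrier_mat (rep_dim \<sigma>) (rep_dim \<tau>)" unfolding A_def by simp
    ultimately show False using Schur_intertwiner[OF assms(1,2)] assms(3) by blast
  qed
  then have "A $$ (i, j) = 0" using assms by simp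
  then show ?thesis unfolding A_def using assms by simp
qed

text \<open>The averaged matrix is a scalar \<open>c\<close>. Taking its trace and using that the
  columns of \<open>\<sigma> x\<close> are orthonormal determines \<open>c\<close>, whence the
  factor \<open>1 / of_nat (rep_dim \<sigma>)\<close>.\<close>

lemma Schur_orthogonality:
  assumes comm: "scalar_commutant \<sigma>"
    and ind: "i < rep_dim \<sigma>" "k < rep_dim \<sigma>" "j < rep_dim \<sigma>" "l < rep_dim \<sigma>"
  shows "(\<integral>x. \<sigma> x $$ (i, k) * cnj (\<sigma> x $$ (j, l)) \<partial>M)
    = (if i = j \<and> k = l then 1 / of_nat (rep_dim \<sigma>) else 0)"
proof -
  let ?d = "rep_dim \<sigma>"
  define A where "A = Matrix.mat ?d ?d (\<lambda>(i, j). \<integral>x. \<sigma> x $$ (i, k) * cnj (\<sigma> x $$ (j, l)) \<partial>M)"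
  have ur: "unitary_rep \<sigma>" and d: "0 < ?d" using scalar_commutantD[OF comm] by auto
  have "A * \<sigma> x = \<sigma> x * A" for x
    unfolding A_def using ur ind by (intro matrix_coeff_intertwiner[symmetric])
  moreover have "A \<in> carrier_mat ?d ?d" unfolding A_def by simp
  ultimately obtain c where c: "A = c \<cdot>\<^sub>m 1\<^sub>m ?d" using scalar_commutantD(3)[OF comm] by metis
  have Aij: "(\<integral>x. \<sigma> x $$ (p, k) * cnj (\<sigma> x $$ (q, l)) \<partial>M) = (if p = q then c else 0)"
    if "p < ?d" "q < ?d" for p q
  proof -
    have "A $$ (p, q) = (c \<cdot>\<^sub>m 1\<^sub>m ?d) $$ (p, q)" unfolding c ..
    then show ?thesis unfolding A_def using that by simp
  qed
  have "of_nat ?d * c = (\<Sum>p<?d. \<integral>x. \<sigma> x $$ (p, k) * cnj (\<sigma> x $$ (p, l)) \<partial>M)"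
    using Aij by simp
  also have "\<dots> = (\<integral>x. (\<Sum>p<?d. \<sigma> x $$ (p, k) * cnj (\<sigma> x $$ (p, l))) \<partial>M)"
    using ind by (intro Bochner_Integration.integral_sum[symmetric] cont_integrable continuous_intros
        unitary_rep_index(4)[OF ur]) auto
  also have "\<dots> = (if k = l then 1 else 0)"
    unfolding unitary_rep_index(3)[OF ur ind(2,4)] by simp
  finally have "c = (if k = l then 1 / of_nat ?d else 0)" using d by (auto simp: field_simps)
  then show ?thesis using Aij[OF ind(1,3)] by auto
qed

text \<open>Left translation acts on coordinates in an orthonormal basis by unitary matrices, and
  subspaces of coordinate vectors invariant under them correspond to left invariant subspaces of
  \<open>W\<close>. Minimality thus becomes irreducibility.\<close>

lemma minimal_left_inv_irreducible:
  assumes min: "minimal_left_inv W"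
    and B: "ons B" "B \<subseteq> W" "\<forall>f\<in>W. f = proj B f" and f: "f \<in> B"
  shows "\<exists>\<sigma> c j. irreducible_rep \<sigma> \<and> j < rep_dim \<sigma> \<and>
    f = (\<lambda>x. \<Sum>i<rep_dim \<sigma>. c i * cnj (\<sigma> x $$ (j, i)))"
proof -
  have W: "lin W" "left_inv W" "\<not> W \<subseteq> {\<lambda>x. 0}" and minimal: "\<And>W'. lin W' \<Longrightarrow> left_inv W' \<Longrightarrow>
      W' \<subseteq> W \<Longrightarrow> \<not> W' \<subseteq> {\<lambda>x. 0} \<Longrightarrow> W' = W"
    using min unfolding minimal_left_inv_def by blast+
  define d where "d = card B"
  have finB: "finite B" using B(1) unfolding ons_def by simp
  obtain e where e: "bij_betw e {..<d} B"
    unfolding d_def using ex_bij_betw_nat_finite[OF finB] by (auto simp: atLeast0LessThan)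
  have eB: "e i \<in> B" if "i < d" for i using e that by (auto dest: bij_betwE)
  have eW: "e i \<in> W" if "i < d" for i using eB[OF that] B(2) by auto
  have ce: "cont (e i)" if "i < d" for i using linD(1)[OF W(1) eW[OF that]] .
  have ee: "ip (e i) (e j) = (if i = j then 1 else 0)" if "i < d" "j < d" for i j
  proof -
    have "e i = e j \<longleftrightarrow> i = j" using e that by (auto simp: bij_betw_def inj_on_eq_iff)
    then show ?thesis using B(1) eB[OF that(1)] eB[OF that(2)] unfolding ons_def by auto
  qed
  have expand: "g x = (\<Sum>i<d. ip g (e i) * e i x)" if "g \<in> W" for g x
  proof -
    have "g x = proj B g x" using B(3) that by metis
    then show ?thesis unfolding proj_def using sum.reindex_bij_betw[OF e, of "\<lambda>b. ip g b * b x"] by simp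
  qed
  have coord: "ip (\<lambda>x. \<Sum>i<d. u i * e i x) (e j) = u j" if "j < d" for u j
  proof -
    have "ip (\<lambda>x. \<Sum>i<d. u i * e i x) (e j) = (\<Sum>i<d. u i * ip (e i) (e j))"
      using that by (intro ip_sum ce) auto
    also have "\<dots> = (\<Sum>i<d. if i = j then u i else 0)"
      using that by (intro sum.cong) (auto simp: ee)
    finally show ?thesis using that by simp
  qed
  \<comment> \<open>Translating by \<open>- a\<close> makes \<open>\<pi>\<close> a homomorphism
    rather than an antihomomorphism on a noncommutative group.\<close>
  define \<pi> where "\<pi> a = Matrix.mat d d (\<lambda>(i, j). ip (\<lambda>x. e j (- a + x)) (e i))" for a
  have \<pi>_ij: "\<pi> a $$ (i, j) = ip (\<lambda>x. e j (- a + x)) (e i)" if "i < d" "j < d" for a i j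
    unfolding \<pi>_def using that by simp
  have C: "\<pi> a \<in> carrier_mat d d" for a unfolding \<pi>_def by simp
  have trans: "e j (- a + x) = (\<Sum>i<d. \<pi> a $$ (i, j) * e i x)" if "j < d" for j a x
  proof -
    have "(\<lambda>x. e j (- a + x)) \<in> W" using W(2) eW[OF that] unfolding left_inv_def by auto
    from expand[OF this, of x] show ?thesis using that by (simp add: \<pi>_ij)
  qed
  have hom: "\<pi> (a + b) = \<pi> a * \<pi> b" for a b
  proof (rule eq_matI)
    fix i j assume "i < dim_row (\<pi> a * \<pi> b)" "j < dim_col (\<pi> a * \<pi> b)"
    then have ij: "i < d" "j < d" using C[of a] C[of b] by auto
    have "\<pi> (a + b) $$ (i, j) = ip (\<lambda>x. e j (- b + (- a + x))) (e i)"
      unfolding \<pi>_ij[OF ij] minus_add add.assoc ..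
    also have "\<dots> = ip (\<lambda>x. \<Sum>l<d. \<pi> b $$ (l, j) * e l (- a + x)) (e i)"
      unfolding trans[OF ij(2), of b] ..
    also have "\<dots> = (\<Sum>l<d. \<pi> b $$ (l, j) * ip (\<lambda>x. e l (- a + x)) (e i))"
      using ij by (intro ip_sum ce) (auto intro: cont_left ce)
    also have "\<dots> = (\<Sum>l<d. \<pi> a $$ (i, l) * \<pi> b $$ (l, j))"
      using ij by (intro sum.cong) (auto simp: \<pi>_ij mult.commute)
    finally show "\<pi> (a + b) $$ (i, j) = (\<pi> a * \<pi> b) $$ (i, j)"
      unfolding mult_mat_index[OF C C ij] .
  qed (use C[of "a + b"] C[of a] C[of b] in auto)
  have adj: "\<pi> (- a) = mat_adjoint (\<pi> a)" for a
  proof (rule eq_matI)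
    fix i j assume "i < dim_row (mat_adjoint (\<pi> a))" "j < dim_col (mat_adjoint (\<pi> a))"
    then have ij: "i < d" "j < d" using C[of a] by auto
    have "\<pi> (- a) $$ (i, j) = ip (\<lambda>x. e j (a + x)) (e i)"
      using ij by (simp add: \<pi>_ij)
    also have "\<dots> = ip (\<lambda>x. e j (a + (- a + x))) (\<lambda>x. e i (- a + x))"
      by (rule ip_left_translate[symmetric, of "\<lambda>x. e j (a + x)"]) (auto intro: cont_left ce ij)
    also have "\<dots> = ip (e j) (\<lambda>x. e i (- a + x))"
      by (simp add: add.assoc[symmetric])
    also have "\<dots> = cnj (\<pi> a $$ (j, i))" using ij by (simp add: \<pi>_ij ip_cnj)
    finally show "\<pi> (- a) $$ (i, j) = mat_adjoint (\<pi> a) $$ (i, j)"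
      using ij C[of a] by (subst index_mat_adjoint) auto
  qed (use C[of a] C[of "- a"] in auto)
  have one: "\<pi> 0 = 1\<^sub>m d"
    by (rule eq_matI) (use C[of 0] in \<open>auto simp: \<pi>_ij ee\<close>)
  have rd: "rep_dim \<pi> = d" unfolding rep_dim_def using C by auto
  have "unitary_mat d (\<pi> a)" for a
    unfolding unitary_mat_def adj[symmetric] hom[symmetric] using C one by simp
  moreover have "cont (\<lambda>a. \<pi> a $$ (i, j))" if "i < d" "j < d" for i j
  proof -
    have "cont (\<lambda>a. ip (\<lambda>x. e j (- a + x)) (e i))"
      unfolding ip_def using that
      by (intro cont_parametric_integral continuous_intros cont_quot[of "e j"] cont_snd[of "e i"] ce)
    then show ?thesis using that by (simp add: \<pi>_ij)
  qed
  ultimately have ur: "unitary_rep \<pi>"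
    unfolding unitary_rep_def rd using hom by auto
  have "d \<noteq> 0"
  proof
    assume "d = 0"
    have "f = (\<lambda>x. 0)" if "f \<in> W" for f
      using expand[OF that] unfolding \<open>d = 0\<close> by (intro ext) simp
    then have "W \<subseteq> {\<lambda>x. 0}" by blast
    then show False using W(3) by simp
  qed
  have irr: "irreducible_rep \<pi>"
    unfolding irreducible_rep_def rd
  proof (intro conjI ur allI impI)
    show "0 < d" using \<open>d \<noteq> 0\<close> by simp
    fix X assume X: "VectorSpace.subspace class_ring X (module_vec TYPE(complex) d)"
      and inv: "\<forall>x. \<forall>w\<in>X. \<pi> x *\<^sub>v w \<in> X"
    note XD = subspace_module_vecD[OF X]
    \<comment> \<open>The coordinate isomorphism onto \<open>W\<close>, through which invariant
      subspaces are transported.\<close>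
    define F where "F u = (\<lambda>x. \<Sum>i<d. u $ i * e i x)" for u :: "complex Matrix.vec"
    have F_inj: "u = v" if "u \<in> carrier_vec d" "v \<in> carrier_vec d" "F u = F v" for u v
    proof (rule eq_vecI)
      fix i assume "i < dim_vec v"
      then have "i < d" using that(2) by simp
      then show "u $ i = v $ i" using coord[of i "($) u"] coord[of i "($) v"] that(3) unfolding F_def by metis
    qed (use that in simp)
    have "lin (F ` X)"
      unfolding lin_def
    proof (intro conjI ballI allI; (elim imageE)?; hypsubst?)
      show "cont (F u)" for u unfolding F_def by (intro continuous_intros ce) auto
      have "F (0\<^sub>v d) = (\<lambda>x. 0)" unfolding F_def by simp
      then show "(\<lambda>x. 0) \<in> F ` X" using XD(2) by (metis image_eqI)
      show "(\<lambda>x. F u x + F v x) \<in> F ` X" if "u \<in> X" "v \<in> X" for u v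
      proof -
        have "F (u + v) = (\<lambda>x. F u x + F v x)"
          using that XD(1) unfolding F_def by (auto simp: distrib_right sum.distrib)
        then show ?thesis using XD(3)[OF that] by (metis image_eqI)
      qed
      show "(\<lambda>x. c * F u x) \<in> F ` X" if "u \<in> X" for c u
      proof -
        have "F (c \<cdot>\<^sub>v u) = (\<lambda>x. c * F u x)"
          using that XD(1) unfolding F_def by (auto simp: sum_distrib_left mult.assoc)
        then show ?thesis using XD(4)[OF that] by (metis image_eqI)
      qed
    qed
    moreover have "left_inv (F ` X)"
      unfolding left_inv_def
    proof (intro ballI allI, elim imageE, hypsubst)
      fix a u assume u: "u \<in> X"
      then have uc: "u \<in> carrier_vec d" using XD(1) by auto
      have "F u (a + x) = F (\<pi> (- a) *\<^sub>v u) x" for x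
      proof -
        have "F u (a + x) = (\<Sum>i<d. u $ i * (\<Sum>l<d. \<pi> (- a) $$ (l, i) * e l x))"
          unfolding F_def using trans[of _ "- a" x] by simp
        also have "\<dots> = (\<Sum>l<d. (\<Sum>i<d. \<pi> (- a) $$ (l, i) * u $ i) * e l x)"
          unfolding sum_distrib_left sum_distrib_right
          by (subst sum.swap) (simp add: mult_ac)
        also have "\<dots> = F (\<pi> (- a) *\<^sub>v u) x"
          unfolding F_def using uc C[of "- a"]
          by (intro sum.cong) (auto simp: scalar_prod_def atLeast0LessThan)
        finally show ?thesis .
      qed
      then have "(\<lambda>x. F u (a + x)) = F (\<pi> (- a) *\<^sub>v u)" by auto
      then show "(\<lambda>x. F u (a + x)) \<in> F ` X" using inv u by auto
    qed
    moreover have "F ` X \<subseteq> W"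
      unfolding F_def using eW by (auto intro!: lin_sum W(1))
    ultimately consider "F ` X \<subseteq> {\<lambda>x. 0}" | "F ` X = W" using minimal by blast
    then show "X = {0\<^sub>v d} \<or> X = carrier_vec d"
    proof cases
      case 1
      have Z: "u = 0\<^sub>v d" if "u \<in> X" for u
      proof (rule F_inj)
        have Fz: "F v = (\<lambda>x. 0)" if "v \<in> X" for v
          by (rule singletonD[OF subsetD[OF 1 imageI[OF that]]])
        show "F u = F (0\<^sub>v d)" by (rule HOL.trans[OF Fz[OF that] Fz[OF XD(2), symmetric]])
      qed (use that XD(1) in auto)
      have "X \<subseteq> {0\<^sub>v d}"
      proof
        fix v assume "v \<in> X"
        show "v \<in> {0\<^sub>v d}" unfolding singleton_iff by (rule Z[OF \<open>v \<in> X\<close>])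
      qed
      then show ?thesis using XD(2) by blast
    next
      case 2
      have "v \<in> X" if v: "v \<in> carrier_vec d" for v
      proof -
        have "F v \<in> W" unfolding F_def using eW by (auto intro!: lin_sum W(1))
        then obtain u where "u \<in> X" "F u = F v" using 2 by (metis imageE)
        then show ?thesis using F_inj[of u v] v XD(1) by auto
      qed
      then show ?thesis using XD(1) by auto
    qed
  qed
  obtain j where j: "j < d" "f = e j" using f e by (auto simp: bij_betw_def)
  \<comment> \<open>Translating a basis function by \<open>x\<close> and evaluating at the identity
    recovers its value at \<open>x\<close>; the inverse in \<open>\<pi> (- x)\<close> turns into
    conjugate entries.\<close>
  have "f = (\<lambda>x. \<Sum>i<rep_dim \<pi>. e i 0 * cnj (\<pi> x $$ (j, i)))"
  proof
    fix x
    have "f x = (\<Sum>i<d. \<pi> (- x) $$ (i, j) * e i 0)"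
      using trans[OF j(1), of "- x" 0] j(2) by simp
    also have "\<dots> = (\<Sum>i<d. e i 0 * cnj (\<pi> x $$ (j, i)))"
      using j unitary_rep_index(2)[OF ur, unfolded rd] by (intro sum.cong) (auto simp: mult.commute)
    finally show "f x = (\<Sum>i<rep_dim \<pi>. e i 0 * cnj (\<pi> x $$ (j, i)))" unfolding rd .
  qed
  then show ?thesis
    using irr j(1) rd by (intro exI[of _ \<pi>] exI[of _ "\<lambda>i. e i 0"] exI[of _ j] conjI) simp_all
qed

text \<open>Unconjugated pairing with entries is orthogonality to their conjugates, and it is the
  conjugate entries that span minimal invariant subspaces.\<close>

definition annihilated :: "('g \<Rightarrow> complex) \<Rightarrow> bool" where
  "annihilated h \<longleftrightarrow> (\<forall>\<sigma>. irreducible_rep \<sigma> \<longrightarrow>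
     (\<forall>i<rep_dim \<sigma>. \<forall>j<rep_dim \<sigma>. (\<integral>x. h x * \<sigma> x $$ (i, j) \<partial>M) = 0))"

lemma annihilatedI:
  "(\<And>\<sigma> i j. irreducible_rep \<sigma> \<Longrightarrow> i < rep_dim \<sigma> \<Longrightarrow> j < rep_dim \<sigma> \<Longrightarrow>
    (\<integral>x. h x * \<sigma> x $$ (i, j) \<partial>M) = 0) \<Longrightarrow> annihilated h"
  unfolding annihilated_def by blast

lemma annihilatedD:
  "annihilated h \<Longrightarrow> irreducible_rep \<sigma> \<Longrightarrow> i < rep_dim \<sigma> \<Longrightarrow> j < rep_dim \<sigma> \<Longrightarrow>
    (\<integral>x. h x * \<sigma> x $$ (i, j) \<partial>M) = 0"
  unfolding annihilated_def by blast

text \<open>Integrating against \<open>\<sigma>\<close> turns convolution into a matrix product,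
  whose right factor belongs to \<open>k\<close> and vanishes.\<close>

lemma annihilated_conv:
  assumes k: "cont k" "annihilated k" and g: "cont g"
  shows "annihilated (conv g k)"
proof (rule annihilatedI)
  fix \<sigma> :: "'g rep" and i j
  assume \<sigma>: "irreducible_rep \<sigma>" and ij: "i < rep_dim \<sigma>" "j < rep_dim \<sigma>"
  note ur = irreducible_repD[OF \<sigma>]
  note cs = unitary_rep_index(4)[OF ur]
  have "(\<integral>x. conv g k x * \<sigma> x $$ (i, j) \<partial>M)
      = (\<integral>x. \<integral>y. g y * k (- y + x) * \<sigma> x $$ (i, j) \<partial>M \<partial>M)"
    unfolding conv_def by simp
  also have "\<dots> = (\<integral>y. \<integral>x. g y * k (- y + x) * \<sigma> x $$ (i, j) \<partial>M \<partial>M)"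
    by (intro Fubini continuous_intros cont_snd[OF g] cont_quot'[OF k(1)] cont_fst[OF cs] ij)
  also have "\<dots> = (\<integral>y. 0 \<partial>M)"
  proof (rule Bochner_Integration.integral_cong[OF refl])
    fix y
    have "(\<integral>x. k (- y + x) * \<sigma> x $$ (i, j) \<partial>M) = (\<integral>x. k (- y + (y + x)) * \<sigma> (y + x) $$ (i, j) \<partial>M)"
      using ij by (intro integral_left[of "\<lambda>x. k (- y + x) * \<sigma> x $$ (i, j)" y, symmetric]
          continuous_intros cont_left[OF k(1)] cs)
    also have "\<dots> = (\<integral>x. (\<Sum>l<rep_dim \<sigma>. \<sigma> y $$ (i, l) * (k x * \<sigma> x $$ (l, j))) \<partial>M)"
      unfolding unitary_rep_index(1)[OF ur ij]
      by (simp add: add.assoc[symmetric] sum_distrib_left mult_ac)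
    also have "\<dots> = (\<Sum>l<rep_dim \<sigma>. \<integral>x. \<sigma> y $$ (i, l) * (k x * \<sigma> x $$ (l, j)) \<partial>M)"
      using ij by (intro Bochner_Integration.integral_sum cont_integrable continuous_intros k cs) auto
    also have "\<dots> = 0"
      using annihilatedD[OF k(2) \<sigma> _ ij(2)] by simp
    finally show "(\<integral>x. g y * k (- y + x) * \<sigma> x $$ (i, j) \<partial>M) = 0"
      by (simp add: mult.assoc)
  qed
  finally show "(\<integral>x. conv g k x * \<sigma> x $$ (i, j) \<partial>M) = 0" by simp
qed

text \<open>A nonzero \<open>h\<close> would produce a unit vector \<open>f\<close> with
  \<open>f = conv (conv f k) k\<close> that is a combination of conjugate entries. It inherits
  annihilation from the kernel, so it is orthogonal to itself.\<close>

lemma annihilated_hermitian_eq_0: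
  assumes h: "cont h" "annihilated h" and herm: "\<And>x. h (- x) = cnj (h x)"
  shows "h = (\<lambda>x. 0)"
proof (rule ccontr)
  assume "h \<noteq> (\<lambda>x. 0)"
  then obtain c q where q: "cont q" "q \<noteq> (\<lambda>x. 0)" "conv (conv q (\<lambda>x. c * h x)) (\<lambda>x. c * h x) = q"
    using fixed_point_of_scaled_kernel[OF h(1) herm] by blast
  define k where "k x = c * h x" for x
  have k: "cont k" unfolding k_def by (intro continuous_intros h)
  have kT: "annihilated k"
    using h(2) unfolding annihilated_def k_def by (simp add: mult.assoc)
  have kk: "cont (conv k k)" by (intro cont_conv k)
  \<comment> \<open>The convolution square is used because a self-adjoint operator of norm 1 may
    have -1 rather than 1 as its extreme eigenvalue; power iteration fixes a function of the squared
    operator only.\<close>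
  let ?V = "{f. cont f \<and> conv f (conv k k) = f}"
  have "q \<in> ?V" using q conv_assoc[OF q(1) k k] unfolding k_def by simp
  then have "\<not> ?V \<subseteq> {\<lambda>x. 0}" using q(2) by auto
  moreover obtain n where n: "rank_bounded ?V n" using fixed_space_rank_bounded[OF kk] by blast
  ultimately obtain W where W: "minimal_left_inv W" "W \<subseteq> ?V"
    using minimal_left_inv_exists[OF fixed_space_lin[OF kk] fixed_space_left_inv[OF kk]] by blast
  have lW: "lin W" using W(1) unfolding minimal_left_inv_def by blast
  have "rank_bounded W n" using n W(2) unfolding rank_bounded_def by blast
  then obtain B where B: "ons B" "B \<subseteq> W" "\<forall>f\<in>W. f = proj B f"
    using ons_basis[OF lW] by metis
  have "B \<noteq> {}"
  proof
    assume "B = {}"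
    then have "\<forall>f\<in>W. f = (\<lambda>x. 0)" using B(3) unfolding proj_def by simp
    then show False using W(1) unfolding minimal_left_inv_def by auto
  qed
  then obtain f where f: "f \<in> B" by auto
  obtain \<sigma> u j where \<sigma>: "irreducible_rep \<sigma>" "j < rep_dim \<sigma>"
    and fu: "f = (\<lambda>x. \<Sum>i<rep_dim \<sigma>. u i * cnj (\<sigma> x $$ (j, i)))"
    using minimal_left_inv_irreducible[OF W(1) B f] by blast
  note ur = irreducible_repD[OF \<sigma>(1)]
  have fV: "cont f" "conv f (conv k k) = f" using f B(2) W(2) by auto
  have "annihilated (conv (conv f k) k)"
    by (intro annihilated_conv k kT cont_conv fV)
  then have fT: "annihilated f" using conv_assoc[OF fV(1) k k] fV(2) by simp
  have "ip f f = ip f (\<lambda>x. \<Sum>i<rep_dim \<sigma>. u i * cnj (\<sigma> x $$ (j, i)))" using fu by simp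
  also have "\<dots> = (\<Sum>i<rep_dim \<sigma>. cnj (u i) * ip f (\<lambda>x. cnj (\<sigma> x $$ (j, i))))"
    using \<sigma> by (intro ip_sum_right fV continuous_intros unitary_rep_index(4)[OF ur]) auto
  also have "\<dots> = 0"
    unfolding ip_def using annihilatedD[OF fT \<sigma>] by simp
  finally show False using B(1) f unfolding ons_def by simp
qed

text \<open>Annihilation is preserved by the involution \<open>h'\<close>, since the adjoint only
  swaps the indices of an entry. The hermitian combinations \<open>h + h'\<close> and
  \<open>\<i> * (h - h')\<close> then vanish, and with them \<open>h\<close>.\<close>

theorem matrix_coeffs_total:
  assumes h: "cont h" "annihilated h"
  shows "h = (\<lambda>x. 0)"
proof -
  define h' where "h' x = cnj (h (- x))" for x
  have ch': "cont h'"
    unfolding h'_def by (intro continuous_intros cont_comp[OF h(1)])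
  have T': "annihilated h'"
  proof (rule annihilatedI)
    fix \<sigma> :: "'g rep" and i j
    assume \<sigma>: "irreducible_rep \<sigma>" and ij: "i < rep_dim \<sigma>" "j < rep_dim \<sigma>"
    note ur = irreducible_repD[OF \<sigma>]
    have "(\<integral>x. h' x * \<sigma> x $$ (i, j) \<partial>M) = (\<integral>x. h' (- x) * \<sigma> (- x) $$ (i, j) \<partial>M)"
      using ij by (intro integral_inverse[of "\<lambda>x. h' x * \<sigma> x $$ (i, j)", symmetric] continuous_intros ch'
          unitary_rep_index(4)[OF ur])
    also have "\<dots> = (\<integral>x. cnj (h x * \<sigma> x $$ (j, i)) \<partial>M)"
      unfolding h'_def by (simp add: unitary_rep_index(2)[OF ur ij])
    also have "\<dots> = cnj (\<integral>x. h x * \<sigma> x $$ (j, i) \<partial>M)"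
      by (rule Bochner_Integration.integral_cnj)
    also have "\<dots> = 0" using annihilatedD[OF h(2) \<sigma> ij(2,1)] by simp
    finally show "(\<integral>x. h' x * \<sigma> x $$ (i, j) \<partial>M) = 0" .
  qed
  have comb: "annihilated (\<lambda>x. a * h x + b * h' x)" for a b
  proof (rule annihilatedI)
    fix \<sigma> :: "'g rep" and i j
    assume \<sigma>: "irreducible_rep \<sigma>" and ij: "i < rep_dim \<sigma>" "j < rep_dim \<sigma>"
    note ur = irreducible_repD[OF \<sigma>]
    have "integrable M (\<lambda>x. h x * \<sigma> x $$ (i, j))"
      using ij by (intro cont_integrable continuous_intros h(1) unitary_rep_index(4)[OF ur])
    moreover have "integrable M (\<lambda>x. h' x * \<sigma> x $$ (i, j))"
      using ij by (intro cont_integrable continuous_intros ch' unitary_rep_index(4)[OF ur])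
    ultimately show "(\<integral>x. (a * h x + b * h' x) * \<sigma> x $$ (i, j) \<partial>M) = 0"
      using annihilatedD[OF h(2) \<sigma> ij] annihilatedD[OF T' \<sigma> ij]
      by (simp add: distrib_right mult.assoc)
  qed
  have "(\<lambda>x. 1 * h x + 1 * h' x) = (\<lambda>x. 0)"
  proof (rule annihilated_hermitian_eq_0[OF _ comb])
    show "cont (\<lambda>x. 1 * h x + 1 * h' x)" by (intro continuous_intros h(1) ch')
  qed (simp add: h'_def)
  moreover have "(\<lambda>x. \<i> * h x + (- \<i>) * h' x) = (\<lambda>x. 0)"
  proof (rule annihilated_hermitian_eq_0[OF _ comb])
    show "cont (\<lambda>x. \<i> * h x + (- \<i>) * h' x)" by (intro continuous_intros h(1) ch')
  qed (simp add: h'_def)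
  ultimately show ?thesis
    by (auto simp: fun_eq_iff algebra_simps)
qed

section \<open>Uniform density of trigonometric polynomials\<close>

inductive_set trig :: "('g \<Rightarrow> complex) set" where
  coeff: "irreducible_rep \<sigma> \<Longrightarrow> i < rep_dim \<sigma> \<Longrightarrow> j < rep_dim \<sigma> \<Longrightarrow> (\<lambda>x. cnj (\<sigma> x $$ (i, j))) \<in> trig"
| zero: "(\<lambda>x. 0) \<in> trig"
| add: "f \<in> trig \<Longrightarrow> g \<in> trig \<Longrightarrow> (\<lambda>x. f x + g x) \<in> trig"
| scale: "f \<in> trig \<Longrightarrow> (\<lambda>x. c * f x) \<in> trig"

lemma trig_cont: "f \<in> trig \<Longrightarrow> cont f"
proof (induction rule: trig.induct)
  case (coeff \<sigma> i j)
  then show ?case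
    by (intro continuous_intros unitary_rep_index(4)) (auto simp: irreducible_rep_def)
qed (auto intro!: continuous_intros)

lemma lin_trig: "lin trig"
  unfolding lin_def by (auto intro: trig_cont trig.zero trig.add trig.scale)

text \<open>After the substitution of \<open>x + y\<close> for \<open>y\<close>, the homomorphism
  law separates the variables: an entry is sent to a combination of entries in the same row of the
  same representation.\<close>

lemma trig_conv:
  assumes k: "cont k" and t: "t \<in> trig"
  shows "conv t k \<in> trig"
  using t
proof induction
  case (coeff \<sigma> i j)
  note ur = irreducible_repD[OF coeff(1)]
  note cs = unitary_rep_index(4)[OF ur]
  have ck: "cont (\<lambda>y. k (- y))" by (intro cont_comp[OF k] continuous_intros)
  have "conv (\<lambda>x. cnj (\<sigma> x $$ (i, j))) k
      = (\<lambda>x. \<Sum>l<rep_dim \<sigma>. (\<integral>y. cnj (\<sigma> y $$ (l, j)) * k (- y) \<partial>M) * cnj (\<sigma> x $$ (i, l)))"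
  proof
    fix x
    have "conv (\<lambda>x. cnj (\<sigma> x $$ (i, j))) k x
        = (\<integral>y. cnj (\<sigma> (x + y) $$ (i, j)) * k (- (x + y) + x) \<partial>M)"
      unfolding conv_def
      by (rule integral_left[of "\<lambda>y. cnj (\<sigma> y $$ (i, j)) * k (- y + x)", symmetric])
         (intro continuous_intros cs coeff cont_reflect[OF k])
    also have "\<dots> = (\<integral>y. (\<Sum>l<rep_dim \<sigma>. cnj (\<sigma> x $$ (i, l)) * (cnj (\<sigma> y $$ (l, j)) * k (- y))) \<partial>M)"
      unfolding unitary_rep_index(1)[OF ur coeff(2,3)]
      by (simp add: minus_add add.assoc sum_distrib_right mult.assoc)
    also have "\<dots> = (\<Sum>l<rep_dim \<sigma>. \<integral>y. cnj (\<sigma> x $$ (i, l)) * (cnj (\<sigma> y $$ (l, j)) * k (- y)) \<partial>M)"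
      by (intro Bochner_Integration.integral_sum cont_integrable continuous_intros cs ck) (use coeff in auto)
    finally show "conv (\<lambda>x. cnj (\<sigma> x $$ (i, j))) k x
        = (\<Sum>l<rep_dim \<sigma>. (\<integral>y. cnj (\<sigma> y $$ (l, j)) * k (- y) \<partial>M) * cnj (\<sigma> x $$ (i, l)))"
      by (simp add: mult.commute)
  qed
  also have "\<dots> \<in> trig"
    using coeff by (intro lin_sum[OF lin_trig] trig.coeff) auto
  finally show ?case .
next
  case zero
  have "conv (\<lambda>x. 0) k = (\<lambda>x. 0)" unfolding conv_def by simp
  then show ?case by (simp add: trig.zero)
next
  case (add f g)
  have "conv (\<lambda>x. f x + g x) k = (\<lambda>x. conv f k x + conv g k x)"
    by (rule ext, rule conv_add) (intro trig_cont add.hyps k)+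
  then show ?case using add.IH by (simp add: trig.add)
next
  case (scale f c)
  have "conv (\<lambda>x. c * f x) k = (\<lambda>x. c * conv f k x)"
    by (rule ext, rule conv_scale)
  then show ?case using scale.IH by (simp add: trig.scale)
qed

lemma parallelogram:
  assumes u: "cont u" and v: "cont v"
  shows "(l2 (\<lambda>x. u x - v x))\<^sup>2 = 2 * (l2 u)\<^sup>2 + 2 * (l2 v)\<^sup>2 - (l2 (\<lambda>x. u x + v x))\<^sup>2"
proof -
  have "ip u (\<lambda>x. - v x) = - ip u v" using ip_scale_right[of u "-1" v] by simp
  moreover have "l2 (\<lambda>x. - v x) = l2 v" using l2_scale[of "-1" v] by simp
  moreover have "cont (\<lambda>x. - v x)" by (intro continuous_intros v)
  ultimately have "(l2 (\<lambda>x. u x + v x))\<^sup>2 = (l2 u)\<^sup>2 + (l2 v)\<^sup>2 + 2 * Re (ip u v)"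
    using l2_diff_sq[OF u, of "\<lambda>x. - v x"] by simp
  then show ?thesis using l2_diff_sq[OF u v] by simp
qed

text \<open>A best L2 approximation of \<open>\<phi>\<close> in \<open>trig\<close> need not exist,
  but a minimizing sequence becomes uniformly convergent after convolution. The defect of its limit
  is annihilated, hence zero, and the convolved sequence still lies in \<open>trig\<close>.\<close>

lemma conv_in_closure_trig:
  assumes \<phi>: "cont \<phi>" and k: "cont k" and herm: "\<And>x. k (- x) = cnj (k x)" and "0 < e"
  shows "\<exists>t\<in>trig. \<forall>x. cmod (conv \<phi> k x - t x) < e"
proof -
  define D where "D t x = \<phi> x - t x" for t :: "'g \<Rightarrow> complex" and x
  define \<delta> where "\<delta> = (INF t\<in>trig. (l2 (D t))\<^sup>2)"
  have bdd: "bdd_below ((\<lambda>t. (l2 (D t))\<^sup>2) ` trig)" by (rule bdd_belowI2[of _ 0]) simp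
  have ge: "\<delta> \<le> (l2 (D t))\<^sup>2" if "t \<in> trig" for t
    unfolding \<delta>_def by (rule cINF_lower[OF bdd that])
  have "\<exists>t\<in>trig. (l2 (D t))\<^sup>2 < \<delta> + 1 / Suc n" for n
  proof -
    have "\<delta> < \<delta> + 1 / Suc n" by simp
    then show ?thesis unfolding \<delta>_def using cINF_less_iff[OF _ bdd] trig.zero by blast
  qed
  then obtain t where t: "\<And>n. t n \<in> trig" "\<And>n. (l2 (D (t n)))\<^sup>2 < \<delta> + 1 / Suc n"
    by metis
  have ct: "cont (t n)" for n by (rule trig_cont[OF t(1)])
  have cD: "cont (D (t n))" for n unfolding D_def by (intro continuous_intros \<phi> ct)
  have inv0: "(\<lambda>n. 1 / real (Suc n)) \<longlonglongrightarrow> 0"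
    by (rule LIMSEQ_inverse_real_of_nat[unfolded inverse_eq_divide])
  \<comment> \<open>The midpoint of two approximants lies in \<open>trig\<close>, so it is no closer
    than the infimum; the parallelogram law then bounds the distance between them.\<close>
  have dist: "(l2 (\<lambda>x. t m x - t n x))\<^sup>2 \<le> 2 / Suc m + 2 / Suc n" for m n
  proof -
    let ?h = "\<lambda>x. (1/2) * (t m x + t n x)"
    have "?h \<in> trig" by (intro trig.scale trig.add t)
    then have "\<delta> \<le> (l2 (D ?h))\<^sup>2" by (rule ge)
    have "(\<lambda>x. D (t n) x + D (t m) x) = (\<lambda>x. 2 * D ?h x)" unfolding D_def by (auto simp: algebra_simps)
    then have "l2 (\<lambda>x. D (t n) x + D (t m) x) = 2 * l2 (D ?h)" by (simp add: l2_scale)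
    then have "(l2 (\<lambda>x. D (t n) x + D (t m) x))\<^sup>2 = 4 * (l2 (D ?h))\<^sup>2"
      by (simp add: power_mult_distrib)
    moreover have "(\<lambda>x. t m x - t n x) = (\<lambda>x. D (t n) x - D (t m) x)" unfolding D_def by auto
    ultimately have "(l2 (\<lambda>x. t m x - t n x))\<^sup>2
        = 2 * (l2 (D (t n)))\<^sup>2 + 2 * (l2 (D (t m)))\<^sup>2 - 4 * (l2 (D ?h))\<^sup>2"
      using parallelogram[OF cD cD, of n m] by simp
    moreover have "2 / real (Suc m) = 2 * (1 / Suc m)" "2 / real (Suc n) = 2 * (1 / Suc n)" by auto
    ultimately show ?thesis
      using t(2)[of m] t(2)[of n] \<open>\<delta> \<le> (l2 (D ?h))\<^sup>2\<close> by linarith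
  qed
  have "\<exists>N. \<forall>m\<ge>N. \<forall>n\<ge>N. (l2 (\<lambda>x. t m x - t n x))\<^sup>2 < e" if "0 < e" for e :: real
  proof -
    obtain N where N: "\<And>n. N \<le> n \<Longrightarrow> 1 / real (Suc n) < e / 4"
      using order_tendstoD(2)[OF inv0, of "e / 4"] \<open>0 < e\<close> by (auto simp: eventually_sequentially)
    have "(l2 (\<lambda>x. t m x - t n x))\<^sup>2 < e" if "N \<le> m" "N \<le> n" for m n
    proof -
      have "2 / real (Suc m) = 2 * (1 / Suc m)" "2 / real (Suc n) = 2 * (1 / Suc n)" by auto
      then show ?thesis using dist[of m n] N[OF that(1)] N[OF that(2)] by linarith
    qed
    then show ?thesis by blast
  qed
  then obtain q where cq: "cont q" and q: "uniform_limit UNIV (\<lambda>n. conv (t n) k) q sequentially"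
    using conv_uniform_limit[OF k, of t] ct by blast
  define h where "h x = conv \<phi> k x - q x" for x
  have ch: "cont h" unfolding h_def by (intro continuous_intros cont_conv \<phi> k cq)
  have "annihilated h"
  proof (rule annihilatedI)
    fix \<sigma> :: "'g rep" and i j
    assume \<sigma>: "irreducible_rep \<sigma>" and ij: "i < rep_dim \<sigma>" "j < rep_dim \<sigma>"
    define m where "m x = cnj (\<sigma> x $$ (i, j))" for x
    have mT: "m \<in> trig" unfolding m_def using \<sigma> ij by (rule trig.coeff)
    note cm = trig_cont[OF mT]
    \<comment> \<open>Self-adjointness moves the kernel from the error onto the coefficient
      \<open>m\<close>; as \<open>w\<close> stays in \<open>trig\<close>, almost minimality controls
      the inner product with it.\<close>
    define w where "w = conv m k"
    have wT: "w \<in> trig" unfolding w_def by (rule trig_conv[OF k mT])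
    note cw = trig_cont[OF wT]
    have perp: "(cmod (ip (D (t n)) w))\<^sup>2 \<le> (l2 w)\<^sup>2 * (1 / Suc n)" for n
    proof (cases "l2 w = 0")
      case True
      then show ?thesis using ip_Cauchy_Schwarz[OF cD cw, of n] by simp
    next
      case False
      let ?c = "ip (D (t n)) w / of_real ((l2 w)\<^sup>2)"
      \<comment> \<open>Correcting \<open>t n\<close> by its projection along \<open>w\<close> stays
        in \<open>trig\<close>, so it can gain no more than the slack
        \<open>1 / Suc n\<close>.\<close>
      have "(\<lambda>x. D (t n) x - ?c * w x) = D (\<lambda>x. t n x + ?c * w x)"
        unfolding D_def by auto
      moreover have "(\<lambda>x. t n x + ?c * w x) \<in> trig" by (intro trig.add trig.scale t wT)
      ultimately have "\<delta> \<le> (l2 (\<lambda>x. D (t n) x - ?c * w x))\<^sup>2" using ge by simp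
      then have "(cmod (ip (D (t n)) w))\<^sup>2 / (l2 w)\<^sup>2 \<le> 1 / Suc n"
        unfolding l2_diff_projection_sq[OF cD cw False] using t(2)[of n] by linarith
      moreover have "0 < (l2 w)\<^sup>2" using False by simp
      ultimately show ?thesis by (simp add: pos_divide_le_eq mult.commute)
    qed
    have "(\<lambda>n. (l2 w)\<^sup>2 * (1 / Suc n)) \<longlonglongrightarrow> (l2 w)\<^sup>2 * 0"
      by (intro tendsto_intros inv0)
    then have lw: "(\<lambda>n. (l2 w)\<^sup>2 * (1 / Suc n)) \<longlonglongrightarrow> 0" by simp
    have "(\<lambda>n. (cmod (ip (D (t n)) w))\<^sup>2) \<longlonglongrightarrow> 0"
    proof (rule tendsto_sandwich[OF _ _ tendsto_const lw])
      show "\<forall>\<^sub>F n in sequentially. (cmod (ip (D (t n)) w))\<^sup>2 \<le> (l2 w)\<^sup>2 * (1 / Suc n)"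
        by (rule always_eventually, rule allI, rule perp)
    qed simp
    then have "(\<lambda>n. sqrt ((cmod (ip (D (t n)) w))\<^sup>2)) \<longlonglongrightarrow> sqrt 0" by (rule tendsto_real_sqrt)
    then have lim0: "(\<lambda>n. cmod (ip (D (t n)) w)) \<longlonglongrightarrow> 0" by simp
    have near: "cmod (ip h m) \<le> 0 + r" if "0 < r" for r
    proof -
      define r' where "r' = r / (2 * (l2 m + 1))"
      have m1: "0 < l2 m + 1" by (simp add: add_nonneg_pos)
      have r': "0 < r'" unfolding r'_def using that m1 by simp
      have "eventually (\<lambda>n. cmod (ip (D (t n)) w) < r / 2) sequentially"
        using lim0 that by (intro order_tendstoD(2)) auto
      moreover have "eventually (\<lambda>n. \<forall>x\<in>UNIV. dist (conv (t n) k x) (q x) < r') sequentially"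
        by (rule uniform_limitD[OF q r'])
      ultimately have "eventually (\<lambda>n. cmod (ip (D (t n)) w) < r / 2 \<and>
          (\<forall>x\<in>UNIV. dist (conv (t n) k x) (q x) < r')) sequentially"
        by (rule eventually_conj)
      then obtain n where n: "cmod (ip (D (t n)) w) < r / 2" "\<And>x. dist (conv (t n) k x) (q x) < r'"
        by (auto simp: eventually_sequentially)
      have cdiff: "cont (\<lambda>x. conv (t n) k x - q x)"
        by (intro continuous_intros cont_conv ct k cq)
      have hx: "h = (\<lambda>x. conv (D (t n)) k x + (conv (t n) k x - q x))"
        unfolding h_def D_def using conv_diff[OF \<phi> ct k] by (auto simp: fun_eq_iff)
      have "ip h m = ip (conv (D (t n)) k) m + ip (\<lambda>x. conv (t n) k x - q x) m"
        unfolding hx by (intro ip_add cont_conv cD k cdiff cm)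
      also have "ip (conv (D (t n)) k) m = ip (D (t n)) w"
        unfolding w_def by (rule conv_selfadjoint[OF cD cm k herm])
      finally have "cmod (ip h m) \<le> cmod (ip (D (t n)) w) + cmod (ip (\<lambda>x. conv (t n) k x - q x) m)"
        by (simp add: norm_triangle_ineq)
      also have "cmod (ip (\<lambda>x. conv (t n) k x - q x) m) \<le> l2 (\<lambda>x. conv (t n) k x - q x) * l2 m"
        by (rule ip_Cauchy_Schwarz[OF cdiff cm])
      also have "l2 (\<lambda>x. conv (t n) k x - q x) \<le> r'"
        using n(2) by (intro l2_le[OF cdiff]) (auto simp: dist_norm less_imp_le)
      also have "r' * l2 m \<le> r' * (l2 m + 1)" using r' by simp
      also have "r' * (l2 m + 1) = r / 2" unfolding r'_def using m1 by (simp add: field_simps)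
      finally show ?thesis using n(1) by (simp add: mult_right_mono)
    qed
    have "cmod (ip h m) \<le> 0" by (rule field_le_epsilon) (rule near)
    then show "(\<integral>x. h x * \<sigma> x $$ (i, j) \<partial>M) = 0"
      unfolding ip_def m_def by simp
  qed
  then have "h = (\<lambda>x. 0)" by (rule matrix_coeffs_total[OF ch])
  then have "conv \<phi> k x = q x" for x unfolding h_def by (simp add: fun_eq_iff)
  moreover obtain n where "\<forall>x. dist (conv (t n) k x) (q x) < e"
    using uniform_limitD[OF q \<open>0 < e\<close>] by (auto simp: eventually_sequentially)
  ultimately show ?thesis
    using trig_conv[OF k t(1)] by (intro bexI[of _ "conv (t n) k"]) (auto simp: dist_norm norm_minus_commute)
qed

text \<open>Slices that are uniformly close have close suprema.\<close>

lemma cont_SUP: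
  fixes F :: "'g \<Rightarrow> 'g \<Rightarrow> real"
  assumes F: "continuous_on UNIV (\<lambda>p. F (fst p) (snd p))" and bdd: "\<And>x. bdd_above (range (F x))"
  shows "cont (\<lambda>x. SUP y. F x y)"
  unfolding continuous_on_def
proof (intro ballI tendstoI)
  fix x0 and e :: real assume e: "0 < e"
  have "eventually (\<lambda>x. \<forall>y. dist (F x y) (F x0 y) < e/2) (nhds x0)"
    using e by (intro eventually_uniformly_close_slices compact F) auto
  then have "eventually (\<lambda>x. dist (SUP y. F x y) (SUP y. F x0 y) < e) (nhds x0)"
  proof eventually_elim
    case (elim x)
    have "(SUP y. F a y) \<le> (SUP y. F b y) + e/2" if "\<And>y. \<bar>F a y - F b y\<bar> < e/2" for a b
    proof (rule cSUP_least)
      fix y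
      show "F a y \<le> (SUP y. F b y) + e/2"
        using that[of y] cSUP_upper[OF UNIV_I bdd, of b y] by linarith
    qed simp
    from this[of x x0] this[of x0 x] elim e show ?case
      by (simp add: dist_real_def abs_minus_commute)
  qed
  then show "\<forall>\<^sub>F x in at x0 within UNIV. dist (SUP y. F x y) (SUP y. F x0 y) < e"
    unfolding eventually_at_filter by eventually_elim simp
qed

text \<open>The kernel is built from \<open>\<phi>\<close> itself: \<open>N x\<close> measures how
  far right translation by \<open>x\<close> moves \<open>\<phi>\<close>, and \<open>\<kappa>\<close>
  vanishes where this reaches \<open>e\<close>. As \<open>N\<close> is even, the kernel is
  hermitian; as it vanishes at the identity, the kernel has positive mass.\<close>

lemma approximate_identity:
  assumes \<phi>: "cont \<phi>" and e: "0 < e"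
  shows "\<exists>k. cont k \<and> (\<forall>x. k (- x) = cnj (k x)) \<and> (\<forall>x. cmod (conv \<phi> k x - \<phi> x) \<le> e)"
proof -
  obtain B where "0 < B" and B: "\<And>x. cmod (\<phi> x) \<le> B" by (rule cont_bounded[OF \<phi>]) (rule that)
  define F where "F x y = cmod (\<phi> (y + x) - \<phi> y)" for x y
  have cF: "continuous_on UNIV (\<lambda>p. F (fst p) (snd p))"
    unfolding F_def
    by (intro continuous_intros continuous_on_compose2[OF \<phi>, of _ "\<lambda>p. snd p + fst p"] cont_snd[OF \<phi>]) auto
  have bdd: "bdd_above (range (F x))" for x
  proof (rule bdd_aboveI2)
    show "F x y \<le> B + B" for y
      unfolding F_def using B[of "y + x"] B[of y] norm_triangle_ineq4[of "\<phi> (y + x)" "\<phi> y"] by linarith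
  qed
  define N where "N x = (SUP y. F x y)" for x
  have cN: "cont N" unfolding N_def by (rule cont_SUP[OF cF bdd])
  have FN: "F x y \<le> N x" for x y unfolding N_def by (rule cSUP_upper[OF UNIV_I bdd])
  have "range (F (- x)) = range (F x)" for x
  proof -
    have eq: "F (- x) y = F x (y + - x)" for x y
      unfolding F_def by (simp add: add.assoc norm_minus_commute del: add_uminus_conv_diff)
    have "range (F (- x)) \<subseteq> range (F x)" for x using eq[of x] by auto
    from this[of x] this[of "- x"] show ?thesis by simp
  qed
  then have N_minus: "N (- x) = N x" for x unfolding N_def by metis
  have N0: "N 0 = 0" unfolding N_def F_def by simp
  define \<kappa> where "\<kappa> x = max 0 (e - N x)" for x
  have c\<kappa>: "cont \<kappa>" unfolding \<kappa>_def by (intro continuous_intros cN)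
  have \<kappa>_nn: "0 \<le> \<kappa> x" for x unfolding \<kappa>_def by simp
  define I where "I = (\<integral>x. \<kappa> x \<partial>M)"
  have "I \<noteq> 0"
  proof
    assume "I = 0"
    then have "\<kappa> 0 = 0" unfolding I_def by (intro integral_nonneg_eq_0[OF c\<kappa> \<kappa>_nn])
    then show False unfolding \<kappa>_def using e N0 by simp
  qed
  moreover have "0 \<le> I" unfolding I_def using \<kappa>_nn by simp
  ultimately have I: "0 < I" by simp
  define k where "k x = complex_of_real (\<kappa> x / I)" for x
  have ck: "cont k" unfolding k_def using \<open>I \<noteq> 0\<close> by (intro continuous_intros c\<kappa>) auto
  have int_k: "(\<integral>y. k (- y + x) \<partial>M) = 1" for x
  proof -
    have "(\<integral>y. k (- y + x) \<partial>M) = (\<integral>y. k y \<partial>M)" by (rule integral_reflect[OF ck])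
    also have "\<dots> = of_real (\<integral>y. \<kappa> y / I \<partial>M)" unfolding k_def by (rule integral_complex_of_real)
    finally show ?thesis using \<open>I \<noteq> 0\<close> by (simp add: I_def[symmetric])
  qed
  have "cmod (conv \<phi> k x - \<phi> x) \<le> e" for x
  proof -
    have ckx: "cont (\<lambda>y. k (- y + x))" by (rule cont_reflect[OF ck])
    have ik: "integrable M (\<lambda>y. k (- y + x))" "integrable M (\<lambda>y. \<phi> y * k (- y + x))"
      by (intro cont_integrable continuous_intros \<phi> ckx)+
    have "conv \<phi> k x - \<phi> x = (\<integral>y. \<phi> y * k (- y + x) \<partial>M) - \<phi> x * (\<integral>y. k (- y + x) \<partial>M)"
      unfolding conv_def int_k by simp
    also have "\<dots> = (\<integral>y. (\<phi> y - \<phi> x) * k (- y + x) \<partial>M)"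
      using ik by (simp add: left_diff_distrib)
    finally have "cmod (conv \<phi> k x - \<phi> x) = cmod (\<integral>y. (\<phi> y - \<phi> x) * k (- y + x) \<partial>M)" by simp
    also have "\<dots> \<le> (\<integral>y. cmod ((\<phi> y - \<phi> x) * k (- y + x)) \<partial>M)" by (rule integral_norm_bound)
    also have "\<dots> \<le> (\<integral>y. e * Re (k (- y + x)) \<partial>M)"
    proof (rule integral_mono)
      show "integrable M (\<lambda>y. cmod ((\<phi> y - \<phi> x) * k (- y + x)))" "integrable M (\<lambda>y. e * Re (k (- y + x)))"
        by (intro cont_integrable continuous_intros \<phi> ckx)+
      fix y
      have "cmod (\<phi> y - \<phi> x) * (\<kappa> (- y + x) / I) \<le> e * (\<kappa> (- y + x) / I)"
      proof (cases "\<kappa> (- y + x) = 0")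
        case False
        then have "N (- y + x) \<le> e" unfolding \<kappa>_def by (simp split: if_splits add: max_def)
        \<comment> \<open>The point \<open>x\<close> is the right translate of \<open>y\<close> by
          \<open>- y + x\<close>, the argument at which the kernel is evaluated.\<close>
        moreover have "cmod (\<phi> y - \<phi> x) = F (- y + x) y"
          unfolding F_def by (simp add: add.assoc[symmetric] norm_minus_commute)
        ultimately have "cmod (\<phi> y - \<phi> x) \<le> e" using FN[of "- y + x" y] by simp
        then show ?thesis using \<kappa>_nn I by (intro mult_right_mono) auto
      qed simp
      then show "cmod ((\<phi> y - \<phi> x) * k (- y + x)) \<le> e * Re (k (- y + x))"
        unfolding k_def using \<kappa>_nn[of "- y + x"] I by (simp add: norm_mult norm_divide)
    qed
    also have "\<dots> = e * Re (\<integral>y. k (- y + x) \<partial>M)" using ik by simp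
    finally show ?thesis by (simp add: int_k)
  qed
  moreover have "k (- x) = cnj (k x)" for x unfolding k_def \<kappa>_def N_minus by simp
  ultimately show ?thesis using ck by blast
qed

theorem trig_uniformly_dense:
  assumes \<phi>: "cont \<phi>" and e: "0 < e"
  shows "\<exists>t\<in>trig. \<forall>x. cmod (\<phi> x - t x) \<le> e"
proof -
  obtain k where k: "cont k" "\<And>x. k (- x) = cnj (k x)" "\<And>x. cmod (conv \<phi> k x - \<phi> x) \<le> e / 2"
    using approximate_identity[OF \<phi>, of "e / 2"] e by auto
  obtain t where t: "t \<in> trig" "\<And>x. cmod (conv \<phi> k x - t x) < e / 2"
    using conv_in_closure_trig[OF \<phi> k(1,2), of "e / 2"] e by auto
  have "cmod (\<phi> x - t x) \<le> e" for x
    using k(3)[of x] t(2)[of x] norm_triangle_ineq4[of "conv \<phi> k x - t x" "conv \<phi> k x - \<phi> x"] by simp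
  then show ?thesis using t(1) by blast
qed

subsection \<open>Averages over Borel sets\<close>

lemma outer_regular:
  assumes "B \<in> sets M" "0 < e"
  obtains U where "open U" "B \<subseteq> U" "measure M U < measure M B + e"
proof -
  have "B \<in> sets borel" using assms sets_M by simp
  then have eq: "emeasure M B = (INF U\<in>{U. open U \<and> B \<subseteq> U}. emeasure M U)"
    using haar unfolding normalized_haar_measure_def by blast
  have "emeasure M B < emeasure M B + ennreal e"
    using assms(2) by (simp add: emeasure_eq_measure ennreal_plus[symmetric] ennreal_less_iff del: ennreal_plus)
  then have "(INF U\<in>{U. open U \<and> B \<subseteq> U}. emeasure M U) < emeasure M B + ennreal e"
    unfolding eq[symmetric] .
  then obtain U where U: "open U" "B \<subseteq> U" "emeasure M U < emeasure M B + ennreal e"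
    unfolding INF_less_iff by blast
  from U(3) have "measure M U < measure M B + e"
    using assms(2) by (simp add: emeasure_eq_measure ennreal_plus[symmetric] ennreal_less_iff del: ennreal_plus)
  then show ?thesis using that U by blast
qed

lemma L1_cont:
  fixes f :: "'g \<Rightarrow> 'a::complex_banach"
  assumes f: "L1 M f" and \<phi>: "cont \<phi>"
  shows "L1 M (\<lambda>x. \<phi> x *\<^sub>C f x)"
proof -
  obtain K where "0 < K" "\<And>x. norm (\<phi> x) \<le> K" by (rule cont_bounded[OF \<phi>]) (rule that)
  then show ?thesis using L1_scaleC(1)[OF f cont_measurable[OF \<phi>]] by blast
qed

text \<open>A Urysohn function agrees with the indicator of \<open>B\<close> off a set of small
  measure. On that set \<open>f\<close> is controlled by a bounded simple function near it in L1,
  which takes the place of absolute continuity of the integral.\<close>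

lemma averages_le_if_continuous_averages_le:
  fixes f :: "'g \<Rightarrow> 'a::complex_banach"
  assumes f: "L1 M f" and C: "0 \<le> C"
    and bound: "\<And>\<phi>. cont \<phi> \<Longrightarrow> norm (strong_integral M (\<lambda>x. \<phi> x *\<^sub>C f x)) \<le> C * (\<integral>x. cmod (\<phi> x) \<partial>M)"
    and B: "B \<in> sets M"
  shows "norm (strong_integral M (\<lambda>x. indicator B x *\<^sub>C f x)) \<le> C * measure M B"
proof (rule field_le_epsilon)
  fix e :: real assume e: "0 < e"
  interpret c: finite_measure "completion M" by (rule finite_measure_completion)
  obtain s where s: "simple_function M s" "L1_norm M (\<lambda>x. f x - s x) < e / 2"
    using L1_approx[OF f, of "e / 2"] e by auto
  obtain K where K: "0 \<le> K" "\<And>x. norm (s x) \<le> K"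
    using simple_function_bounded[OF s(1)] by auto
  \<comment> \<open>Regularity costs \<open>C * r\<close> in the bound for the Urysohn function and
    \<open>2 * K * r\<close> on the exceptional set; with this \<open>r\<close> both together stay
    below \<open>e / 2\<close>.\<close>
  define r where "r = e / (2 * (C + 2 * K + 1))"
  have den: "0 < C + 2 * K + 1" using C K(1) by simp
  then have r: "0 < r" unfolding r_def using e by simp
  obtain U where U: "open U" "B \<subseteq> U" "measure M U < measure M B + r"
    by (rule outer_regular[OF B r]) (rule that)
  \<comment> \<open>Outer regularity of the complement gives closed sets inside \<open>B\<close>:
    \<open>- U'\<close> lies in \<open>B\<close>, and \<open>B\<close> in \<open>U\<close>.\<close>
  have B': "- B \<in> sets M" using sets.compl_sets[OF B] by (simp add: Compl_eq_Diff_UNIV)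
  obtain U' where U': "open U'" "- B \<subseteq> U'" "measure M U' < measure M (- B) + r"
    by (rule outer_regular[OF B' r]) (rule that)
  obtain \<psi> :: "'g \<Rightarrow> real" where \<psi>: "continuous_on UNIV \<psi>" "\<And>x. 0 \<le> \<psi> x" "\<And>x. \<psi> x \<le> 1"
    "\<And>x. x \<in> - U \<Longrightarrow> \<psi> x = 0" "\<And>x. x \<in> - U' \<Longrightarrow> \<psi> x = 1"
    by (rule compact_Hausdorff_Urysohn[OF compact, of "- U" "- U'"])
       (use U U' in \<open>auto simp: closed_Compl\<close>)
  define D where "D = U \<inter> U'"
  have sU: "U \<in> sets M" "U' \<in> sets M" "D \<in> sets M" unfolding D_def using U U' by (auto simp: sets_M)
  have mD: "measure M D \<le> 2 * r"
  proof -
    have "measure M (U \<union> U') = measure M UNIV" using U U' by (intro arg_cong[of _ _ "measure M"]) auto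
    moreover have "measure M (U \<union> U') = measure M U + measure M U' - measure M D"
      unfolding D_def using sU by (intro measure_Un3) (auto simp: fmeasurable_def emeasure_eq_measure)
    moreover have "measure M (- B) = 1 - measure M B"
      using finite_measure_compl[OF B] by (simp add: Compl_eq_Diff_UNIV)
    ultimately show ?thesis using U(3) U'(3) by simp
  qed
  define \<phi> where "\<phi> x = complex_of_real (\<psi> x)" for x
  have c\<phi>: "cont \<phi>" unfolding \<phi>_def by (intro continuous_intros \<psi>)
  have L\<phi>: "L1 M (\<lambda>x. \<phi> x *\<^sub>C f x)" by (rule L1_cont[OF f c\<phi>])
  have LB: "L1 M (\<lambda>x. indicator B x *\<^sub>C f x)"
    using B by (intro L1_scaleC(1)[OF f, of _ 1]) (auto simp: indicator_def)
  have Ls: "L1 M (\<lambda>x. f x - s x)" by (rule L1_diff(1)[OF f L1_simple[OF s(1)]])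
  have iD: "integrable (completion M) (\<lambda>x. K * indicator D x)"
    using sU by (intro integrable_mult_right integrable_real_indicator) (auto simp: c.emeasure_eq_measure)
  have "L1_norm M (\<lambda>x. indicator B x *\<^sub>C f x - \<phi> x *\<^sub>C f x)
      \<le> (\<integral>x. norm (f x - s x) + K * indicator D x \<partial>completion M)"
  proof (rule L1_mono(2))
    show "strongly_measurable M (\<lambda>x. indicator B x *\<^sub>C f x - \<phi> x *\<^sub>C f x)"
      using L1_diff(1)[OF LB L\<phi>] unfolding L1_def by simp
    show "integrable (completion M) (\<lambda>x. norm (f x - s x) + K * indicator D x)"
      using Ls iD unfolding L1_def by auto
    have "norm (indicator B x *\<^sub>C f x - \<phi> x *\<^sub>C f x) \<le> norm (f x - s x) + K * indicator D x" for x
    proof (cases "x \<in> D")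
      case True
      have "cmod (indicator B x - \<phi> x) \<le> 1"
      proof -
        have "indicator B x - \<phi> x = complex_of_real (indicator B x - \<psi> x)"
          unfolding \<phi>_def by (simp add: indicator_def)
        moreover have "\<bar>indicator B x - \<psi> x\<bar> \<le> 1"
          using \<psi>(2)[of x] \<psi>(3)[of x] by (auto simp: indicator_def)
        ultimately show ?thesis by (simp only: norm_of_real)
      qed
      then have "norm (indicator B x *\<^sub>C f x - \<phi> x *\<^sub>C f x) \<le> norm (f x)"
        unfolding scaleC.diff_left[symmetric] norm_scaleC by (intro mult_left_le_one_le) auto
      also have "\<dots> \<le> norm (f x - s x) + K"
        using norm_triangle_sub[of "f x" "s x"] K(2)[of x] by simp
      finally show ?thesis using True by simp
    next
      case False
      then have "indicator B x = \<phi> x"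
        using \<psi>(4)[of x] \<psi>(5)[of x] U(2) U'(2) unfolding D_def \<phi>_def by (auto simp: indicator_def)
      then show ?thesis using False by simp
    qed
    then show "AE x in M. norm (indicator B x *\<^sub>C f x - \<phi> x *\<^sub>C f x) \<le> norm (f x - s x) + K * indicator D x"
      by simp
  qed
  also have "\<dots> = L1_norm M (\<lambda>x. f x - s x) + K * measure M D"
    using Ls iD sU(3) unfolding L1_norm_def L1_def by simp
  also have "\<dots> \<le> e / 2 + K * (2 * r)"
    using s(2) mD K(1) by (intro add_mono mult_left_mono) auto
  finally have diff: "L1_norm M (\<lambda>x. indicator B x *\<^sub>C f x - \<phi> x *\<^sub>C f x) \<le> e / 2 + K * (2 * r)" .
  have "(\<integral>x. cmod (\<phi> x) \<partial>M) \<le> (\<integral>x. indicator U x \<partial>M)"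
  proof (rule integral_mono)
    show "integrable M (\<lambda>x. cmod (\<phi> x))" by (intro cont_integrable continuous_intros c\<phi>)
    show "integrable M (indicator U :: 'g \<Rightarrow> real)"
      using sU by (intro integrable_real_indicator) (auto simp: emeasure_eq_measure)
    show "cmod (\<phi> x) \<le> indicator U x" for x
      unfolding \<phi>_def using \<psi>(2,3)[of x] \<psi>(4)[of x] by (auto simp: indicator_def)
  qed
  also have "\<dots> = measure M U" using sU by simp
  finally have "C * (\<integral>x. cmod (\<phi> x) \<partial>M) \<le> C * (measure M B + r)"
    using U(3) C by (intro mult_left_mono) auto
  then have J: "norm (strong_integral M (\<lambda>x. \<phi> x *\<^sub>C f x)) \<le> C * (measure M B + r)"
    using bound[OF c\<phi>] by simp
  have "norm (strong_integral M (\<lambda>x. indicator B x *\<^sub>C f x))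
      \<le> norm (strong_integral M (\<lambda>x. \<phi> x *\<^sub>C f x))
        + norm (strong_integral M (\<lambda>x. indicator B x *\<^sub>C f x) - strong_integral M (\<lambda>x. \<phi> x *\<^sub>C f x))"
    by (rule norm_triangle_sub)
  also have "strong_integral M (\<lambda>x. indicator B x *\<^sub>C f x) - strong_integral M (\<lambda>x. \<phi> x *\<^sub>C f x)
      = strong_integral M (\<lambda>x. indicator B x *\<^sub>C f x - \<phi> x *\<^sub>C f x)"
    by (rule strong_integral_diff[OF LB L\<phi>, symmetric])
  also have "norm (strong_integral M (\<lambda>x. indicator B x *\<^sub>C f x - \<phi> x *\<^sub>C f x)) \<le> e / 2 + K * (2 * r)"
    using strong_integral_norm_le[OF L1_diff(1)[OF LB L\<phi>]] diff by simp
  also have "norm (strong_integral M (\<lambda>x. \<phi> x *\<^sub>C f x)) \<le> C * (measure M B + r)" by (rule J)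
  also have "C * (measure M B + r) + (e / 2 + K * (2 * r)) = C * measure M B + (e / 2 + r * (C + 2 * K))"
    by (simp add: algebra_simps)
  also have "r * (C + 2 * K) \<le> r * (C + 2 * K + 1)" using r by simp
  also have "r * (C + 2 * K + 1) = e / 2" unfolding r_def using den by (simp add: field_simps)
  finally show "norm (strong_integral M (\<lambda>x. indicator B x *\<^sub>C f x)) \<le> C * measure M B + e" by simp
qed

end

section \<open>Fourier coefficients\<close>

locale compact_haar_dual = compact_haar M
  for M :: "'g::{topological_group_add, t2_space} measure" +
  fixes rep :: "'g rep set \<Rightarrow> 'g rep" and \<xi> :: "'g rep set \<Rightarrow> nat \<Rightarrow> complex Matrix.vec"
  assumes choice: "dual_choice rep \<xi>"
begin

abbreviation d :: "'g rep set \<Rightarrow> nat" where "d c \<equiv> rep_dim (rep c)"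

definition basis_mat :: "'g rep set \<Rightarrow> complex Matrix.mat" where
  "basis_mat c = Matrix.mat (d c) (d c) (\<lambda>(i, j). \<xi> c j $ i)"

text \<open>The chosen representative written in the chosen orthonormal basis.\<close>

definition \<rho> :: "'g rep set \<Rightarrow> 'g rep" where
  "\<rho> c x = mat_adjoint (basis_mat c) * (rep c x * basis_mat c)"

definition coef :: "'g rep set \<times> nat \<times> nat \<Rightarrow> 'g \<Rightarrow> complex" where
  "coef p x = (case p of (c, i, j) \<Rightarrow> (mat_adjoint (rep c x) *\<^sub>v \<xi> c j) \<bullet>c \<xi> c i)"

definition indices :: "('g rep set \<times> nat \<times> nat) set" where
  "indices = (SIGMA c:unitary_dual. {..<d c} \<times> {..<d c})"

lemma rep_in_class: "c \<in> unitary_dual \<Longrightarrow> rep c \<in> c"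
  using choice unfolding dual_choice_def by simp

lemma rep_irreducible:
  assumes "c \<in> unitary_dual" shows "irreducible_rep (rep c)"
proof -
  have "rep c \<in> c" by (rule rep_in_class[OF assms])
  then show ?thesis using assms unfolding unitary_dual_def by (auto elim!: quotientE)
qed

lemma rep_inequivalent:
  assumes "c \<in> unitary_dual" "c' \<in> unitary_dual" "unitarily_equivalent (rep c) (rep c')"
  shows "c = c'"
proof -
  have "(rep c, rep c') \<in> {(\<sigma>, \<tau>). irreducible_rep \<sigma> \<and> irreducible_rep \<tau> \<and> unitarily_equivalent \<sigma> \<tau>}"
    using assms rep_irreducible by simp
  with equiv_unitarily_equivalent assms(1,2)[unfolded unitary_dual_def]
    rep_in_class[OF assms(1)] rep_in_class[OF assms(2)]
  show ?thesis by (rule quotient_eqI)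
qed

lemma rep_exhaustive:
  assumes "irreducible_rep \<sigma>"
  obtains c where "c \<in> unitary_dual" "unitarily_equivalent (rep c) \<sigma>"
proof -
  let ?R = "{(\<sigma>, \<tau>). irreducible_rep \<sigma> \<and> irreducible_rep \<tau> \<and> unitarily_equivalent \<sigma> \<tau>}"
  have c: "?R `` {\<sigma>} \<in> unitary_dual"
    unfolding unitary_dual_def using assms by (intro quotientI) simp
  then have "rep (?R `` {\<sigma>}) \<in> ?R `` {\<sigma>}" by (rule rep_in_class)
  then have "unitarily_equivalent \<sigma> (rep (?R `` {\<sigma>}))"
    by (simp only: Image_singleton_iff mem_Collect_eq prod.case)
  then have "unitarily_equivalent (rep (?R `` {\<sigma>})) \<sigma>"
    by (rule unitarily_equivalent_sym[OF irreducible_repD[OF assms] irreducible_repD[OF rep_irreducible[OF c]]])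
  then show ?thesis by (rule that[OF c])
qed

text \<open>Orthonormality of the columns gives one of the two products; for a square matrix a
  one-sided inverse is two-sided.\<close>

lemma basis_mat_unitary:
  assumes c: "c \<in> unitary_dual" shows "unitary_mat (d c) (basis_mat c)"
proof -
  have ob: "orthonormal_basis (d c) (\<xi> c)" using choice c unfolding dual_choice_def by auto
  have B: "basis_mat c \<in> carrier_mat (d c) (d c)" unfolding basis_mat_def by simp
  have dim: "dim_vec (\<xi> c i) = d c" if "i < d c" for i
    using ob that unfolding orthonormal_basis_def by auto
  have AB: "mat_adjoint (basis_mat c) * basis_mat c = 1\<^sub>m (d c)"
  proof (rule eq_matI)
    fix i j assume "i < dim_row (1\<^sub>m (d c) :: complex Matrix.mat)" "j < dim_col (1\<^sub>m (d c) :: complex Matrix.mat)"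
    then have ij: "i < d c" "j < d c" by auto
    have "(mat_adjoint (basis_mat c) * basis_mat c) $$ (i, j) = (\<Sum>k<d c. cnj (\<xi> c i $ k) * \<xi> c j $ k)"
      unfolding adjoint_mult_index[OF B B ij] unfolding basis_mat_def using ij by (intro sum.cong) auto
    also have "\<dots> = \<xi> c j \<bullet>c \<xi> c i"
      using dim[OF ij(1)] dim[OF ij(2)] by (simp add: scalar_prod_def atLeast0LessThan mult.commute)
    also have "\<dots> = (1\<^sub>m (d c)) $$ (i, j)" using ob ij unfolding orthonormal_basis_def by auto
    finally show "(mat_adjoint (basis_mat c) * basis_mat c) $$ (i, j) = (1\<^sub>m (d c)) $$ (i, j)" .
  qed (use B in auto)
  moreover have "basis_mat c * mat_adjoint (basis_mat c) = 1\<^sub>m (d c)"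
    by (rule mat_mult_left_right_inverse[OF mat_adjoint_carrier[OF B] B AB])
  ultimately show ?thesis unfolding unitary_mat_def using B by simp
qed

lemma \<rho>_conjugate:
  assumes "c \<in> unitary_dual"
  shows "scalar_commutant (\<rho> c)" "rep_dim (\<rho> c) = d c" "unitarily_equivalent (\<rho> c) (rep c)"
  using conjugate_rep[OF irreducible_scalar_commutant[OF rep_irreducible[OF assms]] basis_mat_unitary[OF assms]]
  unfolding \<rho>_def[abs_def] by auto

text \<open>The adjoint in the Fourier coefficient conjugates the entry and swaps its
  indices.\<close>

lemma coef_eq:
  assumes c: "c \<in> unitary_dual" and ij: "i < d c" "j < d c"
  shows "coef (c, i, j) x = cnj (\<rho> c x $$ (j, i))"
proof -
  note ur = irreducible_repD[OF rep_irreducible[OF c]]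
  note C = unitary_rep_carrier[OF ur]
  have B: "basis_mat c \<in> carrier_mat (d c) (d c)" unfolding basis_mat_def by simp
  have ent: "basis_mat c $$ (k, l) = \<xi> c l $ k" if "k < d c" "l < d c" for k l
    unfolding basis_mat_def using that by simp
  have \<xi>: "\<xi> c k \<in> carrier_vec (d c)" if "k < d c" for k
    using choice c that unfolding dual_choice_def orthonormal_basis_def by auto
  have "coef (c, i, j) x = (\<Sum>k<d c. (\<Sum>l<d c. cnj (rep c x $$ (l, k)) * \<xi> c j $ l) * cnj (\<xi> c i $ k))"
    unfolding coef_def using C[of x] \<xi>[OF ij(1)] \<xi>[OF ij(2)]
    by (auto simp: scalar_prod_def atLeast0LessThan intro!: sum.cong)
  also have "\<dots> = (\<Sum>l<d c. \<Sum>k<d c. cnj (rep c x $$ (l, k)) * \<xi> c j $ l * cnj (\<xi> c i $ k))"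
    unfolding sum_distrib_right by (rule sum.swap)
  also have "\<dots> = (\<Sum>l<d c. \<xi> c j $ l * (\<Sum>k<d c. cnj (rep c x $$ (l, k)) * cnj (\<xi> c i $ k)))"
    by (simp add: sum_distrib_left mult_ac)
  also have "\<dots> = cnj (\<rho> c x $$ (j, i))"
    unfolding \<rho>_def adjoint_mult_index[OF B mult_carrier_mat[OF C B] ij(2,1)] cnj_sum
    using ij by (intro sum.cong refl) (simp add: mult_mat_index[OF C B] ent)
  finally show ?thesis .
qed

lemma coef_cont:
  assumes "p \<in> indices" shows "cont (coef p)"
proof -
  obtain c i j where p: "p = (c, i, j)" "c \<in> unitary_dual" "i < d c" "j < d c"
    using assms unfolding indices_def by auto
  have "unitary_rep (\<rho> c)" by (rule scalar_commutantD(1)[OF \<rho>_conjugate(1)[OF p(2)]])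
  then have "cont (\<lambda>x. cnj (\<rho> c x $$ (j, i)))"
    using p by (intro continuous_intros unitary_rep_index(4)) (auto simp: \<rho>_conjugate)
  then show ?thesis unfolding p(1) using coef_eq[OF p(2-4)] by simp
qed

text \<open>Each column of a unitary matrix has norm 1.\<close>

lemma coef_bound:
  assumes "p \<in> indices" shows "cmod (coef p x) \<le> 1"
proof -
  obtain c i j where p: "p = (c, i, j)" "c \<in> unitary_dual" "i < d c" "j < d c"
    using assms unfolding indices_def by auto
  let ?r = "\<lambda>k. cmod (\<rho> c x $$ (k, i))"
  note ur = scalar_commutantD(1)[OF \<rho>_conjugate(1)[OF p(2)]]
  have "complex_of_real (\<Sum>k<d c. (?r k)\<^sup>2) = (\<Sum>k<d c. \<rho> c x $$ (k, i) * cnj (\<rho> c x $$ (k, i)))"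
    unfolding of_real_sum complex_norm_square ..
  also have "\<dots> = of_real 1"
    using unitary_rep_index(3)[OF ur, of i i x] p \<rho>_conjugate(2)[OF p(2)] by simp
  finally have "(\<Sum>k<d c. (?r k)\<^sup>2) = 1" unfolding of_real_eq_iff .
  moreover have "(?r j)\<^sup>2 \<le> (\<Sum>k<d c. (?r k)\<^sup>2)"
    using p by (intro member_le_sum) auto
  ultimately have "(?r j)\<^sup>2 \<le> 1" by simp
  then have "?r j \<le> 1" using abs_square_le_1[of "?r j"] by simp
  then show ?thesis unfolding p(1) coef_eq[OF p(2-4)] by simp
qed

lemma coef_orthogonal:
  assumes "p \<in> indices" "q \<in> indices"
  shows "ip (coef p) (coef q) = (if p = q then 1 / of_nat (d (fst p)) else 0)"
proof -
  obtain c i j where p: "p = (c, i, j)" "c \<in> unitary_dual" "i < d c" "j < d c"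
    using assms unfolding indices_def by auto
  obtain c' k l where q: "q = (c', k, l)" "c' \<in> unitary_dual" "k < d c'" "l < d c'"
    using assms unfolding indices_def by auto
  note irr = \<rho>_conjugate[OF p(2)] \<rho>_conjugate[OF q(2)]
  have ur: "unitary_rep (\<rho> c)" "unitary_rep (\<rho> c')" "unitary_rep (rep c)" "unitary_rep (rep c')"
    by (intro scalar_commutantD(1)[OF irr(1)] scalar_commutantD(1)[OF irr(4)]
        irreducible_repD rep_irreducible p q)+
  have "ip (coef p) (coef q) = (\<integral>x. cnj (\<rho> c x $$ (j, i) * cnj (\<rho> c' x $$ (l, k))) \<partial>M)"
    unfolding ip_def p(1) q(1) coef_eq[OF p(2-4)] coef_eq[OF q(2-4)] by simp
  also have "\<dots> = cnj (\<integral>x. \<rho> c x $$ (j, i) * cnj (\<rho> c' x $$ (l, k)) \<partial>M)"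
    by (rule Bochner_Integration.integral_cnj)
  also have "(\<integral>x. \<rho> c x $$ (j, i) * cnj (\<rho> c' x $$ (l, k)) \<partial>M)
      = (if p = q then 1 / of_nat (d (fst p)) else 0)"
  proof (cases "c = c'")
    case True
    then show ?thesis
      using Schur_orthogonality[OF irr(1), of j i l k] p q irr(2) by auto
  next
    case False
    have "\<not> unitarily_equivalent (\<rho> c') (\<rho> c)"
    proof
      assume "unitarily_equivalent (\<rho> c') (\<rho> c)"
      then have "unitarily_equivalent (\<rho> c') (rep c)"
        using unitarily_equivalent_trans[OF ur(2,1,3) _ irr(3)] by simp
      then have "unitarily_equivalent (rep c') (rep c)"
        using unitarily_equivalent_trans[OF ur(4,2,3) unitarily_equivalent_sym[OF ur(2,4) irr(6)]] by simp
      then show False using rep_inequivalent[OF q(2) p(2)] False by simp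
    qed
    then show ?thesis
      using Schur_orthogonality_inequivalent[OF irr(1,4)] p q irr(2,5) False by auto
  qed
  finally show ?thesis by simp
qed

definition coef_span :: "('g \<Rightarrow> complex) set" where
  "coef_span = {t. \<exists>P a. finite P \<and> P \<subseteq> indices \<and> t = (\<lambda>x. \<Sum>p\<in>P. a p * coef p x)}"

lemma coef_spanI:
  "finite P \<Longrightarrow> P \<subseteq> indices \<Longrightarrow> (\<lambda>x. \<Sum>p\<in>P. a p * coef p x) \<in> coef_span"
  unfolding coef_span_def by (intro CollectI exI[of _ P] exI[of _ a]) simp

lemma lin_coef_span: "lin coef_span"
  unfolding lin_def
proof (intro conjI ballI allI)
  fix t assume "t \<in> coef_span"
  then obtain P a where P: "P \<subseteq> indices" "t = (\<lambda>x. \<Sum>p\<in>P. a p * coef p x)"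
    unfolding coef_span_def by blast
  show "cont t" unfolding P(2) using P(1) by (intro continuous_intros coef_cont) auto
next
  show "(\<lambda>x. 0) \<in> coef_span" using coef_spanI[of "{}"] by simp
next
  fix s t assume "s \<in> coef_span" "t \<in> coef_span"
  then obtain P a Q b where P: "finite P" "P \<subseteq> indices" "s = (\<lambda>x. \<Sum>p\<in>P. a p * coef p x)"
    and Q: "finite Q" "Q \<subseteq> indices" "t = (\<lambda>x. \<Sum>p\<in>Q. b p * coef p x)"
    unfolding coef_span_def by blast
  have "s x + t x = (\<Sum>p\<in>P \<union> Q. ((if p \<in> P then a p else 0) + (if p \<in> Q then b p else 0)) * coef p x)" for x
  proof -
    have "s x = (\<Sum>p\<in>P \<union> Q. (if p \<in> P then a p else 0) * coef p x)"
      unfolding P(3) using P Q by (intro sum.mono_neutral_cong_left) auto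
    moreover have "t x = (\<Sum>p\<in>P \<union> Q. (if p \<in> Q then b p else 0) * coef p x)"
      unfolding Q(3) using P Q by (intro sum.mono_neutral_cong_left) auto
    ultimately show ?thesis by (simp add: distrib_right sum.distrib)
  qed
  then show "(\<lambda>x. s x + t x) \<in> coef_span"
    using P Q by (simp only:) (intro coef_spanI, auto)
next
  fix c t assume "t \<in> coef_span"
  then obtain P a where P: "finite P" "P \<subseteq> indices" "t = (\<lambda>x. \<Sum>p\<in>P. a p * coef p x)"
    unfolding coef_span_def by blast
  then have "(\<lambda>x. c * t x) = (\<lambda>x. \<Sum>p\<in>P. (c * a p) * coef p x)"
    by (simp add: sum_distrib_left mult.assoc)
  then show "(\<lambda>x. c * t x) \<in> coef_span" using P coef_spanI by simp
qed

lemma coef_in_span: "p \<in> indices \<Longrightarrow> coef p \<in> coef_span"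
  using coef_spanI[of "{p}" "\<lambda>_. 1"] by simp

text \<open>An arbitrary irreducible representation is conjugate, by a unitary \<open>V\<close> not
  depending on \<open>x\<close>, to the chosen one of its class; its entries are fixed combinations
  of the chosen entries.\<close>

lemma trig_subset_coef_span: "t \<in> trig \<Longrightarrow> t \<in> coef_span"
proof (induction rule: trig.induct)
  case (coeff \<sigma> i j)
  obtain c where c: "c \<in> unitary_dual" "unitarily_equivalent (rep c) \<sigma>"
    using rep_exhaustive[OF coeff(1)] by blast
  have ur: "unitary_rep (\<rho> c)" "unitary_rep \<sigma>" "unitary_rep (rep c)"
    by (intro scalar_commutantD(1)[OF \<rho>_conjugate(1)[OF c(1)]] irreducible_repD rep_irreducible coeff(1) c(1))+
  have "unitarily_equivalent (\<rho> c) \<sigma>"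
    by (rule unitarily_equivalent_trans[OF ur(1,3,2) \<rho>_conjugate(3)[OF c(1)] c(2)])
  then obtain V where dim: "d c = rep_dim \<sigma>" and V: "unitary_mat (d c) V" and tw: "\<And>x. V * \<rho> c x = \<sigma> x * V"
    unfolding unitarily_equivalent_def \<rho>_conjugate(2)[OF c(1)] by auto
  have C: "V \<in> carrier_mat (d c) (d c)" "\<rho> c x \<in> carrier_mat (d c) (d c)" "\<sigma> x \<in> carrier_mat (d c) (d c)" for x
    using V unitary_rep_carrier[OF ur(1)] unitary_rep_carrier[OF ur(2)] dim \<rho>_conjugate(2)[OF c(1)]
    unfolding unitary_mat_def by auto
  have AV: "mat_adjoint V \<in> carrier_mat (d c) (d c)" using C(1) by simp
  have ij: "i < d c" "j < d c" using coeff dim by auto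
  have "cnj (\<sigma> x $$ (i, j))
      = (\<Sum>l<d c. V $$ (j, l) * (\<Sum>k<d c. cnj (V $$ (i, k)) * coef (c, l, k) x))" for x
  proof -
    have "\<sigma> x = \<sigma> x * (V * mat_adjoint V)"
      using V C(3)[of x] unfolding unitary_mat_def by simp
    also have "\<dots> = (V * \<rho> c x) * mat_adjoint V"
      unfolding tw by (rule assoc_mult_mat[OF C(3,1) AV, symmetric])
    finally have "\<sigma> x $$ (i, j) = ((V * \<rho> c x) * mat_adjoint V) $$ (i, j)" by simp
    also have "\<dots> = (\<Sum>l<d c. (\<Sum>k<d c. V $$ (i, k) * \<rho> c x $$ (k, l)) * cnj (V $$ (j, l)))"
      unfolding mult_adjoint_index[OF mult_carrier_mat[OF C(1,2)] C(1) ij]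
      using ij by (intro sum.cong refl) (simp add: mult_mat_index[OF C(1,2)])
    finally show ?thesis
      using c by (simp add: coef_eq mult.commute)
  qed
  then have "(\<lambda>x. cnj (\<sigma> x $$ (i, j)))
      = (\<lambda>x. \<Sum>l<d c. V $$ (j, l) * (\<Sum>k<d c. cnj (V $$ (i, k)) * coef (c, l, k) x))" by simp
  also have "\<dots> \<in> coef_span"
    using c(1) by (intro lin_sum[OF lin_coef_span] coef_in_span) (auto simp: indices_def)
  finally show ?case .
qed (use linD[OF lin_coef_span] in auto)

lemma coefficient_bound:
  assumes P: "finite P" "P \<subseteq> indices" "t = (\<lambda>x. \<Sum>p\<in>P. a p * coef p x)" and p: "p \<in> P"
  shows "cmod (a p) \<le> real (d (fst p)) * (\<integral>x. cmod (t x) \<partial>M)"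
proof -
  have dpos: "0 < d (fst p)"
    using p P(2) by (auto simp: indices_def)
  have ct: "cont t" unfolding P(3) using P(2) by (intro continuous_intros coef_cont) auto
  have cp: "cont (coef p)" using p P(2) by (intro coef_cont) auto
  have "ip t (coef p) = (\<Sum>q\<in>P. a q * ip (coef q) (coef p))"
    unfolding P(3) using P(2) p by (intro ip_sum coef_cont) auto
  also have "\<dots> = (\<Sum>q\<in>P. if q = p then a q / of_nat (d (fst p)) else 0)"
    using subsetD[OF P(2)] p by (intro sum.cong refl) (simp add: coef_orthogonal)
  also have "\<dots> = a p / of_nat (d (fst p))" using P(1) p by simp
  finally have "a p = of_nat (d (fst p)) * ip t (coef p)" using dpos by simp
  then have "cmod (a p) = real (d (fst p)) * cmod (ip t (coef p))" by (simp add: norm_mult)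
  also have "cmod (ip t (coef p)) \<le> (\<integral>x. cmod (t x * cnj (coef p x)) \<partial>M)"
    unfolding ip_def by (rule integral_norm_bound)
  also have "\<dots> \<le> (\<integral>x. cmod (t x) \<partial>M)"
  proof (rule integral_mono)
    show "integrable M (\<lambda>x. cmod (t x * cnj (coef p x)))" "integrable M (\<lambda>x. cmod (t x))"
      by (intro cont_integrable continuous_intros ct cp)+
    show "cmod (t x * cnj (coef p x)) \<le> cmod (t x)" for x
      using coef_bound[of p x] p P(2) by (auto simp: norm_mult mult_left_le)
  qed
  finally show ?thesis by (simp add: mult_left_mono)
qed

section \<open>Estimates by the Barron norm\<close>

abbreviation "bterm \<equiv> barron_term M rep \<xi>"
abbreviation "bspace \<equiv> barron_space M rep \<xi>"
abbreviation "bnorm \<equiv> barron_norm M rep \<xi>"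

abbreviation fc :: "('g \<Rightarrow> 'a::complex_banach) \<Rightarrow> 'g rep set \<times> nat \<times> nat \<Rightarrow> 'a" where
  "fc f p \<equiv> strong_integral M (\<lambda>x. coef p x *\<^sub>C f x)"

lemma fourier_coeff_eq: "fourier_coeff M f (rep c) (\<xi> c j) (\<xi> c i) = fc f (c, i, j)"
  unfolding fourier_coeff_def coef_def by simp

lemma barron_term_eq:
  "bterm \<gamma> s f c = real (d c) * (1 + (\<gamma> c)\<^sup>2) powr (s / 2) *
     (\<Sum>i<d c. \<Sum>j<d c. norm (fc f (c, i, j)))"
  unfolding barron_term_def fourier_coeff_eq ..

lemma barron_term_nonneg: "0 \<le> bterm \<gamma> s f c"
  unfolding barron_term_eq by (intro mult_nonneg_nonneg sum_nonneg) auto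

text \<open>For nonnegative \<open>s\<close> the weight is a nonnegative power of a number that is
  at least 1.\<close>

lemma barron_term_ge:
  assumes "0 \<le> s"
  shows "real (d c) * (\<Sum>i<d c. \<Sum>j<d c. norm (fc f (c, i, j))) \<le> bterm \<gamma> s f c"
proof -
  have "1 \<le> (1 + (\<gamma> c)\<^sup>2) powr (s / 2)" using assms by (intro ge_one_powr_ge_zero) auto
  then have "real (d c) * 1 * (\<Sum>i<d c. \<Sum>j<d c. norm (fc f (c, i, j))) \<le> bterm \<gamma> s f c"
    unfolding barron_term_eq by (intro mult_right_mono mult_left_mono sum_nonneg) auto
  then show ?thesis by simp
qed

lemma L1_coef: "L1 M f \<Longrightarrow> p \<in> indices \<Longrightarrow> L1 M (\<lambda>x. coef p x *\<^sub>C (f x :: 'a::complex_banach))"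
  by (rule L1_cont[OF _ coef_cont])

lemma barron_space_L1: "f \<in> bspace \<gamma> s \<Longrightarrow> L1 M f"
  unfolding barron_space_def by (intro bochner_L2_imp_L1) simp

lemma barron_norm_nonneg: "0 \<le> bnorm \<gamma> s f"
  unfolding barron_norm_def by (intro infsum_nonneg barron_term_nonneg)

lemma trig_average_le:
  fixes f :: "'g \<Rightarrow> 'a::complex_banach"
  assumes f: "f \<in> bspace \<gamma> s" and s: "0 \<le> s" and t: "t \<in> trig"
  shows "norm (strong_integral M (\<lambda>x. t x *\<^sub>C f x)) \<le> bnorm \<gamma> s f * (\<integral>x. cmod (t x) \<partial>M)"
proof -
  note Lf = barron_space_L1[OF f]
  obtain P a where P: "finite P" "P \<subseteq> indices" "t = (\<lambda>x. \<Sum>p\<in>P. a p * coef p x)"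
    using trig_subset_coef_span[OF t] unfolding coef_span_def by blast
  let ?T = "\<integral>x. cmod (t x) \<partial>M"
  have "(\<lambda>x. t x *\<^sub>C f x) = (\<lambda>x. \<Sum>p\<in>P. a p *\<^sub>C (coef p x *\<^sub>C f x))"
    unfolding P(3) by (simp add: scaleC.sum_left scaleC_scaleC)
  moreover have "strong_integral M (\<lambda>x. \<Sum>p\<in>P. a p *\<^sub>C (coef p x *\<^sub>C f x)) = (\<Sum>p\<in>P. a p *\<^sub>C fc f p)"
    using P(2) by (intro strong_integral_sum[THEN conjunct1] L1_coef[OF Lf]) auto
  ultimately have "norm (strong_integral M (\<lambda>x. t x *\<^sub>C f x)) = norm (\<Sum>p\<in>P. a p *\<^sub>C fc f p)" by simp
  also have "\<dots> \<le> (\<Sum>p\<in>P. norm (a p *\<^sub>C fc f p))" by (rule norm_sum)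
  also have "\<dots> \<le> (\<Sum>p\<in>P. real (d (fst p)) * ?T * norm (fc f p))"
    unfolding norm_scaleC using coefficient_bound[OF P] by (intro sum_mono mult_right_mono) auto
  \<comment> \<open>The index set is enlarged to all pairs \<open>(i, j)\<close> over the classes
    that occur, so that whole Barron terms appear.\<close>
  also have "\<dots> \<le> (\<Sum>p\<in>(SIGMA c:fst ` P. {..<d c} \<times> {..<d c}). real (d (fst p)) * ?T * norm (fc f p))"
    using P by (intro sum_mono2 finite_SigmaI mult_nonneg_nonneg) (force simp: indices_def)+
  also have "\<dots> = (\<Sum>c\<in>fst ` P. \<Sum>q\<in>{..<d c} \<times> {..<d c}. real (d c) * ?T * norm (fc f (c, q)))"
    using P(1) sum.Sigma[of "fst ` P" "\<lambda>c. {..<d c} \<times> {..<d c}"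
        "\<lambda>c q. real (d c) * ?T * norm (fc f (c, q))"]
    by (simp add: case_prod_unfold)
  also have "\<dots> = (\<Sum>c\<in>fst ` P. real (d c) * (\<Sum>i<d c. \<Sum>j<d c. norm (fc f (c, i, j)))) * ?T"
    unfolding sum_distrib_right
  proof (intro sum.cong refl)
    fix c
    show "(\<Sum>q\<in>{..<d c} \<times> {..<d c}. real (d c) * ?T * norm (fc f (c, q)))
        = real (d c) * (\<Sum>i<d c. \<Sum>j<d c. norm (fc f (c, i, j))) * ?T"
      unfolding sum.cartesian_product by (simp add: sum_distrib_left mult_ac case_prod_unfold)
  qed
  also have "\<dots> \<le> (\<Sum>c\<in>fst ` P. bterm \<gamma> s f c) * ?T"
    by (intro mult_right_mono sum_mono barron_term_ge[OF s]) simp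
  also have "(\<Sum>c\<in>fst ` P. bterm \<gamma> s f c) \<le> bnorm \<gamma> s f"
    unfolding barron_norm_def using f P
    by (intro finite_sum_le_infsum barron_term_nonneg) (auto simp: barron_space_def indices_def)
  finally show ?thesis by (simp add: mult_right_mono)
qed

lemma continuous_average_le:
  fixes f :: "'g \<Rightarrow> 'a::complex_banach"
  assumes f: "f \<in> bspace \<gamma> s" and s: "0 \<le> s" and \<phi>: "cont \<phi>"
  shows "norm (strong_integral M (\<lambda>x. \<phi> x *\<^sub>C f x)) \<le> bnorm \<gamma> s f * (\<integral>x. cmod (\<phi> x) \<partial>M)"
proof (rule field_le_epsilon)
  fix e :: real assume e: "0 < e"
  let ?C = "bnorm \<gamma> s f"
  note Lf = barron_space_L1[OF f]
  \<comment> \<open>A uniform error \<open>r\<close> costs \<open>r * L1_norm M f\<close> in the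
    vector integral and \<open>?C * r\<close> in the L1 norm of the test function; the summand 1
    keeps the denominator positive.\<close>
  define r where "r = e / (?C + L1_norm M f + 1)"
  have den: "0 < ?C + L1_norm M f + 1" using barron_norm_nonneg[of \<gamma> s f] L1_norm_nonneg[of M f] by linarith
  then have r: "0 < r" unfolding r_def using e by simp
  obtain t where t: "t \<in> trig" "\<And>x. cmod (\<phi> x - t x) \<le> r"
    using trig_uniformly_dense[OF \<phi> r] by blast
  have ct: "cont t" by (rule trig_cont[OF t(1)])
  have "norm (strong_integral M (\<lambda>x. \<phi> x *\<^sub>C f x) - strong_integral M (\<lambda>x. t x *\<^sub>C f x))
      = norm (strong_integral M (\<lambda>x. (\<phi> x - t x) *\<^sub>C f x))"
    unfolding scaleC.diff_left strong_integral_diff[OF L1_cont[OF Lf \<phi>] L1_cont[OF Lf ct]] ..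
  also have "\<dots> \<le> L1_norm M (\<lambda>x. (\<phi> x - t x) *\<^sub>C f x)"
    by (intro strong_integral_norm_le L1_cont[OF Lf] continuous_intros \<phi> ct)
  also have "\<dots> \<le> r * L1_norm M f"
    by (intro L1_scaleC(2)[OF Lf] t(2) cont_measurable continuous_intros \<phi> ct)
  finally have 1: "norm (strong_integral M (\<lambda>x. \<phi> x *\<^sub>C f x) - strong_integral M (\<lambda>x. t x *\<^sub>C f x)) \<le> r * L1_norm M f" .
  have "(\<integral>x. cmod (t x) \<partial>M) \<le> (\<integral>x. cmod (\<phi> x) + r \<partial>M)"
  proof (rule integral_mono)
    show "integrable M (\<lambda>x. cmod (t x))" "integrable M (\<lambda>x. cmod (\<phi> x) + r)"
      by (intro cont_integrable continuous_intros ct \<phi>)+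
    show "cmod (t x) \<le> cmod (\<phi> x) + r" for x
      using norm_triangle_sub[of "t x" "\<phi> x"] t(2)[of x] by (simp add: norm_minus_commute)
  qed
  also have "\<dots> = (\<integral>x. cmod (\<phi> x) \<partial>M) + r"
    using cont_integrable[of "\<lambda>x. cmod (\<phi> x)"] \<phi> by (simp add: continuous_intros)
  finally have "?C * (\<integral>x. cmod (t x) \<partial>M) \<le> ?C * ((\<integral>x. cmod (\<phi> x) \<partial>M) + r)"
    by (intro mult_left_mono barron_norm_nonneg)
  with trig_average_le[OF f s t(1)]
  have 2: "norm (strong_integral M (\<lambda>x. t x *\<^sub>C f x)) \<le> ?C * (\<integral>x. cmod (\<phi> x) \<partial>M) + ?C * r"
    by (simp add: distrib_left)
  have "r * L1_norm M f + ?C * r \<le> r * (?C + L1_norm M f + 1)" using r by (simp add: algebra_simps)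
  also have "\<dots> = e" unfolding r_def using den by simp
  finally show "norm (strong_integral M (\<lambda>x. \<phi> x *\<^sub>C f x)) \<le> ?C * (\<integral>x. cmod (\<phi> x) \<partial>M) + e"
    using 1 2 norm_triangle_sub[of "strong_integral M (\<lambda>x. \<phi> x *\<^sub>C f x)" "strong_integral M (\<lambda>x. t x *\<^sub>C f x)"]
    by linarith
qed

lemma AE_norm_le_barron_norm:
  fixes f :: "'g \<Rightarrow> 'a::complex_banach"
  assumes f: "f \<in> bspace \<gamma> s" and s: "0 \<le> s"
  shows "AE x in M. norm (f x) \<le> bnorm \<gamma> s f"
  by (rule AE_norm_le_if_averages_le[OF barron_space_L1[OF f]
      averages_le_if_continuous_averages_le[OF barron_space_L1[OF f] barron_norm_nonneg
      continuous_average_le[OF f s]]])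

lemma Linf_norm_le_barron_norm:
  fixes f :: "'g \<Rightarrow> 'a::complex_banach"
  assumes f: "f \<in> bspace \<gamma> s" and s: "0 \<le> s"
  shows "Linf_norm M f \<le> bnorm \<gamma> s f"
proof (rule field_le_epsilon)
  fix e :: real assume e: "0 < e"
  let ?C = "bnorm \<gamma> s f"
  \<comment> \<open>The infimum runs over strictly positive bounds, so the Barron norm itself may
    not qualify when it is 0.\<close>
  have "AE x in M. norm (f x) \<le> ?C + e"
    using AE_norm_le_barron_norm[OF f s] by eventually_elim (use e in simp)
  then have "?C + e \<in> {C. 0 < C \<and> (AE x in M. norm (f x) \<le> C)}"
    using e by (simp add: add_nonneg_pos barron_norm_nonneg)
  then show "Linf_norm M f \<le> ?C + e"
    unfolding Linf_norm_def by (rule cInf_lower) (auto intro!: bdd_belowI[of _ 0])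
qed

lemma barron_term_add_le:
  fixes f g :: "'g \<Rightarrow> 'a::complex_banach"
  assumes f: "L1 M f" and g: "L1 M g" and c: "c \<in> unitary_dual"
  shows "bterm \<gamma> s (\<lambda>x. f x + g x) c
    \<le> bterm \<gamma> s f c + bterm \<gamma> s g c"
proof -
  have "norm (fc (\<lambda>x. f x + g x) (c, i, j)) \<le> norm (fc f (c, i, j)) + norm (fc g (c, i, j))"
    if "i < d c" "j < d c" for i j
  proof -
    have "(c, i, j) \<in> indices" using that c unfolding indices_def by simp
    then have "fc (\<lambda>x. f x + g x) (c, i, j) = fc f (c, i, j) + fc g (c, i, j)"
      unfolding scaleC_add_right by (intro strong_integral_add L1_coef f g)
    then show ?thesis by (simp add: norm_triangle_ineq)
  qed
  then have "(\<Sum>i<d c. \<Sum>j<d c. norm (fc (\<lambda>x. f x + g x) (c, i, j)))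
      \<le> (\<Sum>i<d c. \<Sum>j<d c. norm (fc f (c, i, j)) + norm (fc g (c, i, j)))"
    by (intro sum_mono) simp
  then show ?thesis
    unfolding barron_term_eq distrib_left[symmetric] sum.distrib[symmetric]
    by (intro mult_left_mono) auto
qed

lemma barron_term_scaleC:
  fixes f :: "'g \<Rightarrow> 'a::complex_banach"
  assumes f: "L1 M f" and c: "c \<in> unitary_dual"
  shows "bterm \<gamma> s (\<lambda>x. a *\<^sub>C f x) c = cmod a * bterm \<gamma> s f c"
proof -
  have "norm (fc (\<lambda>x. a *\<^sub>C f x) (c, i, j)) = cmod a * norm (fc f (c, i, j))"
    if "i < d c" "j < d c" for i j
  proof -
    have "(c, i, j) \<in> indices" using that c unfolding indices_def by simp
    moreover have "(\<lambda>x. coef (c, i, j) x *\<^sub>C a *\<^sub>C f x) = (\<lambda>x. a *\<^sub>C coef (c, i, j) x *\<^sub>C f x)"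
      by (simp add: scaleC_scaleC mult.commute)
    ultimately have "fc (\<lambda>x. a *\<^sub>C f x) (c, i, j) = a *\<^sub>C fc f (c, i, j)"
      using strong_integral_scaleC[OF L1_coef[OF f], of "(c, i, j)" a] by simp
    then show ?thesis by (simp add: norm_scaleC)
  qed
  then have "(\<Sum>i<d c. \<Sum>j<d c. norm (fc (\<lambda>x. a *\<^sub>C f x) (c, i, j)))
      = cmod a * (\<Sum>i<d c. \<Sum>j<d c. norm (fc f (c, i, j)))"
    by (simp add: sum_distrib_left)
  then show ?thesis unfolding barron_term_eq by simp
qed

lemma barron_space_add:
  fixes f g :: "'g \<Rightarrow> 'a::complex_banach"
  assumes f: "f \<in> bspace \<gamma> s" and g: "g \<in> bspace \<gamma> s"
  shows "(\<lambda>x. f x + g x) \<in> bspace \<gamma> s"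
proof -
  have "(\<lambda>c. bterm \<gamma> s f c + bterm \<gamma> s g c) summable_on unitary_dual"
    using f g unfolding barron_space_def by (intro summable_on_add) auto
  then have "bterm \<gamma> s (\<lambda>x. f x + g x) summable_on unitary_dual"
    by (rule summable_on_comparison_test)
       (auto intro!: barron_term_add_le barron_space_L1[OF f] barron_space_L1[OF g] barron_term_nonneg)
  then show ?thesis
    using f g bochner_L2_add[of f M g] unfolding barron_space_def by simp
qed

lemma barron_space_scaleC:
  fixes f :: "'g \<Rightarrow> 'a::complex_banach"
  assumes f: "f \<in> bspace \<gamma> s"
  shows "(\<lambda>x. a *\<^sub>C f x) \<in> bspace \<gamma> s"
proof -
  have "(\<lambda>c. cmod a * bterm \<gamma> s f c) summable_on unitary_dual"
    using f unfolding barron_space_def by (intro summable_on_cmult_right) auto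
  then have "bterm \<gamma> s (\<lambda>x. a *\<^sub>C f x) summable_on unitary_dual"
    using barron_term_scaleC[OF barron_space_L1[OF f]] by (subst summable_on_cong) auto
  then show ?thesis
    using f bochner_L2_scaleC[of f M a] unfolding barron_space_def by simp
qed

text \<open>Every Fourier integrand is null. This is what the injectivity clause of the embedding
  asks for.\<close>

lemma barron_norm_AE_0:
  fixes f :: "'g \<Rightarrow> 'a::complex_banach"
  assumes f: "L1 M f" "AE x in M. f x = 0"
  shows "c \<in> unitary_dual \<Longrightarrow> bterm \<gamma> s f c = 0" "bnorm \<gamma> s f = 0"
proof -
  have term_0: "bterm \<gamma> s f c = 0" if c: "c \<in> unitary_dual" for c
  proof -
    have "fc f (c, i, j) = 0" if "i < d c" "j < d c" for i j
    proof (rule strong_integral_cong_AE_0)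
      show "L1 M (\<lambda>x. coef (c, i, j) x *\<^sub>C f x)"
        using that c by (intro L1_coef f) (simp add: indices_def)
      show "AE x in M. coef (c, i, j) x *\<^sub>C f x = 0"
        using f(2) by eventually_elim (simp add: scaleC.zero_right)
    qed
    then show ?thesis unfolding barron_term_eq by simp
  qed
  then show "c \<in> unitary_dual \<Longrightarrow> bterm \<gamma> s f c = 0" .
  show "bnorm \<gamma> s f = 0"
    unfolding barron_norm_def by (rule infsum_0) (rule term_0)
qed

lemma barron_space_zero: "(\<lambda>x. 0 :: 'a::complex_banach) \<in> bspace \<gamma> s"
proof -
  have z: "strongly_measurable M (\<lambda>x. 0 :: 'a)" by (rule strongly_measurable_simple) simp
  then have "(\<lambda>x. 0 :: 'a) \<in> bochner_L2 M" unfolding bochner_L2_iff by simp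
  moreover have "bterm \<gamma> s (\<lambda>x. 0 :: 'a) c = 0" if "c \<in> unitary_dual" for c
    by (rule barron_norm_AE_0(1)[OF L1_simple _ that]) auto
  then have "bterm \<gamma> s (\<lambda>x. 0 :: 'a) summable_on unitary_dual"
    by (subst summable_on_cong[of _ _ "\<lambda>_. 0"]) auto
  ultimately show ?thesis unfolding barron_space_def by simp
qed

text \<open>Membership in \<open>bochner_Linf\<close> makes the infimum range over a nonempty set,
  so arbitrarily small essential bounds exist; countably many of them hold simultaneously almost
  everywhere.\<close>

lemma Linf_norm_0_imp:
  fixes f :: "'g \<Rightarrow> 'a::complex_banach"
  assumes f: "f \<in> bochner_Linf M" and 0: "Linf_norm M f = 0"
  shows "AE x in M. f x = 0"
proof -
  let ?S = "{C. 0 < C \<and> (AE x in M. norm (f x) \<le> C)}"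
  have "?S \<noteq> {}" using f unfolding bochner_Linf_def by blast
  have "AE x in M. norm (f x) \<le> 1 / Suc n" for n
  proof -
    have "Inf ?S < 1 / Suc n" using 0 unfolding Linf_norm_def by simp
    then obtain C where "C \<in> ?S" "C < 1 / Suc n" using \<open>?S \<noteq> {}\<close> by (metis (no_types, lifting) cInf_lessD)
    then have "AE x in M. norm (f x) \<le> C" by simp
    then show ?thesis by eventually_elim (use \<open>C < 1 / Suc n\<close> in linarith)
  qed
  then have "AE x in M. \<forall>n::nat. norm (f x) \<le> 1 / Suc n" unfolding AE_all_countable by simp
  then show ?thesis
  proof eventually_elim
    case (elim x)
    have "norm (f x) \<le> 0"
      by (rule LIMSEQ_le_const[OF LIMSEQ_inverse_real_of_nat[unfolded inverse_eq_divide]])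
         (use elim in auto)
    then show ?case by simp
  qed
qed

end

theorem theorem3p10:
  fixes \<mu> :: "'g::{topological_group_add, t2_space} measure"
    and rep :: "'g rep set \<Rightarrow> 'g rep"
    and \<xi> :: "'g rep set \<Rightarrow> nat \<Rightarrow> complex Matrix.vec"
    and \<gamma> :: "'g rep set \<Rightarrow> real"
    and s :: real
  assumes compact: "compact (UNIV :: 'g set)"
    and haar: "normalized_haar_measure \<mu>"
    and choice: "dual_choice rep \<xi>"
    and \<gamma>_meas: "\<gamma> \<in> borel_measurable (count_space unitary_dual)"
    and \<gamma>_pos: "\<forall>c\<in>unitary_dual. 0 < \<gamma> c"
    and s: "0 \<le> s"
  shows "continuously_embeds
           (barron_space \<mu> rep \<xi> \<gamma> s :: ('g \<Rightarrow> 'a::complex_banach) set)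
           (barron_norm \<mu> rep \<xi> \<gamma> s)
           (bochner_Linf \<mu>) (Linf_norm \<mu>)
       \<and> (\<forall>f \<in> (barron_space \<mu> rep \<xi> \<gamma> s :: ('g \<Rightarrow> 'a) set).
            Linf_norm \<mu> f \<le> barron_norm \<mu> rep \<xi> \<gamma> s f)"
proof -
  interpret compact_haar_dual \<mu> rep \<xi>
    using compact haar choice by unfold_locales
  let ?X = "barron_space \<mu> rep \<xi> \<gamma> s :: ('g \<Rightarrow> 'a) set"
  have Linf: "f \<in> bochner_Linf \<mu>" if f: "f \<in> ?X" for f
  proof -
    \<comment> \<open>The summand 1 makes the essential bound strictly positive, as
      \<open>bochner_Linf\<close> demands.\<close>
    have "AE x in \<mu>. norm (f x) \<le> barron_norm \<mu> rep \<xi> \<gamma> s f + 1"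
      using AE_norm_le_barron_norm[OF f s] by eventually_elim simp
    moreover have "0 < barron_norm \<mu> rep \<xi> \<gamma> s f + 1" by (simp add: add_nonneg_pos barron_norm_nonneg)
    moreover have "strongly_measurable \<mu> f" using barron_space_L1[OF f] unfolding L1_def by simp
    ultimately show ?thesis unfolding bochner_Linf_def by blast
  qed
  have diff: "(\<lambda>x. g x - f x) \<in> ?X" if "f \<in> ?X" "g \<in> ?X" for f g
  proof -
    have "(\<lambda>x. g x - f x) = (\<lambda>x. g x + (-1) *\<^sub>C f x)"
      by (simp add: scaleC.minus_left scaleC_one)
    then show ?thesis using barron_space_add[OF that(2) barron_space_scaleC[OF that(1), of "-1"]] by simp
  qed
  \<comment> \<open>The identity has norm at most 1, so \<delta> = \<epsilon> works at every
    point.\<close>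
  have cont: "\<exists>\<delta>>0. \<forall>g\<in>?X. barron_norm \<mu> rep \<xi> \<gamma> s (\<lambda>x. g x - f x) < \<delta> \<longrightarrow>
      Linf_norm \<mu> (\<lambda>x. g x - f x) < \<epsilon>" if f: "f \<in> ?X" and \<epsilon>: "0 < \<epsilon>" for f \<epsilon>
  proof (intro exI[of _ \<epsilon>] conjI \<epsilon> ballI impI)
    fix g assume g: "g \<in> ?X" and less: "barron_norm \<mu> rep \<xi> \<gamma> s (\<lambda>x. g x - f x) < \<epsilon>"
    show "Linf_norm \<mu> (\<lambda>x. g x - f x) < \<epsilon>"
      by (rule le_less_trans[OF Linf_norm_le_barron_norm[OF diff[OF f g] s] less])
  qed
  have inj: "barron_norm \<mu> rep \<xi> \<gamma> s f = 0" if f: "f \<in> ?X" "Linf_norm \<mu> f = 0" for f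
    by (rule barron_norm_AE_0(2)[OF barron_space_L1[OF f(1)] Linf_norm_0_imp[OF Linf[OF f(1)] f(2)]])
  show ?thesis
    unfolding continuously_embeds_def
  proof (intro conjI ballI allI impI subsetI)
    show "(\<lambda>x. 0) \<in> ?X" by (rule barron_space_zero)
  qed (fact barron_space_add barron_space_scaleC Linf cont inj Linf_norm_le_barron_norm[OF _ s])+
qed

end
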